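(* Let $G$ be a group and let $\{R_i \mid i\in \mathcal{I}\}$ be a collection of $*$-regular subrings of $\mathcal{U}(G)$. Then $\bigcap_{i\in \mathcal{I}} R_i$ is also a $*$-regular subring of $\mathcal{U}(G)$.
   Context: All rings have a $1$ and subrings have the same $1$. For a group $G$, $\ell^2(G)$ is the Hilbert space with orthonormal basis $G$; $\mathbb{C}G$ acts on the left of $\ell^2(G)$ by bounded operators (left regular representation), and $\mathcal{N}(G)$ (the group von Neumann algebra) is the weak closure of $\mathbb{C}G$ in the bounded operators on $\ell^2(G)$. $\mathcal{U}(G)$ is the algebra of (closed, densely defined) unbounded operators on $\ell^2(G)$ affiliated to $\mathcal{N}(G)$. The adjoint involution of $\mathcal{N}(G)$ extends to an involution $*$ on $\mathcal{U}(G)$, and $\mathcal{U}(G)$ is a finite $*$-regular algebra (finite: $xy=1$ implies $yx=1$). A ring $R$ is (von Neumann) regular if for every $x\in R$ there is an idempotent $e\in R$ with $xR=eR$. A $*$-regular ring is a regular ring $R$ with an involution $*$ such that $x\in R$ and $x^*x=0$ imply $x=0$. In a $*$-regular ring, for each $x\in R$ there is a unique projection $e$ ($e=e^*=e^2$) with $xR=eR$. A $*$-regular subring of $\mathcal{U}(G)$ is a subring closed under the involution of $\mathcal{U}(G)$ that is $*$-regular with respect to the restricted involution. *)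

theory Defs
  imports "HOL-Analysis.Analysis" "HOL-Algebra.Subrings"
begin

section \<open>The Hilbert space of square-summable complex functions\<close>

typedef 'a ell2 = "{f :: 'a \<Rightarrow> complex. (\<lambda>x. (cmod (f x))\<^sup>2) summable_on UNIV}"
  morphisms coord Abs_ell2
  by (rule exI[of _ "\<lambda>_. 0"]) simp

setup_lifting type_definition_ell2

lemma ell2_eqI: "(\<And>x. coord f x = coord g x) \<Longrightarrow> f = g"
  by (metis coord_inject ext)

lemma coord_summable: "(\<lambda>x. (cmod (coord f x))\<^sup>2) summable_on UNIV"
  using coord[of f] by simp

lemma square_summable_add:
  assumes "(\<lambda>x. (cmod (f x))\<^sup>2) summable_on UNIV" "(\<lambda>x. (cmod (g x))\<^sup>2) summable_on UNIV"
  shows "(\<lambda>x. (cmod (f x + g x))\<^sup>2) summable_on UNIV"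
proof (rule summable_on_comparison_test)
  show "(\<lambda>x. 2 * (cmod (f x))\<^sup>2 + 2 * (cmod (g x))\<^sup>2) summable_on UNIV"
    by (intro summable_on_add summable_on_cmult_right assms)
  show "(cmod (f x + g x))\<^sup>2 \<le> 2 * (cmod (f x))\<^sup>2 + 2 * (cmod (g x))\<^sup>2" for x
  proof -
    have "(cmod (f x + g x))\<^sup>2 \<le> (cmod (f x) + cmod (g x))\<^sup>2"
      by (intro power_mono norm_triangle_ineq) simp
    also have "\<dots> \<le> 2 * (cmod (f x))\<^sup>2 + 2 * (cmod (g x))\<^sup>2"
      using zero_le_power2[of "cmod (f x) - cmod (g x)"]
      by (simp add: power2_sum power2_diff)
    finally show ?thesis .
  qed
qed simp

lemma square_summable_scale:
  assumes "(\<lambda>x. (cmod (f x))\<^sup>2) summable_on UNIV"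
  shows "(\<lambda>x. (cmod (c * f x))\<^sup>2) summable_on UNIV"
  using summable_on_cmult_right[OF assms, of "(cmod c)\<^sup>2"]
  by (simp add: norm_mult power_mult_distrib)

lemma ell2_product_summable: "(\<lambda>x. coord f x * cnj (coord g x)) summable_on UNIV"
proof (rule abs_summable_summable, rule Infinite_Sum.abs_summable_on_comparison_test')
  show "(\<lambda>x. (cmod (coord f x))\<^sup>2 + (cmod (coord g x))\<^sup>2) summable_on UNIV"
    by (intro summable_on_add coord_summable)
  show "cmod (coord f x * cnj (coord g x)) \<le> (cmod (coord f x))\<^sup>2 + (cmod (coord g x))\<^sup>2" for x
  proof -
    have "0 \<le> (cmod (coord f x) - cmod (coord g x))\<^sup>2" "0 \<le> cmod (coord f x) * cmod (coord g x)"
      by simp_all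
    then show ?thesis
      unfolding norm_mult power2_diff complex_mod_cnj by linarith
  qed
qed

text \<open>The inner product is linear in its first argument.\<close>

definition cinner :: "'a ell2 \<Rightarrow> 'a ell2 \<Rightarrow> complex"
  where "cinner f g = (\<Sum>\<^sub>\<infinity>x. coord f x * cnj (coord g x))"

lift_definition scaleC :: "complex \<Rightarrow> 'a ell2 \<Rightarrow> 'a ell2"  (infixr "*\<^sub>C" 75)
  is "\<lambda>c f x. c * f x"
  by (simp add: square_summable_scale)

instantiation ell2 :: (type) real_inner
begin

lift_definition zero_ell2 :: "'a ell2" is "\<lambda>_. 0" by simp

lift_definition plus_ell2 :: "'a ell2 \<Rightarrow> 'a ell2 \<Rightarrow> 'a ell2" is "\<lambda>f g x. f x + g x"
  by (simp add: square_summable_add)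

lift_definition uminus_ell2 :: "'a ell2 \<Rightarrow> 'a ell2" is "\<lambda>f x. - f x"
  by simp

definition minus_ell2 :: "'a ell2 \<Rightarrow> 'a ell2 \<Rightarrow> 'a ell2" where "(f :: 'a ell2) - g = f + - g"

definition scaleR_ell2 :: "real \<Rightarrow> 'a ell2 \<Rightarrow> 'a ell2" where "r *\<^sub>R (f :: 'a ell2) = of_real r *\<^sub>C f"

definition inner_ell2 :: "'a ell2 \<Rightarrow> 'a ell2 \<Rightarrow> real" where "inner f g = Re (cinner f g)"

definition norm_ell2 :: "'a ell2 \<Rightarrow> real" where "norm (f :: 'a ell2) = sqrt (\<Sum>\<^sub>\<infinity>x. (cmod (coord f x))\<^sup>2)"

definition dist_ell2 :: "'a ell2 \<Rightarrow> 'a ell2 \<Rightarrow> real" where "dist (f :: 'a ell2) g = norm (f - g)"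

definition sgn_ell2 :: "'a ell2 \<Rightarrow> 'a ell2" where "sgn (f :: 'a ell2) = inverse (norm f) *\<^sub>R f"

definition uniformity_ell2 :: "('a ell2 \<times> 'a ell2) filter"
  where "uniformity = (INF e\<in>{0<..}. principal {(f :: 'a ell2, g). dist f g < e})"

definition open_ell2 :: "'a ell2 set \<Rightarrow> bool"
  where "open (U :: 'a ell2 set) \<longleftrightarrow> (\<forall>f\<in>U. eventually (\<lambda>(f', g). f' = f \<longrightarrow> g \<in> U) uniformity)"

instance
proof
  fix f g h :: "'a ell2" and r s :: real
  show "f + g + h = f + (g + h)" by transfer (simp add: algebra_simps)
  show "f + g = g + f" by transfer (simp add: algebra_simps)
  show "0 + f = f" by transfer simp
  show "- f + f = 0" by transfer simp
  show "f - g = f + - g" by (rule minus_ell2_def)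
  show "r *\<^sub>R (f + g) = r *\<^sub>R f + r *\<^sub>R g"
    unfolding scaleR_ell2_def by transfer (simp add: algebra_simps)
  show "(r + s) *\<^sub>R f = r *\<^sub>R f + s *\<^sub>R f"
    unfolding scaleR_ell2_def by transfer (simp add: algebra_simps)
  show "r *\<^sub>R s *\<^sub>R f = (r * s) *\<^sub>R f"
    unfolding scaleR_ell2_def by transfer (simp add: algebra_simps)
  show "1 *\<^sub>R f = f"
    unfolding scaleR_ell2_def by transfer simp
  show "dist f g = norm (f - g)" by (rule dist_ell2_def)
  show "sgn f = inverse (norm f) *\<^sub>R f" by (rule sgn_ell2_def)
  show "uniformity = (INF e\<in>{0<..}. principal {(f :: 'a ell2, g). dist f g < e})"
    by (rule uniformity_ell2_def)
  show "open U \<longleftrightarrow> (\<forall>f\<in>U. eventually (\<lambda>(f', g). f' = f \<longrightarrow> g \<in> U) uniformity)"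
    for U :: "'a ell2 set"
    by (rule open_ell2_def)
  have "cinner g f = (\<Sum>\<^sub>\<infinity>x. cnj (coord f x * cnj (coord g x)))"
    by (simp add: cinner_def mult.commute)
  then have "cinner g f = cnj (cinner f g)"
    by (simp only: infsum_cnj cinner_def)
  then show "inner f g = inner g f" by (simp add: inner_ell2_def)
  have "cinner (f + g) h = cinner f h + cinner g h"
    by (simp add: cinner_def plus_ell2.rep_eq ring_distribs infsum_add[OF ell2_product_summable ell2_product_summable])
  then show "inner (f + g) h = inner f h + inner g h" by (simp add: inner_ell2_def)
  have "cinner (r *\<^sub>R f) g = of_real r * cinner f g"
    by (simp add: cinner_def scaleR_ell2_def scaleC.rep_eq mult.assoc infsum_cmult_right')
  then show "inner (r *\<^sub>R f) g = r * inner f g" by (simp add: inner_ell2_def)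
  have sq: "inner f f = (\<Sum>\<^sub>\<infinity>x. (cmod (coord f x))\<^sup>2)"
  proof -
    have "inner f f = (\<Sum>\<^sub>\<infinity>x. Re (coord f x * cnj (coord f x)))"
      unfolding inner_ell2_def cinner_def by (rule infsum_Re[OF ell2_product_summable, symmetric])
    also have "\<dots> = (\<Sum>\<^sub>\<infinity>x. (cmod (coord f x))\<^sup>2)"
      by (rule infsum_cong) (metis Re_complex_of_real complex_norm_square)
    finally show ?thesis .
  qed
  show "0 \<le> inner f f" by (simp add: sq infsum_nonneg)
  show "norm f = sqrt (inner f f)" by (simp add: sq norm_ell2_def)
  show "inner f f = 0 \<longleftrightarrow> f = 0"
  proof
    assume "inner f f = 0"
    then have "(cmod (coord f x))\<^sup>2 = 0" for x
      by (intro nonneg_infsum_le_0D[OF _ coord_summable]) (simp_all add: sq)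
    then show "f = 0" by (intro ell2_eqI) (simp add: zero_ell2.rep_eq)
  next
    assume "f = 0"
    then show "inner f f = 0" using sq by (simp add: zero_ell2.rep_eq)
  qed
qed

end


section \<open>The algebra of affiliated operators\<close>

text \<open>
  The group is given by a carrier set, so its Hilbert space is the closed subspace of functions
  vanishing off the carrier.
\<close>

definition l2 :: "('a, 'b) monoid_scheme \<Rightarrow> 'a ell2 set"
  where "l2 G = {f. \<forall>x. x \<notin> carrier G \<longrightarrow> coord f x = 0}"

text \<open>The continuous extension of the map sending the basis vector \<open>h\<close> to \<open>g h\<close>.\<close>

definition left_translation :: "('a, 'b) monoid_scheme \<Rightarrow> 'a \<Rightarrow> 'a ell2 \<Rightarrow> 'a ell2"
  where "left_translation G g f =
    Abs_ell2 (\<lambda>x. if x \<in> carrier G then coord f (inv\<^bsub>G\<^esub> g \<otimes>\<^bsub>G\<^esub> x) else 0)"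

lemma coord_left_translation:
  assumes "group G" "g \<in> carrier G"
  shows "coord (left_translation G g f) x =
    (if x \<in> carrier G then coord f (inv\<^bsub>G\<^esub> g \<otimes>\<^bsub>G\<^esub> x) else 0)"
proof -
  interpret group G by fact
  let ?s = "\<lambda>x. inv\<^bsub>G\<^esub> g \<otimes>\<^bsub>G\<^esub> x"
  have inj: "inj_on ?s (carrier G)"
    using assms(2) by (auto intro!: inj_onI)
  have "(\<lambda>x. (cmod (coord f x))\<^sup>2) summable_on ?s ` carrier G"
    by (rule summable_on_subset_banach[OF coord_summable]) simp
  then have "(\<lambda>x. (cmod (coord f (?s x)))\<^sup>2) summable_on carrier G"
    using summable_on_reindex[OF inj, of "\<lambda>x. (cmod (coord f x))\<^sup>2"] by (simp add: o_def)
  then have "(\<lambda>x. (cmod (if x \<in> carrier G then coord f (?s x) else 0))\<^sup>2) summable_on UNIV"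
    by (rule summable_on_cong_neutral[THEN iffD1, rotated -1]) auto
  then show ?thesis
    by (simp add: left_translation_def Abs_ell2_inverse)
qed

text \<open>
  Everywhere defined operators are represented by functions of which only the values on \<open>l2 G\<close>
  matter.
\<close>

definition bounded_operators :: "('a, 'b) monoid_scheme \<Rightarrow> ('a ell2 \<Rightarrow> 'a ell2) set"
  where "bounded_operators G = {A.
    (\<forall>u\<in>l2 G. A u \<in> l2 G) \<and>
    (\<forall>u\<in>l2 G. \<forall>v\<in>l2 G. A (u + v) = A u + A v) \<and>
    (\<forall>c. \<forall>u\<in>l2 G. A (c *\<^sub>C u) = c *\<^sub>C A u) \<and>
    (\<exists>K. \<forall>u\<in>l2 G. norm (A u) \<le> K * norm u)}"

definition group_algebra_operators :: "('a, 'b) monoid_scheme \<Rightarrow> ('a ell2 \<Rightarrow> 'a ell2) set"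
  where "group_algebra_operators G =
    {\<lambda>u. \<Sum>g\<in>S. c g *\<^sub>C left_translation G g u | S c. finite S \<and> S \<subseteq> carrier G}"

text \<open>
  Closure in the weak operator topology: the sets tested below are the basic neighbourhoods of
  \<open>T\<close>.
\<close>

definition group_von_neumann_algebra :: "('a, 'b) monoid_scheme \<Rightarrow> ('a ell2 \<Rightarrow> 'a ell2) set"
  where "group_von_neumann_algebra G = {T \<in> bounded_operators G.
    \<forall>F \<epsilon>. finite F \<longrightarrow> F \<subseteq> l2 G \<times> l2 G \<longrightarrow> \<epsilon> > 0 \<longrightarrow>
      (\<exists>A\<in>group_algebra_operators G. \<forall>(u, v)\<in>F. cmod (cinner (T u - A u) v) < \<epsilon>)}"

definition commutant ::
  "('a, 'b) monoid_scheme \<Rightarrow> ('a ell2 \<Rightarrow> 'a ell2) set \<Rightarrow> ('a ell2 \<Rightarrow> 'a ell2) set"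
  where "commutant G M =
    {S \<in> bounded_operators G. \<forall>T\<in>M. \<forall>u\<in>l2 G. S (T u) = T (S u)}"

definition unitary_operator :: "('a, 'b) monoid_scheme \<Rightarrow> ('a ell2 \<Rightarrow> 'a ell2) \<Rightarrow> bool"
  where "unitary_operator G U \<longleftrightarrow> U \<in> bounded_operators G \<and> bij_betw U (l2 G) (l2 G) \<and>
    (\<forall>u\<in>l2 G. \<forall>v\<in>l2 G. cinner (U u) (U v) = cinner u v)"

text \<open>A partially defined operator is represented by its graph.\<close>

definition linear_operator :: "('a, 'b) monoid_scheme \<Rightarrow> ('a ell2 \<times> 'a ell2) set \<Rightarrow> bool"
  where "linear_operator G T \<longleftrightarrow> T \<subseteq> l2 G \<times> l2 G \<and> single_valued T \<and> (0, 0) \<in> T \<and>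
    (\<forall>(u, v)\<in>T. \<forall>(u', v')\<in>T. (u + u', v + v') \<in> T) \<and>
    (\<forall>c. \<forall>(u, v)\<in>T. (c *\<^sub>C u, c *\<^sub>C v) \<in> T)"

definition densely_defined :: "('a, 'b) monoid_scheme \<Rightarrow> ('a ell2 \<times> 'a ell2) set \<Rightarrow> bool"
  where "densely_defined G T \<longleftrightarrow> l2 G \<subseteq> closure (Domain T)"

text \<open>
  \<open>T\<close> is affiliated to \<open>M\<close> if \<open>U T U\<^sup>* = T\<close> for every unitary \<open>U\<close> in the commutant of \<open>M\<close>; the graph
  of \<open>U T U\<^sup>*\<close> is the image of that of \<open>T\<close> under \<open>U \<times> U\<close>.
\<close>

definition affiliated ::
  "('a, 'b) monoid_scheme \<Rightarrow> ('a ell2 \<Rightarrow> 'a ell2) set \<Rightarrow> ('a ell2 \<times> 'a ell2) set \<Rightarrow> bool"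
  where "affiliated G M T \<longleftrightarrow>
    (\<forall>U\<in>commutant G M. unitary_operator G U \<longrightarrow> map_prod U U ` T = T)"

definition adjoint_operator ::
  "('a, 'b) monoid_scheme \<Rightarrow> ('a ell2 \<times> 'a ell2) set \<Rightarrow> ('a ell2 \<times> 'a ell2) set"
  where "adjoint_operator G T =
    {(u, v) \<in> l2 G \<times> l2 G. \<forall>(x, y)\<in>T. cinner y u = cinner x v}"

record 'a star_ring = "'a ring" +
  star :: "'a \<Rightarrow> 'a"

text \<open>
  Sum and product are the closures of the naive sum and composite (the Murray--von Neumann
  operations). As \<open>O\<close> composes relations from left to right, \<open>S\<close> after \<open>T\<close> is \<open>T O S\<close>.
\<close>

definition affiliated_algebra ::
  "('a, 'b) monoid_scheme \<Rightarrow> ('a ell2 \<times> 'a ell2) set star_ring"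
  where "affiliated_algebra G = \<lparr>
    carrier = {T. linear_operator G T \<and> closed T \<and> densely_defined G T \<and>
                  affiliated G (group_von_neumann_algebra G) T},
    mult = (\<lambda>S T. closure (T O S)),
    one = Id_on (l2 G),
    zero = l2 G \<times> {0},
    add = (\<lambda>S T. closure {(u, v + w) | u v w. (u, v) \<in> S \<and> (u, w) \<in> T}),
    star = adjoint_operator G\<rparr>"


section \<open>Star-regular rings\<close>

definition regular_ring :: "('a, 'm) ring_scheme \<Rightarrow> bool"
  where "regular_ring R \<longleftrightarrow> ring R \<and>
    (\<forall>x\<in>carrier R. \<exists>e\<in>carrier R. e \<otimes>\<^bsub>R\<^esub> e = e \<and> x <#\<^bsub>R\<^esub> carrier R = e <#\<^bsub>R\<^esub> carrier R)"

definition involutive :: "('a, 'm) star_ring_scheme \<Rightarrow> bool"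
  where "involutive R \<longleftrightarrow>
    (\<forall>x\<in>carrier R. star R x \<in> carrier R \<and> star R (star R x) = x) \<and>
    (\<forall>x\<in>carrier R. \<forall>y\<in>carrier R.
      star R (x \<oplus>\<^bsub>R\<^esub> y) = star R x \<oplus>\<^bsub>R\<^esub> star R y \<and>
      star R (x \<otimes>\<^bsub>R\<^esub> y) = star R y \<otimes>\<^bsub>R\<^esub> star R x)"

definition star_regular_ring :: "('a, 'm) star_ring_scheme \<Rightarrow> bool"
  where "star_regular_ring R \<longleftrightarrow> regular_ring R \<and> involutive R \<and>
    (\<forall>x\<in>carrier R. star R x \<otimes>\<^bsub>R\<^esub> x = \<zero>\<^bsub>R\<^esub> \<longrightarrow> x = \<zero>\<^bsub>R\<^esub>)"

definition star_regular_subring :: "'a set \<Rightarrow> ('a, 'm) star_ring_scheme \<Rightarrow> bool"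
  where "star_regular_subring S R \<longleftrightarrow> subring S R \<and> (\<forall>x\<in>S. star R x \<in> S) \<and>
    star_regular_ring (R\<lparr>carrier := S\<rparr>)"

end

theory Submission
  imports Defs
begin

text \<open>
  In a \<open>*\<close>-regular ring every element has a unique Moore--Penrose inverse. By uniqueness it is the
  same in \<open>\<U>(G)\<close> and in each \<open>*\<close>-regular subring containing the element, so it lies in the intersection
  and makes the intersection regular.

  The index set may be empty, so this needs that \<open>\<U>(G)\<close> itself is a \<open>*\<close>-regular ring. The argument
  avoids spectral theory. A closed subspace \<open>K\<close> of a finite power of \<open>\<ell>\<^sup>2(G)\<close>, viewed as a real Hilbert
  space, that is invariant under right translations has the dimension \<open>\<Sum>\<^sub>b \<langle>P\<^sub>K b, b\<rangle>\<close>, where \<open>b\<close> runs over the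
  vectors \<open>\<delta>\<^sub>1\<close> and \<open>\<i>\<delta>\<^sub>1\<close> in each coordinate. It vanishes only for \<open>K = 0\<close>, and it satisfies the rank-nullity
  theorem: the traces of \<open>(1 - A\<^sup>* A)\<^sup>k\<close> and \<open>(1 - A A\<^sup>*)\<^sup>k\<close> differ by a constant, and by the mean ergodic
  theorem their averages converge to the dimensions of the kernels of \<open>A\<close> and \<open>A\<^sup>*\<close>. The graph of an
  affiliated operator has the dimension of \<open>\<ell>\<^sup>2(G)\<close>; hence such an operator has no proper closed densely
  defined restriction, and, counting dimensions, naive sums and composites are densely defined. The
  ring axioms then hold because both sides extend a common densely defined operator.
\<close>

section \<open>Orthogonal projections in Hilbert spaces\<close>

text \<open>Rank-nullity is usually derived from the polar decomposition. Here the kernel projection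
  is reached through powers of \<open>1 - A'A\<close> instead: their averages converge strongly, and
  the dimension is a finite sum of matrix coefficients, so strong convergence is enough. From the
  trace one then needs only tr(HF) = tr(FH) for equivariant maps with adjoints.

  Working over the reals gives each coordinate two basis vectors, which rescales all dimensions
  alike; in return complex linearity has to be carried along separately. Similarly, affiliation
  concerns every unitary of the commutant while the dimension uses right translations only.
  Relations between vectors are therefore required to respect all these unitaries, and the passage
  to dimensions forgets most of them.

  Four copies of the space are used because the axioms checked by counting involve three operators
  and one starting vector. One distributive law would need more unknowns; it is obtained from the
  other through the involution.\<close>

instance ell2 :: (type) complete_space
proof
  fix X :: "nat \<Rightarrow> 'a ell2"
  assume X: "Cauchy X"
  have sq: "(norm f)\<^sup>2 = (\<Sum>\<^sub>\<infinity>x. (cmod (coord f x))\<^sup>2)" for f :: "'a ell2"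
    by (simp add: norm_ell2_def infsum_nonneg)
  have fin: "(\<Sum>x\<in>F. (cmod (coord f x))\<^sup>2) \<le> (norm f)\<^sup>2" if "finite F" for F and f :: "'a ell2"
    unfolding sq by (rule finite_sum_le_infsum[OF coord_summable that]) auto
  have diff: "coord (f - g) x = coord f x - coord g x" for f g :: "'a ell2" and x
    unfolding minus_ell2_def plus_ell2.rep_eq uminus_ell2.rep_eq by simp
  have cle: "cmod (coord f x) \<le> norm f" for f :: "'a ell2" and x
    using fin[of "{x}" f] by (simp add: power_mono_iff)
  have "Cauchy (\<lambda>n. coord (X n) x)" for x
    unfolding Cauchy_def
  proof (intro allI impI)
    fix e :: real assume "e > 0"
    then obtain M where M: "\<forall>m\<ge>M. \<forall>n\<ge>M. dist (X m) (X n) < e"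
      using X unfolding Cauchy_def by blast
    have "dist (coord (X m) x) (coord (X n) x) < e" if "m \<ge> M" "n \<ge> M" for m n
    proof -
      have "norm (X m - X n) < e" using M that by (simp add: dist_norm)
      then show ?thesis using cle[of "X m - X n" x] by (simp add: dist_norm diff)
    qed
    then show "\<exists>M. \<forall>m\<ge>M. \<forall>n\<ge>M. dist (coord (X m) x) (coord (X n) x) < e" by blast
  qed
  then have "\<exists>l. (\<lambda>n. coord (X n) x) \<longlonglongrightarrow> l" for x
    by (simp add: Cauchy_convergent_iff convergent_def)
  then obtain l where l: "\<And>x. (\<lambda>n. coord (X n) x) \<longlonglongrightarrow> l x" by metis
  have bound: "(\<Sum>x\<in>F. (cmod (coord (X n) x - l x))\<^sup>2) \<le> e\<^sup>2"
    if "finite F" "\<forall>m\<ge>M. norm (X n - X m) \<le> e" "e > 0" for F n M e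
  proof (rule Lim_bounded)
    show "(\<lambda>m. \<Sum>x\<in>F. (cmod (coord (X n) x - coord (X m) x))\<^sup>2)
        \<longlonglongrightarrow> (\<Sum>x\<in>F. (cmod (coord (X n) x - l x))\<^sup>2)"
      by (intro tendsto_intros l)
    show "\<forall>m\<ge>M. (\<Sum>x\<in>F. (cmod (coord (X n) x - coord (X m) x))\<^sup>2) \<le> e\<^sup>2"
    proof (intro allI impI)
      fix m assume "m \<ge> M"
      then have "(norm (X n - X m))\<^sup>2 \<le> e\<^sup>2" using that by (intro power_mono) auto
      then show "(\<Sum>x\<in>F. (cmod (coord (X n) x - coord (X m) x))\<^sup>2) \<le> e\<^sup>2"
        using fin[OF that(1), of "X n - X m"] by (simp add: diff)
    qed
  qed
  have summ: "(\<lambda>x. (cmod (coord (X n) x - l x))\<^sup>2) summable_on UNIV"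
    if "\<forall>m\<ge>M. norm (X n - X m) \<le> e" "e > 0" for n M e
    by (rule nonneg_bdd_above_summable_on) (auto intro!: bdd_aboveI bound[OF _ that])
  obtain M where "\<forall>m\<ge>M. \<forall>n\<ge>M. dist (X m) (X n) < 1"
    using X unfolding Cauchy_def by (metis zero_less_one)
  then have M: "\<forall>m\<ge>M. norm (X M - X m) \<le> 1" by (auto simp: dist_norm intro: less_imp_le)
  have "(\<lambda>x. (cmod (coord (X M) x + - (coord (X M) x - l x)))\<^sup>2) summable_on UNIV"
    by (rule square_summable_add[OF coord_summable]) (use summ[OF M] in \<open>simp only: norm_minus_cancel\<close>)
  then have "(\<lambda>x. (cmod (l x))\<^sup>2) summable_on UNIV" by simp
  then have L: "coord (Abs_ell2 l) = l" by (simp add: Abs_ell2_inverse)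
  have "X \<longlonglongrightarrow> Abs_ell2 l"
  proof (rule metric_LIMSEQ_I)
    fix r :: real assume "r > 0"
    then obtain M where M: "\<forall>m\<ge>M. \<forall>n\<ge>M. dist (X m) (X n) < r / 2"
      using X unfolding Cauchy_def by (meson half_gt_zero)
    have "dist (X n) (Abs_ell2 l) < r" if "n \<ge> M" for n
    proof -
      have *: "\<forall>m\<ge>M. norm (X n - X m) \<le> r / 2"
        using M that by (auto simp: dist_norm intro: less_imp_le)
      have "(norm (X n - Abs_ell2 l))\<^sup>2 \<le> (r / 2)\<^sup>2"
        unfolding sq diff L
        by (rule infsum_le_finite_sums[OF summ[OF *]]) (use \<open>r > 0\<close> bound[OF _ *] in auto)
      then have "norm (X n - Abs_ell2 l) \<le> r / 2"
        using \<open>r > 0\<close> by (simp add: power2_le_iff_abs_le)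
      then show ?thesis using \<open>r > 0\<close> by (simp add: dist_norm)
    qed
    then show "\<exists>no. \<forall>n\<ge>no. dist (X n) (Abs_ell2 l) < r" by blast
  qed
  then show "convergent X" by (auto simp: convergent_def)
qed

text \<open>A minimizing sequence is Cauchy and its limit is a nearest point. Nearest points of a
  convex set satisfy a variational inequality, which on a subspace applies to \<open>k\<close> and
  \<open>- k\<close> alike and so becomes orthogonality.\<close>

lemma subspace_closest_point_exists:
  fixes x :: "'e::{real_inner, complete_space}"
  assumes K: "closed K" "subspace K"
  shows "\<exists>p\<in>K. \<forall>k\<in>K. (x - p) \<bullet> k = 0"
proof -
  have ne: "K \<noteq> {}" using K subspace_0 by blast
  define d where "d = infdist x K"
  have d: "d \<le> norm (x - k)" if "k \<in> K" for k
    using infdist_le[OF that, of x] by (simp add: d_def dist_norm)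
  have d0: "d \<ge> 0" by (simp add: d_def infdist_nonneg)
  have "\<exists>p\<in>K. (norm (x - p))\<^sup>2 < d\<^sup>2 + inverse (Suc n)" for n
  proof (rule ccontr)
    assume "\<not> ?thesis"
    then have "sqrt (d\<^sup>2 + inverse (Suc n)) \<le> dist x p" if "p \<in> K" for p
      using that by (intro real_le_lsqrt) (auto simp: dist_norm not_less)
    then have "sqrt (d\<^sup>2 + inverse (Suc n)) \<le> d"
      unfolding d_def infdist_notempty[OF ne] by (intro cINF_greatest ne)
    then have "(sqrt (d\<^sup>2 + inverse (Suc n)))\<^sup>2 \<le> d\<^sup>2" by (intro power_mono) auto
    then have "d\<^sup>2 + inverse (Suc n) \<le> d\<^sup>2" by (simp add: add_nonneg_nonneg)
    then show False by simp
  qed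
  then obtain p where p: "\<And>n. p n \<in> K" "\<And>n. (norm (x - p n))\<^sup>2 < d\<^sup>2 + inverse (Suc n)"
    by metis
  \<comment> \<open>Parallelogram law: the midpoint of \<open>p m\<close> and \<open>p n\<close>
    lies in \<open>K\<close>, hence at distance at least \<open>d\<close> from \<open>x\<close>, so
    two nearly optimal points are close.\<close>
  have gap: "(norm (p m - p n))\<^sup>2 \<le> 2 * inverse (Suc m) + 2 * inverse (Suc n)" for m n
  proof -
    have "(1/2) *\<^sub>R (p m + p n) \<in> K"
      using p K by (intro subspace_scale subspace_add) auto
    then have "d\<^sup>2 \<le> (norm (x - (1/2) *\<^sub>R (p m + p n)))\<^sup>2" using d d0 by (intro power_mono) auto
    moreover have "(norm (p m - p n))\<^sup>2 = 2 * (norm (x - p m))\<^sup>2 + 2 * (norm (x - p n))\<^sup>2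
        - 4 * (norm (x - (1/2) *\<^sub>R (p m + p n)))\<^sup>2"
      by (simp add: power2_norm_eq_inner inner_diff_left inner_diff_right inner_add_left inner_add_right
          inner_commute[of "p m" x] inner_commute[of "p n" x] inner_commute[of "p n" "p m"] field_simps)
    ultimately show ?thesis using p(2)[of m] p(2)[of n] by linarith
  qed
  have "Cauchy p"
    unfolding Cauchy_altdef2
  proof (intro allI impI)
    fix e :: real assume e: "e > 0"
    then obtain N where N: "inverse (real (Suc N)) < e\<^sup>2 / 4"
      using reals_Archimedean[of "e\<^sup>2 / 4"] by auto
    have "dist (p n) (p N) < e" if "n \<ge> N" for n
    proof -
      have "inverse (real (Suc n)) \<le> inverse (real (Suc N))" using that by (simp add: field_simps)
      then have "(norm (p n - p N))\<^sup>2 < e\<^sup>2" using gap[of n N] N by linarith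
      then show ?thesis using e by (simp add: dist_norm power2_less_imp_less)
    qed
    then show "\<exists>N. \<forall>n\<ge>N. dist (p n) (p N) < e" by blast
  qed
  then obtain q where q: "p \<longlonglongrightarrow> q" by (auto simp: Cauchy_convergent_iff convergent_def)
  have qK: "q \<in> K" using closed_sequentially[OF K(1) _ q] p by auto
  have "(\<lambda>n. (norm (x - p n))\<^sup>2) \<longlonglongrightarrow> (norm (x - q))\<^sup>2" by (intro tendsto_intros q)
  moreover have "(\<lambda>n. d\<^sup>2 + inverse (real (Suc n))) \<longlonglongrightarrow> d\<^sup>2 + 0"
    by (intro tendsto_intros LIMSEQ_inverse_real_of_nat)
  ultimately have "(norm (x - q))\<^sup>2 \<le> d\<^sup>2"
    using LIMSEQ_le[of "\<lambda>n. (norm (x - p n))\<^sup>2" _ "\<lambda>n. d\<^sup>2 + inverse (real (Suc n))"] p(2)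
    by (force intro: less_imp_le)
  then have best: "norm (x - q) \<le> norm (x - k)" if "k \<in> K" for k
    using d[OF that] power2_le_imp_le[OF _ d0] by fastforce
  have "(x - q) \<bullet> k = 0" if "k \<in> K" for k
  proof -
    have "(x - q) \<bullet> k \<le> 0" if "k \<in> K" for k
      using any_closest_point_dot[OF subspace_imp_convex[OF K(2)] K(1) qK, of "q + k" x]
        best that qK K(2) by (auto simp: dist_norm subspace_add)
    from this[OF that] this[of "- k"] show ?thesis using that K(2) by (simp add: subspace_neg)
  qed
  then show ?thesis using qK by blast
qed

definition proj :: "'e::real_inner set \<Rightarrow> 'e \<Rightarrow> 'e"
  where "proj K x = (SOME p. p \<in> K \<and> (\<forall>k\<in>K. (x - p) \<bullet> k = 0))"

locale closed_subspace =
  fixes K :: "'e::{real_inner, complete_space} set"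
  assumes closed: "closed K" and subspace: "subspace K"
begin

lemma proj_in: "proj K x \<in> K" and proj_orth: "k \<in> K \<Longrightarrow> (x - proj K x) \<bullet> k = 0"
proof -
  have "\<exists>p. p \<in> K \<and> (\<forall>k\<in>K. (x - p) \<bullet> k = 0)"
    using subspace_closest_point_exists[OF closed subspace] by blast
  from someI_ex[OF this] show "proj K x \<in> K" "k \<in> K \<Longrightarrow> (x - proj K x) \<bullet> k = 0"
    by (simp_all add: proj_def)
qed

lemma proj_eqI:
  assumes "p \<in> K" "\<And>k. k \<in> K \<Longrightarrow> (x - p) \<bullet> k = 0"
  shows "proj K x = p"
proof -
  let ?d = "proj K x - p"
  have d: "?d \<in> K" using assms proj_in subspace by (simp add: subspace_diff)
  have "?d \<bullet> ?d = (x - p) \<bullet> ?d - (x - proj K x) \<bullet> ?d" by (simp add: inner_diff_left)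
  also have "\<dots> = 0" using assms(2)[OF d] proj_orth[OF d] by simp
  finally show ?thesis by simp
qed

lemma proj_id: "x \<in> K \<Longrightarrow> proj K x = x"
  by (rule proj_eqI) auto

lemma linear_proj: "linear (proj K)"
proof (rule linearI)
  show "proj K (x + y) = proj K x + proj K y" for x y
  proof (rule proj_eqI)
    show "proj K x + proj K y \<in> K" using proj_in subspace by (simp add: subspace_add)
    show "(x + y - (proj K x + proj K y)) \<bullet> k = 0" if "k \<in> K" for k
      using proj_orth[OF that, of x] proj_orth[OF that, of y]
      by (simp add: inner_diff_left inner_add_left)
  qed
  show "proj K (c *\<^sub>R x) = c *\<^sub>R proj K x" for c x
  proof (rule proj_eqI)
    show "c *\<^sub>R proj K x \<in> K" using proj_in subspace by (simp add: subspace_scale)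
    show "(c *\<^sub>R x - c *\<^sub>R proj K x) \<bullet> k = 0" if "k \<in> K" for k
      using proj_orth[OF that, of x] by (simp add: inner_diff_left)
  qed
qed

lemma inner_proj: "proj K x \<bullet> y = proj K x \<bullet> proj K y"
  using proj_orth[OF proj_in[of x], of y] by (simp add: inner_diff_left inner_diff_right inner_commute)

lemma proj_selfadjoint: "proj K x \<bullet> y = x \<bullet> proj K y"
  by (metis inner_commute inner_proj)

lemma proj_norm_le: "norm (proj K x) \<le> norm x"
proof -
  have "(norm (proj K x))\<^sup>2 \<le> norm (proj K x) * norm x"
    using norm_cauchy_schwarz[of "proj K x" x] inner_proj[of x x] by (simp add: power2_norm_eq_inner)
  then show ?thesis
    by (cases "norm (proj K x) = 0") (auto simp: power2_eq_square mult_le_cancel_left)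
qed

lemma proj_eq_0_iff: "proj K x = 0 \<longleftrightarrow> x \<in> orthogonal_comp K"
  using proj_orth[of _ x] proj_eqI[of 0 x] subspace subspace_0
  by (auto simp: orthogonal_comp_def orthogonal_def inner_commute)

lemma continuous_proj: "continuous_on A (proj K)"
  using linear_proj proj_norm_le
  by (intro linear_continuous_on bounded_linear_intro[of _ 1]) (auto simp: linear_add linear_scale)

end

lemma closed_subspace_orthogonal_comp: "closed_subspace (orthogonal_comp K)"
proof
  have "orthogonal_comp K = (\<Inter>k\<in>K. {x. k \<bullet> x = 0})"
    by (auto simp: orthogonal_comp_def orthogonal_def)
  then show "closed (orthogonal_comp K)" by (simp add: closed_INT closed_hyperplane)
qed (rule subspace_orthogonal_comp)

lemma closed_subspace_Int: "closed_subspace K \<Longrightarrow> closed_subspace L \<Longrightarrow> closed_subspace (K \<inter> L)"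
  by (simp add: closed_subspace_def closed_Int subspace_inter)

lemma closed_subspace_closure:
  fixes N :: "'e::{real_inner, complete_space} set"
  assumes "subspace N"
  shows "closed_subspace (closure N)"
proof
  show "subspace (closure N)"
  proof (rule subspaceI)
    show "0 \<in> closure N" using subspace_0[OF assms] closure_subset by blast
    fix x assume "x \<in> closure N"
    then obtain u where u: "\<And>n. u n \<in> N" "u \<longlonglongrightarrow> x" by (auto simp: closure_sequential)
    show "c *\<^sub>R x \<in> closure N" for c
      unfolding closure_sequential
      by (rule exI[of _ "\<lambda>n. c *\<^sub>R u n"]) (use u assms in \<open>auto intro: tendsto_intros subspace_scale\<close>)
    fix y assume "y \<in> closure N"
    then obtain v where v: "\<And>n. v n \<in> N" "v \<longlonglongrightarrow> y" by (auto simp: closure_sequential)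
    show "x + y \<in> closure N"
      unfolding closure_sequential
      by (rule exI[of _ "\<lambda>n. u n + v n"]) (use u v assms in \<open>auto intro: tendsto_intros subspace_add\<close>)
  qed
qed simp

lemma (in closed_subspace) proj_orthogonal_comp: "proj (orthogonal_comp K) x = x - proj K x"
  by (rule closed_subspace.proj_eqI[OF closed_subspace_orthogonal_comp])
    (use proj_orth[of _ x] proj_in in \<open>auto simp: orthogonal_comp_def orthogonal_def inner_commute\<close>)

text \<open>For nested subspaces the difference of the projections is again a projection, so its
  quadratic form is a squared norm. Nonnegativity gives monotonicity of the dimension; vanishing
  gives equality of the projections at \<open>x\<close>.\<close>

lemma inner_proj_diff:
  assumes "closed_subspace K" "closed_subspace L" "K \<subseteq> L"
  shows "proj L x \<bullet> x - proj K x \<bullet> x = (proj L x - proj K x) \<bullet> (proj L x - proj K x)"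
proof -
  interpret K: closed_subspace K by fact
  interpret L: closed_subspace L by fact
  have "proj L x \<bullet> proj K x = proj K x \<bullet> proj K x"
    using L.proj_selfadjoint[of x "proj K x"] L.proj_id[of "proj K x"] K.proj_in[of x] assms(3)
    by (metis K.inner_proj inner_commute subsetD)
  then show ?thesis
    using L.inner_proj[of x x] K.inner_proj[of x x]
    by (simp add: inner_diff_left inner_diff_right inner_commute[of "proj K x" "proj L x"])
qed

text \<open>The space splits into the fixed vectors, on which the averages are constant, and the
  closure of the range of \<open>1 - C\<close>, on which they tend to 0. Self-adjointness identifies
  the orthogonal complement of that range with the fixed vectors.\<close>

lemma mean_ergodic:
  fixes C :: "'e::{real_inner, complete_space} \<Rightarrow> 'e"
  assumes C: "linear C" and sa: "\<And>x y. C x \<bullet> y = x \<bullet> C y" and le: "\<And>x. norm (C x) \<le> norm x"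
  shows "(\<lambda>n. (1 / real n) *\<^sub>R (\<Sum>k<n. (C ^^ k) x)) \<longlonglongrightarrow> proj {x. C x = x} x"
proof -
  interpret C: linear C by fact
  have bl: "bounded_linear C"
    by (rule bounded_linear_intro[of _ 1]) (use le in \<open>auto simp: C.add C.scale\<close>)
  have "closed {x. C x = x}"
    by (intro closed_Collect_eq linear_continuous_on bl continuous_on_id)
  then interpret K: closed_subspace "{x. C x = x}"
    by unfold_locales (auto simp: subspace_def C.add C.scale)
  let ?R = "range (\<lambda>x. x - C x)"
  have "linear (\<lambda>x. x - C x)"
    by (rule linearI) (simp_all add: C.add C.scale algebra_simps)
  then have "subspace ?R" by (rule linear_subspace_image[OF _ subspace_UNIV])
  then interpret L: closed_subspace "closure ?R" by (rule closed_subspace_closure)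
  define M where "M n x = (1 / real n) *\<^sub>R (\<Sum>k<n. (C ^^ k) x)" for n x
  have lin: "linear (C ^^ k)" for k
    by (induction k) (auto simp: linear_id[unfolded id_def] linear_compose C intro: linear_compose[OF _ C, unfolded o_def])
  have pow_le: "norm ((C ^^ k) x) \<le> norm x" for k x
    by (induction k) (auto intro: order_trans[OF le])
  have M_add: "M n (x + y) = M n x + M n y" for n x y
    by (simp add: M_def linear_add[OF lin] sum.distrib scaleR_add_right)
  have M_le: "norm (M n x) \<le> norm x" for n x
  proof -
    have "norm (\<Sum>k<n. (C ^^ k) x) \<le> (\<Sum>k<n. norm x)"
      by (intro sum_norm_le pow_le)
    then show ?thesis by (cases "n = 0") (auto simp: M_def field_simps)
  qed
  have fix_M: "M n z = z" if "C z = z" "n > 0" for n z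
  proof -
    have "(C ^^ k) z = z" for k by (induction k) (auto simp: that)
    then show ?thesis using that(2) by (simp add: M_def sum_constant_scaleR)
  qed
  have range_M: "(\<lambda>n. M n y) \<longlonglongrightarrow> 0" if y: "y \<in> closure ?R" for y
  proof (rule LIMSEQ_I)
    fix e :: real assume e: "e > 0"
    then obtain u where u: "norm (y - (u - C u)) < e / 2"
      using y[unfolded closure_approachable, rule_format, of "e / 2"]
      by (auto simp: dist_norm norm_minus_commute)
    \<comment> \<open>On the range of \<open>1 - C\<close> the sum telescopes, so its norm stays
      below \<open>2 * norm u\<close> while the factor \<open>1 / n\<close> tends to 0.\<close>
    have *: "norm (M n (u - C u)) \<le> 2 * norm u / n" for n
    proof -
      have "(\<Sum>k<n. (C ^^ k) (u - C u)) = u - (C ^^ n) u"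
        by (induction n) (auto simp: linear_diff[OF lin] funpow_swap1)
      then have "M n (u - C u) = (1 / real n) *\<^sub>R (u - (C ^^ n) u)" by (simp add: M_def)
      moreover have "norm (u - (C ^^ n) u) \<le> 2 * norm u"
        using norm_triangle_ineq4[of u "(C ^^ n) u"] pow_le[of n u] by linarith
      ultimately show ?thesis by (simp add: divide_right_mono)
    qed
    obtain N where N: "real N > 4 * norm u / e" using reals_Archimedean2 by blast
    have "norm (M n y - 0) < e" if n: "n \<ge> Suc N" for n
    proof -
      have "4 * norm u < e * real n"
        using N e n by (simp add: field_simps) (smt (verit) mult_left_mono of_nat_le_iff Suc_leD)
      then have "2 * norm u / n < e / 2" using n by (simp add: field_simps)
      moreover have "M n y = M n (y - (u - C u)) + M n (u - C u)" by (simp add: M_add[symmetric])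
      ultimately show ?thesis
        using *[of n] M_le[of n "y - (u - C u)"] u norm_triangle_ineq[of "M n (y - (u - C u))" "M n (u - C u)"]
        by simp
    qed
    then show "\<exists>N. \<forall>n\<ge>N. norm (M n y - 0) < e" by blast
  qed
  define p z where "p = proj (closure ?R) x" and "z = x - p"
  have p: "p \<in> closure ?R" by (simp add: p_def L.proj_in)
  \<comment> \<open>\<open>z\<close> is orthogonal to every \<open>y - C y\<close>; moving
    \<open>C\<close> across makes \<open>z - C z\<close> orthogonal to everything.\<close>
  have z: "C z = z"
  proof -
    have "z \<bullet> (y - C y) = 0" for y
      unfolding z_def p_def by (rule L.proj_orth) (auto intro: closure_subset[THEN subsetD])
    then have "(z - C z) \<bullet> y = 0" for y by (simp add: inner_diff_left inner_diff_right sa)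
    from this[of "z - C z"] show ?thesis by simp
  qed
  have "proj {x. C x = x} x = z"
  proof (rule K.proj_eqI)
    fix k assume k: "k \<in> {x. C x = x}"
    have "?R \<subseteq> {w. k \<bullet> w = 0}" using k by (auto simp: inner_diff_right sa[symmetric])
    then have "closure ?R \<subseteq> {w. k \<bullet> w = 0}" by (rule closure_minimal) (rule closed_hyperplane)
    then show "(x - z) \<bullet> k = 0" using p by (auto simp: z_def inner_commute)
  qed (use z in simp)
  moreover have "(\<lambda>n. M n p + M n z) \<longlonglongrightarrow> 0 + z"
    by (intro tendsto_add range_M p tendsto_eventually
        eventually_mono[OF eventually_gt_at_top[of "0::nat"] fix_M[OF z]])
  moreover have "M n x = M n p + M n z" for n by (simp add: M_add[symmetric] z_def)
  ultimately show ?thesis by (simp add: M_def)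
qed

lemma has_sum_sum:
  fixes f :: "'b \<Rightarrow> 'a \<Rightarrow> 'c::topological_comm_monoid_add"
  assumes "\<And>i. i \<in> I \<Longrightarrow> (f i has_sum s i) A" "finite I"
  shows "((\<lambda>x. \<Sum>i\<in>I. f i x) has_sum (\<Sum>i\<in>I. s i)) A"
  using assms(2,1) by induction (auto intro: has_sum_add)

section \<open>Dimension of invariant subspaces\<close>

text \<open>
  \<open>X\<close> is a finite power of the regular representation: the translates of the finite set \<open>B\<close> satisfy
  Parseval's identity. Linearity of the action follows from \<open>r_adjoint\<close>.
\<close>

locale gmod =
  fixes G :: "('g, 'm) monoid_scheme" (structure)
    and X :: "'e::{real_inner, complete_space} set"
    and B :: "'e set"
    and r :: "'g \<Rightarrow> 'e \<Rightarrow> 'e"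
  assumes group: "group G"
    and closed_subspace_X: "closed_subspace X"
    and finite_B: "finite B"
    and B_subset: "B \<subseteq> X"
    and zero_notin_B: "0 \<notin> B"
    and r_in: "g \<in> carrier G \<Longrightarrow> x \<in> X \<Longrightarrow> r g x \<in> X"
    and r_adjoint: "g \<in> carrier G \<Longrightarrow> x \<in> X \<Longrightarrow> y \<in> X \<Longrightarrow> r g x \<bullet> y = x \<bullet> r (inv g) y"
    and r_norm: "g \<in> carrier G \<Longrightarrow> x \<in> X \<Longrightarrow> norm (r g x) = norm x"
    and parseval: "x \<in> X \<Longrightarrow> ((\<lambda>g. \<Sum>b\<in>B. (x \<bullet> r g b)\<^sup>2) has_sum x \<bullet> x) (carrier G)"
begin

sublocale X: closed_subspace X by (rule closed_subspace_X)

definition inv_subspace :: "'e set \<Rightarrow> bool"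
  where "inv_subspace K \<longleftrightarrow> closed_subspace K \<and> K \<subseteq> X \<and> (\<forall>g\<in>carrier G. \<forall>x\<in>K. r g x \<in> K)"

text \<open>Only \<open>B\<close> enters the formula, so it also makes sense for kernels and
  orthogonal complements taken in the whole ambient type. For the regular representation with its
  two basis vectors, a complex invariant subspace gets twice its von Neumann dimension.\<close>

definition vdim :: "'e set \<Rightarrow> real"
  where "vdim K = (\<Sum>b\<in>B. proj K b \<bullet> b)"

lemma inv_subspace_X: "inv_subspace X"
  by (simp add: inv_subspace_def closed_subspace_X r_in)

lemma parseval_inner:
  assumes "x \<in> X" "y \<in> X"
  shows "((\<lambda>g. \<Sum>b\<in>B. (x \<bullet> r g b) * (y \<bullet> r g b)) has_sum x \<bullet> y) (carrier G)"
proof -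
  have "x + y \<in> X" using assms X.subspace by (simp add: subspace_add)
  from has_sum_add[OF parseval[OF this] has_sum_cmult_right[of _ _ _ "-1", OF has_sum_add[OF parseval parseval]], OF assms]
  have "((\<lambda>g. (1/2) * ((\<Sum>b\<in>B. ((x + y) \<bullet> r g b)\<^sup>2) + - 1 * ((\<Sum>b\<in>B. (x \<bullet> r g b)\<^sup>2) + (\<Sum>b\<in>B. (y \<bullet> r g b)\<^sup>2))))
      has_sum (1/2) * ((x + y) \<bullet> (x + y) + - 1 * (x \<bullet> x + y \<bullet> y))) (carrier G)"
    by (rule has_sum_cmult_right)
  moreover have "(1/2) * ((\<Sum>b\<in>B. ((x + y) \<bullet> r g b)\<^sup>2) + - 1 * ((\<Sum>b\<in>B. (x \<bullet> r g b)\<^sup>2) + (\<Sum>b\<in>B. (y \<bullet> r g b)\<^sup>2)))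
      = (\<Sum>b\<in>B. (x \<bullet> r g b) * (y \<bullet> r g b))" for g
    by (simp add: inner_add_left power2_sum sum.distrib sum_distrib_left[symmetric] mult.assoc)
  moreover have "(1/2) * ((x + y) \<bullet> (x + y) + - 1 * (x \<bullet> x + y \<bullet> y)) = x \<bullet> y"
    by (simp add: inner_add_left inner_add_right inner_commute)
  ultimately show ?thesis by simp
qed

text \<open>A translation moves across the inner product as its inverse, which again preserves
  \<open>K\<close>; so the translate of \<open>x - proj K x\<close> stays orthogonal to
  \<open>K\<close>.\<close>

lemma proj_equivariant:
  assumes K: "inv_subspace K" and g: "g \<in> carrier G" and x: "x \<in> X"
  shows "proj K (r g x) = r g (proj K x)"
proof -
  interpret group G by (rule group)
  interpret K: closed_subspace K using K by (simp add: inv_subspace_def)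
  have KX: "K \<subseteq> X" and inv: "\<And>g x. g \<in> carrier G \<Longrightarrow> x \<in> K \<Longrightarrow> r g x \<in> K"
    using K by (auto simp: inv_subspace_def)
  show ?thesis
  proof (rule K.proj_eqI)
    show "r g (proj K x) \<in> K" using inv g K.proj_in by blast
    fix k assume k: "k \<in> K"
    have "(r g x - r g (proj K x)) \<bullet> k = (x - proj K x) \<bullet> r (inv g) k"
      using KX k K.proj_in[of x] x g by (simp add: inner_diff_left r_adjoint subset_iff)
    also have "\<dots> = 0" using inv k g by (intro K.proj_orth) simp
    finally show "(r g x - r g (proj K x)) \<bullet> k = 0" .
  qed
qed

text \<open>Faithfulness of the trace. Equal dimensions force the projections to agree on
  \<open>B\<close>, equivariance spreads this to all translates of \<open>B\<close>, and then a
  vector of \<open>L\<close> orthogonal to \<open>K\<close> has only zero coefficients in Parseval's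
  identity.\<close>

lemma inv_subspace_eqI:
  assumes K: "inv_subspace K" and L: "inv_subspace L" and KL: "K \<subseteq> L" and le: "vdim L \<le> vdim K"
  shows "K = L"
proof (rule antisym[OF KL subsetI])
  interpret group G by (rule group)
  interpret K: closed_subspace K using K by (simp add: inv_subspace_def)
  interpret L: closed_subspace L using L by (simp add: inv_subspace_def)
  note * = inner_proj_diff[OF K.closed_subspace_axioms L.closed_subspace_axioms KL]
  then have nn: "0 \<le> proj L b \<bullet> b - proj K b \<bullet> b" for b by simp
  have "(\<Sum>b\<in>B. proj L b \<bullet> b - proj K b \<bullet> b) \<le> 0"
    using le by (simp add: vdim_def sum_subtractf)
  then have "(\<Sum>b\<in>B. proj L b \<bullet> b - proj K b \<bullet> b) = 0" by (intro antisym sum_nonneg nn)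
  then have "proj L b \<bullet> b - proj K b \<bullet> b = 0" if "b \<in> B" for b
    using sum_nonneg_eq_0_iff[OF finite_B, of "\<lambda>b. proj L b \<bullet> b - proj K b \<bullet> b"] nn that by blast
  then have eq: "proj L b = proj K b" if "b \<in> B" for b using * that by auto
  fix x assume x: "x \<in> L"
  define y where "y = x - proj K x"
  have yL: "y \<in> L" using x K.proj_in[of x] KL by (auto simp: y_def intro: subspace_diff[OF L.subspace])
  then have yX: "y \<in> X" using L by (auto simp: inv_subspace_def)
  have "y \<bullet> r g b = 0" if g: "g \<in> carrier G" and b: "b \<in> B" for g b
  proof -
    have bX: "b \<in> X" using b B_subset by blast
    have "y \<bullet> r g b = proj L y \<bullet> r g b" using L.proj_id yL by simp
    also have "\<dots> = y \<bullet> proj L (r g b)" by (rule L.proj_selfadjoint)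
    also have "\<dots> = y \<bullet> r g (proj K b)" using proj_equivariant[OF L g bX] eq b by simp
    also have "\<dots> = y \<bullet> proj K (r g b)" using proj_equivariant[OF K g bX] by simp
    also have "\<dots> = 0" unfolding y_def by (intro K.proj_orth K.proj_in)
    finally show ?thesis .
  qed
  then have "((\<lambda>g. \<Sum>b\<in>B. (y \<bullet> r g b)\<^sup>2) has_sum 0) (carrier G)"
    by (intro has_sum_0) auto
  then have "y \<bullet> y = 0" using parseval[OF yX] has_sum_unique by blast
  then show "x \<in> K" using K.proj_in[of x] by (simp add: y_def)
qed

lemma vdim_mono:
  assumes "closed_subspace K" "closed_subspace L" "K \<subseteq> L"
  shows "vdim K \<le> vdim L"
  unfolding vdim_def
proof (rule sum_mono)
  show "proj K b \<bullet> b \<le> proj L b \<bullet> b" for b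
    using inner_proj_diff[OF assms, of b] inner_ge_zero[of "proj L b - proj K b"] by linarith
qed

lemma r_diff:
  assumes g: "g \<in> carrier G" and xy: "x \<in> X" "y \<in> X"
  shows "r g (x - y) = r g x - r g y"
proof -
  define d where "d = r g (x - y) - (r g x - r g y)"
  have diff: "x - y \<in> X" using xy X.subspace by (simp add: subspace_diff)
  have d: "d \<in> X" unfolding d_def by (intro subspace_diff X.subspace r_in g diff xy)
  have "r g (x - y) \<bullet> d = (x - y) \<bullet> r (inv g) d" by (rule r_adjoint[OF g diff d])
  also have "\<dots> = r g x \<bullet> d - r g y \<bullet> d"
    unfolding r_adjoint[OF g xy(1) d] r_adjoint[OF g xy(2) d] by (rule inner_diff_left)
  finally have "(r g (x - y) - (r g x - r g y)) \<bullet> d = 0" by (simp add: inner_diff_left)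
  then show ?thesis unfolding d_def[symmetric] by (simp add: d_def)
qed

lemma inv_subspace_closure:
  assumes "subspace N" "N \<subseteq> X" "\<And>g x. g \<in> carrier G \<Longrightarrow> x \<in> N \<Longrightarrow> r g x \<in> N"
  shows "inv_subspace (closure N)"
proof -
  have sub: "closure N \<subseteq> X" using assms(2) X.closed by (rule closure_minimal)
  have "r g x \<in> closure N" if g: "g \<in> carrier G" and x: "x \<in> closure N" for g x
  proof -
    obtain u where u: "\<And>n. u n \<in> N" "u \<longlonglongrightarrow> x" using x by (auto simp: closure_sequential)
    have eq: "norm (r g (u n) - r g x) = norm (u n - x)" for n
    proof -
      have "u n \<in> X" "x \<in> X" using u(1)[of n] assms(2) sub x by auto
      then show ?thesis
        unfolding r_diff[OF g \<open>u n \<in> X\<close> \<open>x \<in> X\<close>, symmetric]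
        by (intro r_norm g subspace_diff X.subspace)
    qed
    have "(\<lambda>n. norm (r g (u n) - r g x)) \<longlonglongrightarrow> 0"
      unfolding eq by (rule tendsto_norm_zero[OF LIM_zero[OF u(2)]])
    then have "(\<lambda>n. r g (u n)) \<longlonglongrightarrow> r g x"
      by (rule LIM_zero_cancel[OF tendsto_norm_zero_cancel])
    then show ?thesis unfolding closure_sequential
      by (intro exI[of _ "\<lambda>n. r g (u n)"] conjI allI assms(3)[OF g] u(1))
  qed
  then show ?thesis
    using closed_subspace_closure[OF assms(1)] sub by (simp add: inv_subspace_def)
qed

lemma vdim_X: "vdim X = (\<Sum>b\<in>B. b \<bullet> b)"
  unfolding vdim_def by (rule sum.cong) (use B_subset X.proj_id in auto)

end

section \<open>Symmetry of the trace\<close>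

locale gmod_pair = M: gmod G X B r + N: gmod G Y D s
  for G :: "('g, 'm) monoid_scheme" (structure)
    and X :: "'e::{real_inner, complete_space} set" and B and r
    and Y :: "'f::{real_inner, complete_space} set" and D and s
begin

text \<open>Parseval expands \<open>H (F b) \<bullet> b\<close> over translates of \<open>D\<close>
  and \<open>F (H d) \<bullet> d\<close> over translates of \<open>B\<close>. Equivariance matches
  the two families of coefficients up to inversion in the group; the finite sums over
  \<open>B\<close> and \<open>D\<close> are then exchanged.\<close>

lemma trace_commute:
  assumes F: "\<And>x y. F x \<bullet> y = x \<bullet> F' y" "\<And>x. x \<in> X \<Longrightarrow> F x \<in> Y" "\<And>y. y \<in> Y \<Longrightarrow> F' y \<in> X"
      "\<And>g x. g \<in> carrier G \<Longrightarrow> x \<in> X \<Longrightarrow> F (r g x) = s g (F x)"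
    and H: "\<And>y x. H y \<bullet> x = y \<bullet> H' x" "\<And>y. y \<in> Y \<Longrightarrow> H y \<in> X" "\<And>x. x \<in> X \<Longrightarrow> H' x \<in> Y"
      "\<And>g y. g \<in> carrier G \<Longrightarrow> y \<in> Y \<Longrightarrow> H (s g y) = r g (H y)"
  shows "(\<Sum>b\<in>B. H (F b) \<bullet> b) = (\<Sum>d\<in>D. F (H d) \<bullet> d)"
proof -
  interpret group G by (rule M.group)
  have BX: "\<And>b. b \<in> B \<Longrightarrow> b \<in> X" and DY: "\<And>d. d \<in> D \<Longrightarrow> d \<in> Y"
    using M.B_subset N.B_subset by auto
  let ?t = "\<lambda>g b d. (F' d \<bullet> r g b) * (H d \<bullet> r g b)"
  have 1: "((\<lambda>g. \<Sum>d\<in>D. ?t (inv g) b d) has_sum H (F b) \<bullet> b) (carrier G)" if b: "b \<in> B" for b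
  proof -
    have "((\<lambda>g. \<Sum>d\<in>D. (F b \<bullet> s g d) * (H' b \<bullet> s g d)) has_sum F b \<bullet> H' b) (carrier G)"
      by (intro N.parseval_inner F(2) H(3) BX b)
    \<comment> \<open>Coefficients along translates of \<open>D\<close> become coefficients of
      \<open>F' d\<close> and \<open>H d\<close> along translates of \<open>B\<close>; moving the
      translation across produces the \<open>inv g\<close> in the argument of
      \<open>?t\<close>.\<close>
    moreover have "F b \<bullet> s g d = F' d \<bullet> r (inv g) b" "H' b \<bullet> s g d = H d \<bullet> r (inv g) b"
      if "g \<in> carrier G" "d \<in> D" for g d
    proof -
      have "F b \<bullet> s g d = d \<bullet> s (inv g) (F b)"
        using N.r_adjoint[of g d "F b"] that b BX DY F(2) by (simp add: inner_commute)
      also have "\<dots> = F (r (inv g) b) \<bullet> d" using F(4)[of "inv g" b] that b BX by (simp add: inner_commute[of d])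
      also have "\<dots> = F' d \<bullet> r (inv g) b" unfolding F(1) by (rule inner_commute)
      finally show "F b \<bullet> s g d = F' d \<bullet> r (inv g) b" .
      have "H' b \<bullet> s g d = H (s g d) \<bullet> b" unfolding H(1) by (rule inner_commute)
      also have "\<dots> = r g (H d) \<bullet> b" using H(4) that DY by simp
      also have "\<dots> = H d \<bullet> r (inv g) b" using M.r_adjoint that b BX DY H(2) by simp
      finally show "H' b \<bullet> s g d = H d \<bullet> r (inv g) b" .
    qed
    ultimately show ?thesis by (subst H(1)) (simp cong: has_sum_cong)
  qed
  have 2: "((\<lambda>g. \<Sum>b\<in>B. ?t (inv g) b d) has_sum F (H d) \<bullet> d) (carrier G)" if d: "d \<in> D" for d
  proof -
    have "((\<lambda>g. \<Sum>b\<in>B. ?t g b d) has_sum F' d \<bullet> H d) (carrier G)"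
      by (intro M.parseval_inner F(3) H(2) DY d)
    moreover have "bij_betw (\<lambda>g. inv g) (carrier G) (carrier G)"
      by (rule bij_betw_byWitness[where f' = "\<lambda>g. inv g"]) auto
    moreover have "F (H d) \<bullet> d = F' d \<bullet> H d" unfolding F(1) by (rule inner_commute)
    ultimately show ?thesis
      using has_sum_reindex_bij_betw[of "\<lambda>g. inv g" "carrier G" "carrier G" "\<lambda>g. \<Sum>b\<in>B. ?t g b d"]
      by simp
  qed
  have "((\<lambda>g. \<Sum>b\<in>B. \<Sum>d\<in>D. ?t (inv g) b d) has_sum (\<Sum>b\<in>B. H (F b) \<bullet> b)) (carrier G)"
    by (intro has_sum_sum 1 M.finite_B)
  moreover have "((\<lambda>g. \<Sum>d\<in>D. \<Sum>b\<in>B. ?t (inv g) b d) has_sum (\<Sum>d\<in>D. F (H d) \<bullet> d)) (carrier G)"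
    by (intro has_sum_sum 2 N.finite_B)
  ultimately show ?thesis
    by (subst (asm) sum.swap) (rule has_sum_unique)
qed

end

section \<open>Rank and nullity\<close>

lemma bounded_linear_contraction:
  fixes A :: "'e::real_normed_vector \<Rightarrow> 'f::real_normed_vector"
  assumes "linear A" "\<And>x. norm (A x) \<le> norm x"
  shows "bounded_linear A"
  by (rule bounded_linear_intro[of _ 1]) (use assms in \<open>auto simp: linear_add linear_scale\<close>)

lemma closed_subspace_kernel:
  fixes A :: "'e::{real_inner, complete_space} \<Rightarrow> 'f::real_normed_vector"
  assumes "linear A" "\<And>x. norm (A x) \<le> norm x"
  shows "closed_subspace {x. A x = 0}"
proof
  show "closed {x. A x = 0}"
    by (intro closed_Collect_eq linear_continuous_on bounded_linear_contraction assms continuous_on_const)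
  show "subspace {x. A x = 0}" by (rule linear_subspace_kernel[OF assms(1)])
qed

lemma adjoint_contraction:
  fixes A :: "'e::real_inner \<Rightarrow> 'f::real_inner"
  assumes "\<And>x y. A x \<bullet> y = x \<bullet> A' y" "\<And>x. norm (A x) \<le> norm x"
  shows "norm (A' y) \<le> norm y"
proof -
  have "(norm (A' y))\<^sup>2 = A (A' y) \<bullet> y" by (simp add: power2_norm_eq_inner assms(1))
  also have "\<dots> \<le> norm (A' y) * norm y"
    using norm_cauchy_schwarz[of "A (A' y)" y] assms(2)[of "A' y"] mult_right_mono[OF _ norm_ge_zero]
    by (meson order_trans)
  finally show ?thesis
    by (cases "norm (A' y) = 0") (auto simp: power2_eq_square mult_le_cancel_left)
qed

lemma adjoint_linear:
  fixes A :: "'e::real_inner \<Rightarrow> 'f::real_inner"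
  assumes adj: "\<And>x y. A x \<bullet> y = x \<bullet> A' y"
  shows "linear A'"
proof (rule linearI)
  have eqI: "u = v" if "\<And>x. x \<bullet> u = x \<bullet> v" for u v :: 'e
    using that[of "u - v"] by (metis eq_iff_diff_eq_0 inner_diff_right inner_eq_zero_iff)
  show "A' (y + z) = A' y + A' z" for y z
    by (rule eqI) (simp add: adj[symmetric] inner_add_right)
  show "A' (c *\<^sub>R y) = c *\<^sub>R A' y" for c y
    by (rule eqI) (simp add: adj[symmetric])
qed

text \<open>\<open>1 - A'A\<close> is a self-adjoint contraction whose fixed vectors are exactly the
  kernel of \<open>A\<close>, so the mean ergodic theorem applies at each \<open>b\<close>.\<close>

lemma trace_mean_ergodic:
  fixes A :: "'e::{real_inner, complete_space} \<Rightarrow> 'f::real_inner"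
  assumes lin: "linear A" and adj: "\<And>x y. A x \<bullet> y = x \<bullet> A' y" and le: "\<And>x. norm (A x) \<le> norm x"
  shows "(\<lambda>n. 1 / real n * (\<Sum>k<n. \<Sum>b\<in>B. ((\<lambda>x. x - A' (A x)) ^^ k) b \<bullet> b))
    \<longlonglongrightarrow> (\<Sum>b\<in>B. proj {x. A x = 0} b \<bullet> b)"
proof -
  let ?C = "\<lambda>x. x - A' (A x)"
  have lin': "linear A'" by (rule adjoint_linear[OF adj])
  have linC: "linear ?C"
    by (rule linearI) (simp_all add: linear_add[OF lin] linear_add[OF lin'] linear_scale[OF lin]
        linear_scale[OF lin'] algebra_simps)
  have adj': "A' y \<bullet> x = y \<bullet> A x" for x y
    using adj[of x y] by (simp add: inner_commute)
  have saC: "?C x \<bullet> y = x \<bullet> ?C y" for x y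
    by (simp add: inner_diff_left inner_diff_right adj' adj[symmetric])
  have leC: "norm (?C x) \<le> norm x" for x
  proof -
    \<comment> \<open>The subtracted cross term outweighs the last term because \<open>A'\<close> is
      a contraction too.\<close>
    have "(norm (?C x))\<^sup>2 = (norm x)\<^sup>2 - 2 * (norm (A x))\<^sup>2 + (norm (A' (A x)))\<^sup>2"
      by (simp add: power2_norm_eq_inner inner_diff_left inner_diff_right adj[symmetric] adj' linear_diff[OF lin])
    moreover have "(norm (A' (A x)))\<^sup>2 \<le> (norm (A x))\<^sup>2"
      by (intro power_mono adjoint_contraction[OF adj le]) simp
    ultimately have "(norm (?C x))\<^sup>2 \<le> (norm x)\<^sup>2" using zero_le_power2[of "norm (A x)"] by linarith
    then show ?thesis by (rule power2_le_imp_le) simp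
  qed
  have "{x. ?C x = x} = {x. A x = 0}"
  proof -
    have "A x = 0" if "A' (A x) = 0" for x
      using adj[of x "A x"] that by simp
    then show ?thesis using linear_0[OF lin'] by auto
  qed
  then have "(\<lambda>n. \<Sum>b\<in>B. ((1 / real n) *\<^sub>R (\<Sum>k<n. (?C ^^ k) b)) \<bullet> b)
      \<longlonglongrightarrow> (\<Sum>b\<in>B. proj {x. A x = 0} b \<bullet> b)"
    using mean_ergodic[OF linC saC leC] by (intro tendsto_sum tendsto_inner tendsto_const) simp
  then show ?thesis
    by (simp add: inner_sum_left sum_distrib_left sum.swap[of _ _ B])
qed

context gmod_pair
begin

text \<open>From power \<open>k\<close> to \<open>k + 1\<close> the traces of \<open>?C ^^ k\<close>
  and \<open>?D ^^ k\<close> drop by the same amount, since \<open>A' ?D^k A\<close> and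
  \<open>A A' ?D^k\<close> have equal trace. So \<open>t k - u k\<close> is constant: at
  \<open>k = 0\<close> it is the difference of the dimensions of \<open>X\<close> and
  \<open>Y\<close>, and on average it tends to that of the kernels.\<close>

theorem rank_eq:
  assumes lin: "linear A" and adj: "\<And>x y. A x \<bullet> y = x \<bullet> A' y" and le: "\<And>x. norm (A x) \<le> norm x"
    and A: "\<And>x. x \<in> X \<Longrightarrow> A x \<in> Y" "\<And>y. y \<in> Y \<Longrightarrow> A' y \<in> X"
    and eqv: "\<And>g x. g \<in> carrier G \<Longrightarrow> x \<in> X \<Longrightarrow> A (r g x) = s g (A x)"
      "\<And>g y. g \<in> carrier G \<Longrightarrow> y \<in> Y \<Longrightarrow> A' (s g y) = r g (A' y)"
  shows "M.vdim X - M.vdim {x. A x = 0} = N.vdim Y - N.vdim {y. A' y = 0}"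
proof -
  let ?C = "\<lambda>x. x - A' (A x)" and ?D = "\<lambda>y. y - A (A' y)"
  have lin': "linear A'" by (rule adjoint_linear[OF adj])
  have adj': "A' y \<bullet> x = y \<bullet> A x" for x y
    using adj[of x y] by (simp add: inner_commute)
  have le': "norm (A' y) \<le> norm y" for y by (rule adjoint_contraction[OF adj le])
  define t u where "t k = (\<Sum>b\<in>B. (?C ^^ k) b \<bullet> b)" and "u k = (\<Sum>d\<in>D. (?D ^^ k) d \<bullet> d)" for k
  have step: "t k - t (Suc k) = u k - u (Suc k)" for k
  proof -
    \<comment> \<open>Intertwining: \<open>(1 - A'A) A' = A' (1 - AA')\<close>, hence the same for
      powers.\<close>
    have swap: "(?C ^^ k) (A' y) = A' ((?D ^^ k) y)" for y
      by (induction k) (simp_all add: linear_diff[OF lin'])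
    have linC: "linear (?C ^^ k)"
    proof (induction k)
      case (Suc k)
      have "linear ?C"
        by (rule linearI) (simp_all add: linear_add[OF lin] linear_add[OF lin'] linear_scale[OF lin]
            linear_scale[OF lin'] algebra_simps)
      then show ?case using linear_compose[OF Suc] by (simp add: o_def)
    qed (simp add: linear_id[unfolded id_def])
    have saD: "(?D ^^ k) y \<bullet> z = y \<bullet> (?D ^^ k) z" for y z
    proof (induction k arbitrary: y z)
      case (Suc k)
      have "?D y \<bullet> z = y \<bullet> ?D z" for y z
        by (simp add: adj adj'[symmetric] inner_diff_left inner_diff_right)
      then have "(?D ^^ Suc k) y \<bullet> z = (?D ^^ k) y \<bullet> ?D z" by simp
      also have "\<dots> = y \<bullet> (?D ^^ k) (?D z)" by (rule Suc.IH)
      also have "\<dots> = y \<bullet> (?D ^^ Suc k) z"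
        unfolding funpow.simps(2) o_apply by (rule arg_cong[OF funpow_swap1[symmetric]])
      finally show ?case .
    qed simp
    have D_in: "(?D ^^ k) y \<in> Y" if "y \<in> Y" for y
      using that N.X.subspace A by (induction k) (auto intro: subspace_diff)
    have D_eqv: "(?D ^^ k) (s g y) = s g ((?D ^^ k) y)" if g: "g \<in> carrier G" and y: "y \<in> Y" for g y
    proof -
      have "(?D ^^ k) (s g y) = s g ((?D ^^ k) y) \<and> (?D ^^ k) y \<in> Y"
        using y N.X.subspace A
        by (induction k) (auto simp: eqv g N.r_diff intro: subspace_diff)
      then show ?thesis ..
    qed
    have "t k - t (Suc k) = (\<Sum>b\<in>B. ((?C ^^ k) b - (?C ^^ k) (?C b)) \<bullet> b)"
      by (simp only: t_def funpow_Suc_right o_apply sum_subtractf inner_diff_left)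
    also have "\<dots> = (\<Sum>b\<in>B. A' ((?D ^^ k) (A b)) \<bullet> b)"
      by (simp add: swap[symmetric] linear_diff[OF linC])
    also have "\<dots> = (\<Sum>d\<in>D. A (A' ((?D ^^ k) d)) \<bullet> d)"
    proof (rule trace_commute)
      show "A' ((?D ^^ k) y) \<bullet> x = y \<bullet> (?D ^^ k) (A x)" for x y
        by (simp add: adj' saD)
      show "A' ((?D ^^ k) (s g y)) = r g (A' ((?D ^^ k) y))" if "g \<in> carrier G" "y \<in> Y" for g y
        by (simp add: D_eqv D_in eqv that)
    qed (auto simp: adj A D_in eqv)
    also have "\<dots> = u k - u (Suc k)"
      by (simp add: u_def sum_subtractf inner_diff_left)
    finally show ?thesis .
  qed
  have diff: "t k - u k = t 0 - u 0" for k
  proof (induction k)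
    case (Suc k)
    then show ?case using step[of k] by linarith
  qed simp
  have "(\<lambda>n. 1 / real n * (\<Sum>k<n. t k) - 1 / real n * (\<Sum>k<n. u k))
      \<longlonglongrightarrow> M.vdim {x. A x = 0} - N.vdim {y. A' y = 0}"
    unfolding t_def u_def M.vdim_def N.vdim_def
    by (intro tendsto_diff trace_mean_ergodic lin lin' adj adj' le le')
  \<comment> \<open>Division by zero makes both averages 0 at \<open>n = 0\<close>, so the identity
    is asserted from \<open>n = 1\<close> on.\<close>
  moreover have "1 / real n * (\<Sum>k<n. t k) - 1 / real n * (\<Sum>k<n. u k) = t 0 - u 0" if "n > 0" for n
  proof -
    have "(\<Sum>k<n. t k) - (\<Sum>k<n. u k) = (\<Sum>k<n. t 0 - u 0)"
      unfolding sum_subtractf[symmetric] by (rule sum.cong[OF refl diff])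
    also have "\<dots> = real n * (t 0 - u 0)" by simp
    finally have "(\<Sum>k<n. t k) - (\<Sum>k<n. u k) = real n * (t 0 - u 0)" .
    then have "1 / real n * (\<Sum>k<n. t k) - 1 / real n * (\<Sum>k<n. u k) = 1 / real n * (real n * (t 0 - u 0))"
      by (simp only: right_diff_distrib[symmetric])
    then show ?thesis using that by simp
  qed
  then have "(\<lambda>n. 1 / real n * (\<Sum>k<n. t k) - 1 / real n * (\<Sum>k<n. u k)) \<longlonglongrightarrow> t 0 - u 0"
    by (intro tendsto_eventually eventually_mono[OF eventually_gt_at_top[of "0::nat"]]) blast
  ultimately have "M.vdim {x. A x = 0} - N.vdim {y. A' y = 0} = t 0 - u 0"
    by (rule LIMSEQ_unique)
  then show ?thesis by (simp add: t_def u_def M.vdim_X N.vdim_X)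
qed

end

text \<open>The adjoint is carried as data on the ambient spaces so that \<open>rank_eq\<close>
  applies directly, and the norm bound 1 is what makes \<open>1 - F'F\<close> a contraction. The
  instances below are coordinate projections and maps built from them.\<close>

locale gmod_hom = gmod_pair G X B r Y D s
  for G :: "('g, 'm) monoid_scheme" (structure)
    and X :: "'e::{real_inner, complete_space} set" and B and r
    and Y :: "'f::{real_inner, complete_space} set" and D and s +
  fixes F :: "'e \<Rightarrow> 'f" and F' :: "'f \<Rightarrow> 'e"
  assumes linear_F: "linear F"
    and adjoint_F: "F x \<bullet> y = x \<bullet> F' y"
    and F_contraction: "norm (F x) \<le> norm x"
    and F_in: "x \<in> X \<Longrightarrow> F x \<in> Y"
    and F'_in: "y \<in> Y \<Longrightarrow> F' y \<in> X"
    and F_equivariant: "g \<in> carrier G \<Longrightarrow> x \<in> X \<Longrightarrow> F (r g x) = s g (F x)"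
begin

lemma F'_equivariant:
  assumes g: "g \<in> carrier G" and y: "y \<in> Y"
  shows "F' (s g y) = r g (F' y)"
proof -
  interpret group G by (rule M.group)
  define d where "d = F' (s g y) - r g (F' y)"
  have d: "d \<in> X"
    unfolding d_def by (intro subspace_diff M.X.subspace F'_in N.r_in M.r_in g y)
  have "d \<bullet> F' (s g y) = F d \<bullet> s g y" by (rule adjoint_F[symmetric])
  also have "\<dots> = y \<bullet> s (inv g) (F d)"
    using N.r_adjoint[OF g y F_in[OF d]] by (simp add: inner_commute)
  also have "\<dots> = F (r (inv g) d) \<bullet> y" using F_equivariant d g by (simp add: inner_commute)
  also have "\<dots> = r (inv g) d \<bullet> F' y" by (rule adjoint_F)
  also have "\<dots> = d \<bullet> r g (F' y)"
    using M.r_adjoint[OF g F'_in[OF y] d] by (simp add: inner_commute)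
  finally have "d \<bullet> d = 0" by (simp add: d_def inner_diff_right)
  then show ?thesis by (simp add: d_def)
qed

lemma inv_subspace_image:
  assumes K: "M.inv_subspace K"
  shows "N.inv_subspace (closure (F ` K))"
proof (rule N.inv_subspace_closure)
  have KX: "K \<subseteq> X" using K by (simp add: M.inv_subspace_def)
  show "subspace (F ` K)"
    using K by (intro linear_subspace_image linear_F) (simp add: M.inv_subspace_def closed_subspace_def)
  show "F ` K \<subseteq> Y" using F_in KX by auto
  show "s g y \<in> F ` K" if "g \<in> carrier G" "y \<in> F ` K" for g y
    using that K KX by (auto simp: M.inv_subspace_def F_equivariant[symmetric] subset_iff)
qed

lemma inv_subspace_vimage:
  assumes K: "M.inv_subspace K" and L: "N.inv_subspace L"
  shows "M.inv_subspace {x \<in> K. F x \<in> L}"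
proof -
  have K': "closed_subspace K" "K \<subseteq> X" and L': "closed_subspace L" "L \<subseteq> Y"
    using K L by (simp_all add: M.inv_subspace_def N.inv_subspace_def)
  have eq: "{x \<in> K. F x \<in> L} = K \<inter> F -` L" by auto
  have "closed (F -` L)"
    using L' by (intro closed_vimage linear_continuous_on bounded_linear_contraction linear_F F_contraction)
      (simp add: closed_subspace_def)
  moreover have "subspace (F -` L)"
    using L' by (intro linear_subspace_vimage linear_F) (simp add: closed_subspace_def)
  ultimately have "closed_subspace (K \<inter> F -` L)"
    using K' by (intro closed_subspace_Int) (simp_all add: closed_subspace_def)
  then show ?thesis
    using K K' L by (auto simp: M.inv_subspace_def N.inv_subspace_def F_equivariant eq subset_iff)
qed

text \<open>\<open>rank_eq\<close> compares the kernels of a map and of its adjoint on full modules.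
  For \<open>F\<close> after \<open>proj K\<close>, the first kernel is the orthogonal sum of
  \<open>{x \<in> K. F x = 0}\<close> and the complement of \<open>K\<close>, and the second is the
  complement of the range.\<close>

theorem rank_nullity:
  assumes K: "M.inv_subspace K"
  shows "M.vdim K = M.vdim {x \<in> K. F x = 0} + N.vdim (closure (F ` K))"
proof -
  interpret K: closed_subspace K using K by (simp add: M.inv_subspace_def)
  let ?A = "\<lambda>x. F (proj K x)" and ?A' = "\<lambda>y. proj K (F' y)" and ?K0 = "{x \<in> K. F x = 0}"
  have KX: "K \<subseteq> X" using K by (simp add: M.inv_subspace_def)
  have linA: "linear ?A" using linear_compose[OF K.linear_proj linear_F] by (simp add: o_def)
  have leA: "norm (?A x) \<le> norm x" for x
    using F_contraction K.proj_norm_le by (rule order_trans)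
  have "?K0 = K \<inter> {x. F x = 0}" by auto
  then interpret K0: closed_subspace ?K0
    using closed_subspace_Int[OF K.closed_subspace_axioms closed_subspace_kernel[OF linear_F F_contraction]]
    by simp
  interpret ker: closed_subspace "{x. ?A x = 0}" by (rule closed_subspace_kernel[OF linA leA])
  have sub: "F ` K \<subseteq> Y" using F_in KX by auto
  interpret R: closed_subspace "closure (F ` K)"
    using inv_subspace_image[OF K] by (simp add: N.inv_subspace_def)
  have ker: "proj {x. ?A x = 0} b = proj ?K0 b + (b - proj K b)" for b
  proof (rule ker.proj_eqI)
    have "proj K (proj ?K0 b + (b - proj K b)) = proj ?K0 b"
      using K0.proj_in[of b] K.proj_in[of b]
      by (simp add: linear_add[OF K.linear_proj] linear_diff[OF K.linear_proj] K.proj_id)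
    then show "proj ?K0 b + (b - proj K b) \<in> {x. ?A x = 0}" using K0.proj_in[of b] by simp
    fix k assume "k \<in> {x. ?A x = 0}"
    then have k: "proj K k \<in> ?K0" using K.proj_in by simp
    then have k': "proj ?K0 (proj K k) = proj K k" by (rule K0.proj_id)
    have "proj ?K0 b \<bullet> k = proj K (proj ?K0 b) \<bullet> k" using K0.proj_in[of b] by (simp add: K.proj_id)
    also have "\<dots> = b \<bullet> proj K k" unfolding K.proj_selfadjoint K0.proj_selfadjoint k' ..
    finally show "(b - (proj ?K0 b + (b - proj K b))) \<bullet> k = 0"
      by (simp add: inner_diff_left inner_add_left K.proj_selfadjoint)
  qed
  have "M.vdim {x. ?A x = 0} = M.vdim ?K0 + M.vdim X - M.vdim K"
    unfolding M.vdim_X unfolding M.vdim_def ker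
    by (simp add: inner_add_left inner_diff_left sum.distrib sum_subtractf)
  moreover have "{y. ?A' y = 0} = orthogonal_comp (closure (F ` K))"
  proof -
    have "orthogonal_comp (closure (F ` K)) = orthogonal_comp (F ` K)"
    proof
      show "orthogonal_comp (closure (F ` K)) \<subseteq> orthogonal_comp (F ` K)"
        by (intro orthogonal_comp_anti_mono closure_subset)
      show "orthogonal_comp (F ` K) \<subseteq> orthogonal_comp (closure (F ` K))"
      proof
        fix y assume "y \<in> orthogonal_comp (F ` K)"
        then have "F ` K \<subseteq> {w. y \<bullet> w = 0}"
          by (auto simp: orthogonal_comp_def orthogonal_def inner_commute)
        then have "closure (F ` K) \<subseteq> {w. y \<bullet> w = 0}" by (rule closure_minimal[OF _ closed_hyperplane])
        then show "y \<in> orthogonal_comp (closure (F ` K))"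
          by (auto simp: orthogonal_comp_def orthogonal_def inner_commute)
      qed
    qed
    also have "\<dots> = {y. ?A' y = 0}"
      unfolding K.proj_eq_0_iff by (auto simp: orthogonal_comp_def orthogonal_def adjoint_F)
    finally show ?thesis ..
  qed
  then have "N.vdim {y. ?A' y = 0} = N.vdim Y - N.vdim (closure (F ` K))"
    unfolding N.vdim_X unfolding N.vdim_def
    by (simp add: R.proj_orthogonal_comp inner_diff_left sum_subtractf)
  moreover have "M.vdim X - M.vdim {x. ?A x = 0} = N.vdim Y - N.vdim {y. ?A' y = 0}"
  proof (rule rank_eq[OF linA _ leA])
    show "?A x \<bullet> y = x \<bullet> ?A' y" for x y by (simp add: adjoint_F K.proj_selfadjoint)
    show "?A x \<in> Y" for x using K.proj_in KX F_in by blast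
    show "?A' y \<in> X" for y using K.proj_in KX by blast
    show "?A (r g x) = s g (?A x)" if "g \<in> carrier G" "x \<in> X" for g x
      using that K.proj_in KX by (simp add: M.proj_equivariant[OF K] F_equivariant subset_iff)
    show "?A' (s g y) = r g (?A' y)" if "g \<in> carrier G" "y \<in> Y" for g y
      using that by (simp add: M.proj_equivariant[OF K] F'_equivariant F'_in)
  qed
  ultimately show ?thesis by simp
qed

text \<open>The condition \<open>F x \<in> L\<close> is the vanishing of
  \<open>F x - proj L (F x)\<close>, a map into the complement of \<open>L\<close>. By rank-nullity
  its kernel in \<open>K\<close> loses at most the dimension of that complement.\<close>

theorem vdim_vimage:
  assumes K: "M.inv_subspace K" and L: "N.inv_subspace L"
  shows "M.vdim K \<le> M.vdim {x \<in> K. F x \<in> L} + (N.vdim Y - N.vdim L)"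
proof -
  interpret L: closed_subspace L using L by (simp add: N.inv_subspace_def)
  have LY: "L \<subseteq> Y" using L by (simp add: N.inv_subspace_def)
  interpret H: gmod_hom G X B r Y D s "\<lambda>x. F x - proj L (F x)" "\<lambda>y. F' (y - proj L y)"
  proof (intro gmod_hom.intro gmod_pair_axioms gmod_hom_axioms.intro)
    have lin: "linear (\<lambda>x. proj L (F x))" using linear_compose[OF linear_F L.linear_proj] by (simp add: o_def)
    show "linear (\<lambda>x. F x - proj L (F x))" by (intro linear_compose_sub linear_F lin)
    show "(F x - proj L (F x)) \<bullet> y = x \<bullet> F' (y - proj L y)" for x y
      by (simp add: adjoint_F[symmetric] inner_diff_left inner_diff_right L.proj_selfadjoint)
    show "norm (F x - proj L (F x)) \<le> norm x" for x
    proof -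
      have "norm (F x - proj L (F x)) \<le> norm (F x)"
        using closed_subspace.proj_norm_le[OF closed_subspace_orthogonal_comp]
        by (simp only: L.proj_orthogonal_comp[symmetric])
      then show ?thesis using F_contraction by (rule order_trans)
    qed
    show "F x - proj L (F x) \<in> Y" if "x \<in> X" for x
      using that L.proj_in LY F_in by (intro subspace_diff N.X.subspace) auto
    show "F' (y - proj L y) \<in> X" if "y \<in> Y" for y
      using that L.proj_in LY by (intro F'_in subspace_diff N.X.subspace) auto
    show "F (r g x) - proj L (F (r g x)) = s g (F x - proj L (F x))" if "g \<in> carrier G" "x \<in> X" for g x
      using that L.proj_in LY F_in
      by (simp add: F_equivariant N.proj_equivariant[OF L] N.r_diff subset_iff)
  qed
  let ?R = "closure ((\<lambda>x. F x - proj L (F x)) ` K)"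
  have "M.vdim K = M.vdim {x \<in> K. F x - proj L (F x) = 0} + N.vdim ?R"
    by (rule H.rank_nullity[OF K])
  moreover have "{x \<in> K. F x - proj L (F x) = 0} = {x \<in> K. F x \<in> L}"
  proof -
    have "F x - proj L (F x) = 0 \<longleftrightarrow> F x \<in> L" for x
      unfolding right_minus_eq by (metis L.proj_in L.proj_id)
    then show ?thesis by simp
  qed
  moreover have "N.vdim ?R \<le> N.vdim (orthogonal_comp L)"
  proof (rule N.vdim_mono)
    show "closed_subspace ?R" using H.inv_subspace_image[OF K] by (simp add: N.inv_subspace_def)
    show "closed_subspace (orthogonal_comp L)" by (rule closed_subspace_orthogonal_comp)
    show "?R \<subseteq> orthogonal_comp L"
    proof (rule closure_minimal)
      have "F x - proj L (F x) \<in> orthogonal_comp L" for x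
        using L.proj_orth[of _ "F x"] unfolding orthogonal_comp_def orthogonal_def
        by (simp add: inner_commute[of _ "F x - proj L (F x)"])
      then show "(\<lambda>x. F x - proj L (F x)) ` K \<subseteq> orthogonal_comp L" by auto
      show "closed (orthogonal_comp L)"
        using closed_subspace_orthogonal_comp[of L] by (simp add: closed_subspace_def)
    qed
  qed
  moreover have "N.vdim (orthogonal_comp L) = N.vdim Y - N.vdim L"
    unfolding N.vdim_X unfolding N.vdim_def
    by (simp add: L.proj_orthogonal_comp inner_diff_left sum_subtractf)
  ultimately show ?thesis by simp
qed

end

section \<open>Products of Hilbert modules\<close>

lemma (in gmod) r_zero: "g \<in> carrier G \<Longrightarrow> r g 0 = 0"
  using r_norm[of g 0] X.subspace by (simp add: subspace_0)

lemma closed_subspace_zero: "closed_subspace {0}"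
  by unfold_locales (auto simp: subspace_def)

lemma (in gmod) vdim_zero: "vdim {0} = 0"
  by (simp add: vdim_def closed_subspace.proj_in[OF closed_subspace_zero, simplified])

abbreviation prod_basis :: "'e::zero set \<Rightarrow> 'f::zero set \<Rightarrow> ('e \<times> 'f) set"
  where "prod_basis B D \<equiv> (\<lambda>b. (b, 0)) ` B \<union> (\<lambda>d. (0, d)) ` D"

text \<open>Excluding 0 keeps the two copies disjoint, since \<open>(0, 0)\<close> could otherwise
  lie in both; this is the purpose of the axiom \<open>zero_notin_B\<close>.\<close>

lemma sum_prod_basis:
  assumes "finite B" "finite D" "0 \<notin> B" "0 \<notin> D"
  shows "sum f (prod_basis B D) = (\<Sum>b\<in>B. f (b, 0)) + (\<Sum>d\<in>D. f (0, d))"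
  using assms by (subst sum.union_disjoint) (auto simp: sum.reindex inj_on_def)

lemma gmod_prod:
  fixes X :: "'e::{real_inner, complete_space} set" and Y :: "'f::{real_inner, complete_space} set"
  assumes "gmod G X B r" "gmod G Y D s"
  shows "gmod G (X \<times> Y) (prod_basis B D) (\<lambda>g. map_prod (r g) (s g))"
proof -
  interpret M: gmod G X B r by fact
  interpret N: gmod G Y D s by fact
  show ?thesis
  proof (rule gmod.intro)
    show "group G" by (rule M.group)
    show "closed_subspace (X \<times> Y)"
      by (intro closed_subspace.intro closed_Times M.X.closed N.X.closed subspace_Times M.X.subspace N.X.subspace)
    show "finite (prod_basis B D)" using M.finite_B N.finite_B by simp
    show "prod_basis B D \<subseteq> X \<times> Y"
      using M.B_subset N.B_subset M.X.subspace N.X.subspace by (auto simp: subspace_0)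
    show "0 \<notin> prod_basis B D"
      using M.zero_notin_B N.zero_notin_B by (auto simp: zero_prod_def)
    fix g assume g: "g \<in> carrier G"
    fix x assume x: "x \<in> X \<times> Y"
    show "map_prod (r g) (s g) x \<in> X \<times> Y" using g x M.r_in N.r_in by auto
    show "map_prod (r g) (s g) x \<bullet> y = x \<bullet> map_prod (r (inv\<^bsub>G\<^esub> g)) (s (inv\<^bsub>G\<^esub> g)) y"
      if "y \<in> X \<times> Y" for y
      using g x that M.r_adjoint N.r_adjoint by (auto simp: inner_prod_def)
    show "norm (map_prod (r g) (s g) x) = norm x"
      using g x M.r_norm N.r_norm by (auto simp: norm_Pair)
  next
    fix x assume x: "x \<in> X \<times> Y"
    have *: "(\<Sum>b\<in>prod_basis B D. (x \<bullet> map_prod (r g) (s g) b)\<^sup>2)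
        = (\<Sum>b\<in>B. (fst x \<bullet> r g b)\<^sup>2) + (\<Sum>d\<in>D. (snd x \<bullet> s g d)\<^sup>2)" if "g \<in> carrier G" for g
      unfolding sum_prod_basis[OF M.finite_B N.finite_B M.zero_notin_B N.zero_notin_B]
      using that by (simp add: inner_prod_def M.r_zero N.r_zero)
    have "((\<lambda>g. (\<Sum>b\<in>B. (fst x \<bullet> r g b)\<^sup>2) + (\<Sum>d\<in>D. (snd x \<bullet> s g d)\<^sup>2))
        has_sum (fst x \<bullet> fst x + snd x \<bullet> snd x)) (carrier G)"
      using x by (intro has_sum_add M.parseval N.parseval) auto
    then show "((\<lambda>g. \<Sum>b\<in>prod_basis B D. (x \<bullet> map_prod (r g) (s g) b)\<^sup>2) has_sum x \<bullet> x) (carrier G)"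
      unfolding inner_prod_def[of x x] using * by (simp cong: has_sum_cong)
  qed
qed

lemma vdim_Times:
  assumes "gmod G X B r" "gmod G Y D s"
  shows "gmod.vdim (prod_basis B D) (X \<times> Y) = gmod.vdim B X + gmod.vdim D Y"
proof -
  interpret M: gmod G X B r by fact
  interpret N: gmod G Y D s by fact
  interpret P: gmod G "X \<times> Y" "prod_basis B D" "\<lambda>g. map_prod (r g) (s g)"
    by (intro gmod_prod assms)
  show ?thesis
    unfolding P.vdim_X M.vdim_X N.vdim_X
    by (simp add: sum_prod_basis[OF M.finite_B N.finite_B M.zero_notin_B N.zero_notin_B] inner_prod_def)
qed

lemma gmod_hom_fst:
  fixes X :: "'e::{real_inner, complete_space} set" and Y :: "'f::{real_inner, complete_space} set"
  assumes "gmod G X B r" "gmod G Y D s"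
  shows "gmod_hom G (X \<times> Y) (prod_basis B D) (\<lambda>g. map_prod (r g) (s g)) X B r fst (\<lambda>x. (x, 0))"
proof (intro gmod_hom.intro gmod_pair.intro gmod_prod assms gmod_hom_axioms.intro)
  show "norm (fst x) \<le> norm x" for x :: "'e \<times> 'f"
    by (metis norm_fst_le prod.collapse)
qed (use assms(2) in \<open>auto simp: inner_prod_def linear_fst gmod_def closed_subspace_def subspace_0\<close>)

lemma gmod_hom_snd:
  fixes X :: "'e::{real_inner, complete_space} set" and Y :: "'f::{real_inner, complete_space} set"
  assumes "gmod G X B r" "gmod G Y D s"
  shows "gmod_hom G (X \<times> Y) (prod_basis B D) (\<lambda>g. map_prod (r g) (s g)) Y D s snd (\<lambda>y. (0, y))"
proof (intro gmod_hom.intro gmod_pair.intro gmod_prod assms gmod_hom_axioms.intro)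
  show "norm (snd x) \<le> norm x" for x :: "'e \<times> 'f"
    by (metis norm_snd_le prod.collapse)
qed (use assms(1) in \<open>auto simp: inner_prod_def linear_snd gmod_def closed_subspace_def subspace_0\<close>)

lemma gmod_hom_comp:
  assumes "gmod_hom G X B r Y D s F F'" "gmod_hom G Y D s Z E t H H'"
  shows "gmod_hom G X B r Z E t (\<lambda>x. H (F x)) (\<lambda>z. F' (H' z))"
proof -
  interpret F: gmod_hom G X B r Y D s F F' by fact
  interpret H: gmod_hom G Y D s Z E t H H' by fact
  show ?thesis
  proof (intro gmod_hom.intro gmod_pair.intro F.M.gmod_axioms H.N.gmod_axioms gmod_hom_axioms.intro)
    show "linear (\<lambda>x. H (F x))"
      using linear_compose[OF F.linear_F H.linear_F] by (simp add: o_def)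
    show "norm (H (F x)) \<le> norm x" for x
      using H.F_contraction F.F_contraction by (rule order_trans)
  qed (simp_all add: F.adjoint_F H.adjoint_F F.F_in H.F_in F.F'_in H.F'_in F.F_equivariant H.F_equivariant)
qed

lemma gmod_hom_map_prod:
  fixes F1 :: "'e1::{real_inner, complete_space} \<Rightarrow> 'f1::{real_inner, complete_space}"
    and F2 :: "'e2::{real_inner, complete_space} \<Rightarrow> 'f2::{real_inner, complete_space}"
  assumes "gmod_hom G X1 B1 r1 Y1 D1 s1 F1 F1'" "gmod_hom G X2 B2 r2 Y2 D2 s2 F2 F2'"
  shows "gmod_hom G (X1 \<times> X2) (prod_basis B1 B2) (\<lambda>g. map_prod (r1 g) (r2 g))
    (Y1 \<times> Y2) (prod_basis D1 D2) (\<lambda>g. map_prod (s1 g) (s2 g)) (map_prod F1 F2) (map_prod F1' F2')"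
proof -
  interpret F1: gmod_hom G X1 B1 r1 Y1 D1 s1 F1 F1' by fact
  interpret F2: gmod_hom G X2 B2 r2 Y2 D2 s2 F2 F2' by fact
  show ?thesis
  proof (intro gmod_hom.intro gmod_pair.intro gmod_prod F1.M.gmod_axioms F2.M.gmod_axioms
      F1.N.gmod_axioms F2.N.gmod_axioms gmod_hom_axioms.intro)
    show "linear (map_prod F1 F2)"
      by (rule linearI) (auto simp: linear_add[OF F1.linear_F] linear_add[OF F2.linear_F]
          linear_scale[OF F1.linear_F] linear_scale[OF F2.linear_F])
    show "norm (map_prod F1 F2 x) \<le> norm x" for x
      using F1.F_contraction[of "fst x"] F2.F_contraction[of "snd x"]
      by (cases x) (auto simp: norm_Pair intro!: add_mono power_mono)
  qed (auto simp: inner_prod_def F1.adjoint_F F2.adjoint_F F1.F_in F2.F_in F1.F'_in F2.F'_in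
      F1.F_equivariant F2.F_equivariant)
qed

section \<open>Dimension of graphs in the square of a module\<close>

locale gmod_powers = gmod
begin

abbreviation "B2 \<equiv> prod_basis B B"
abbreviation "r2 \<equiv> \<lambda>g. map_prod (r g) (r g)"

sublocale P2: gmod G "X \<times> X" B2 r2
  by (intro gmod_prod gmod_axioms)

sublocale P4: gmod G "(X \<times> X) \<times> (X \<times> X)" "prod_basis B2 B2" "\<lambda>g. map_prod (r2 g) (r2 g)"
  by (intro gmod_prod gmod_axioms)

lemmas hom_fst = gmod_hom_fst[OF gmod_axioms gmod_axioms]
lemmas hom_snd = gmod_hom_snd[OF gmod_axioms gmod_axioms]

lemma vdim_P2: "P2.vdim (X \<times> X) = 2 * vdim X"
  by (simp add: vdim_Times[OF gmod_axioms gmod_axioms])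

lemma vdim_P4: "P4.vdim ((X \<times> X) \<times> (X \<times> X)) = 4 * vdim X"
  by (simp add: vdim_Times[OF P2.gmod_axioms P2.gmod_axioms] vdim_P2)

text \<open>The first coordinate is injective on the graph and has dense range, so rank-nullity
  leaves only the dimension of the base.\<close>

lemma vdim_graph:
  assumes T: "P2.inv_subspace T" and dense: "X \<subseteq> closure (Domain T)"
    and inj: "\<And>v. (0, v) \<in> T \<Longrightarrow> v = 0"
  shows "P2.vdim T = vdim X"
proof -
  interpret F: gmod_hom G "X \<times> X" B2 r2 X B r fst "\<lambda>x. (x, 0)" by (rule hom_fst)
  have "Domain T \<subseteq> X" using T by (auto simp: P2.inv_subspace_def)
  then have "closure (fst ` T) = X"
    using dense X.closed closure_minimal[of "Domain T" X] by (auto simp: Domain_fst)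
  moreover have "{x \<in> T. fst x = 0} = {0}"
    using inj T by (auto simp: P2.inv_subspace_def closed_subspace_def zero_prod_def dest: subspace_0)
  ultimately show ?thesis using F.rank_nullity[OF T] P2.vdim_zero by simp
qed

end

section \<open>Orthogonal complements inside a module\<close>

context gmod
begin

lemma inv_subspace_orthogonal:
  assumes K: "inv_subspace K"
  shows "inv_subspace (X \<inter> orthogonal_comp K)"
proof -
  interpret group G by (rule group)
  have "r g x \<in> orthogonal_comp K" if "g \<in> carrier G" "x \<in> X" "x \<in> orthogonal_comp K" for g x
  proof -
    have "r g x \<bullet> k = 0" if k: "k \<in> K" for k
    proof -
      have "r g x \<bullet> k = x \<bullet> r (inv g) k"
        using K k \<open>g \<in> carrier G\<close> \<open>x \<in> X\<close> by (intro r_adjoint) (auto simp: inv_subspace_def)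
      also have "\<dots> = 0"
        using K k \<open>g \<in> carrier G\<close> \<open>x \<in> orthogonal_comp K\<close>
        by (auto simp: inv_subspace_def orthogonal_comp_def orthogonal_def inner_commute)
      finally show ?thesis .
    qed
    then show ?thesis by (simp add: orthogonal_comp_def orthogonal_def inner_commute)
  qed
  then show ?thesis
    by (auto simp: inv_subspace_def r_in intro: closed_subspace_Int closed_subspace_X closed_subspace_orthogonal_comp)
qed

lemma vdim_orthogonal:
  assumes K: "inv_subspace K"
  shows "vdim (X \<inter> orthogonal_comp K) = vdim X - vdim K"
proof -
  interpret K: closed_subspace K using K by (simp add: inv_subspace_def)
  interpret O: closed_subspace "X \<inter> orthogonal_comp K"
    by (intro closed_subspace_Int closed_subspace_X closed_subspace_orthogonal_comp)
  have "proj (X \<inter> orthogonal_comp K) b = b - proj K b" if "b \<in> B" for b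
  proof (rule O.proj_eqI)
    have "b \<in> X" "proj K b \<in> X" using that B_subset K K.proj_in by (auto simp: inv_subspace_def)
    then have "b - proj K b \<in> X" by (rule subspace_diff[OF X.subspace])
    then show "b - proj K b \<in> X \<inter> orthogonal_comp K"
      using K.proj_orth[of _ b]
      by (simp add: orthogonal_comp_def orthogonal_def inner_commute[of _ "b - proj K b"])
    show "(b - (b - proj K b)) \<bullet> k = 0" if "k \<in> X \<inter> orthogonal_comp K" for k
      using that K.proj_in[of b] by (simp add: orthogonal_comp_def orthogonal_def)
  qed
  then show ?thesis
    unfolding vdim_X by (simp add: vdim_def inner_diff_left sum_subtractf)
qed

end

section \<open>Invariant closed operators and systems of equations\<close>

context gmod_powers
begin

text \<open>The real shadow of a closed operator, containing just what the dimension sees. As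
  \<open>T\<close> is a subspace, the condition on \<open>(0, v)\<close> amounts to
  single-valuedness.\<close>

definition inv_operator
  where "inv_operator T \<longleftrightarrow> P2.inv_subspace T \<and> (\<forall>v. (0, v) \<in> T \<longrightarrow> v = 0) \<and> X \<subseteq> closure (Domain T)"

lemma vdim_inv_operator: "inv_operator T \<Longrightarrow> P2.vdim T = vdim X"
  using vdim_graph by (simp add: inv_operator_def)

text \<open>A closed operator has no proper closed restriction: both graphs have the dimension of the base space.\<close>

theorem closure_eq_inv_operator:
  assumes A: "inv_operator A" and sub: "N \<subseteq> A" and N: "subspace N"
    and inv: "\<And>g x. g \<in> carrier G \<Longrightarrow> x \<in> N \<Longrightarrow> r2 g x \<in> N"
    and dense: "X \<subseteq> closure (Domain N)"
  shows "closure N = A"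
proof (rule P2.inv_subspace_eqI)
  show A': "P2.inv_subspace A" using A by (simp add: inv_operator_def)
  then have AX: "A \<subseteq> X \<times> X" by (simp add: P2.inv_subspace_def)
  have "closed A" using A' by (simp add: P2.inv_subspace_def closed_subspace_def)
  then show clA: "closure N \<subseteq> A" by (rule closure_minimal[OF sub])
  show N': "P2.inv_subspace (closure N)"
    using sub AX N inv by (intro P2.inv_subspace_closure) auto
  have "Domain N \<subseteq> Domain (closure N)" using closure_subset by fastforce
  then have "X \<subseteq> closure (Domain (closure N))" using dense closure_mono by blast
  then have "inv_operator (closure N)"
    using A clA N' by (auto simp: inv_operator_def)
  then show "P2.vdim A \<le> P2.vdim (closure N)" using A by (simp add: vdim_inv_operator)
qed

text \<open>Prepares the density of the domain of the adjoint, whose graph is the orthogonal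
  complement of \<open>T\<close> up to exchanging coordinates and a sign. The complement has
  dimension \<open>2 * vdim X - vdim X\<close>, and the second coordinate is injective on it because
  \<open>T\<close> is densely defined; so the image has full dimension.\<close>

lemma dense_range_orthogonal:
  assumes T: "inv_operator T"
  shows "X \<subseteq> closure (snd ` ((X \<times> X) \<inter> orthogonal_comp T))"
proof -
  let ?O = "(X \<times> X) \<inter> orthogonal_comp T"
  interpret F: gmod_hom G "X \<times> X" B2 r2 X B r snd "\<lambda>x. (0, x)" by (rule hom_snd)
  have T': "P2.inv_subspace T" using T by (simp add: inv_operator_def)
  have O: "P2.inv_subspace ?O" by (rule P2.inv_subspace_orthogonal[OF T'])
  have "x = 0" if x: "x \<in> ?O" "snd x = 0" for x
  proof -
    have "fst x \<bullet> a = 0" if "a \<in> Domain T" for a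
      using x that by (auto simp: orthogonal_comp_def orthogonal_def inner_prod_def inner_commute)
    then have "Domain T \<subseteq> {a. fst x \<bullet> a = 0}" by auto
    then have "closure (Domain T) \<subseteq> {a. fst x \<bullet> a = 0}"
      by (rule closure_minimal) (rule closed_hyperplane)
    then have "fst x \<bullet> fst x = 0" using x T by (auto simp: inv_operator_def)
    then show ?thesis using x by (simp add: prod_eq_iff)
  qed
  moreover have "0 \<in> ?O" using O unfolding P2.inv_subspace_def closed_subspace_def by (intro subspace_0) simp
  ultimately have "{x \<in> ?O. snd x = 0} = {0}"
    by (simp only: set_eq_iff mem_Collect_eq singleton_iff) (metis snd_zero)
  then have "vdim (closure (snd ` ?O)) = vdim X"
    using F.rank_nullity[OF O] P2.vdim_zero P2.vdim_orthogonal[OF T'] vdim_inv_operator[OF T]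
    by (simp add: vdim_P2)
  then have "closure (snd ` ?O) = X"
    using F.inv_subspace_image[OF O] inv_subspace_X
    by (intro inv_subspace_eqI) (auto simp: inv_subspace_def)
  then show ?thesis by simp
qed

text \<open>
  Three equations in four unknowns, each of codimension \<open>vdim X\<close> in \<open>X\<^sup>4\<close>, leave a solution
  space of dimension at least \<open>vdim X\<close>; it embeds into the first coordinate, so the image is dense.
\<close>

theorem dense_solutions:
  assumes T: "inv_operator T1" "inv_operator T2" "inv_operator T3"
    and P: "gmod_hom G ((X \<times> X) \<times> (X \<times> X)) (prod_basis B2 B2) (\<lambda>g. map_prod (r2 g) (r2 g)) (X \<times> X) B2 r2 P P'"
      "\<And>a b c d. P ((a, b), (c, d)) \<in> {(a, c), (b, c)}"
    and Q: "gmod_hom G ((X \<times> X) \<times> (X \<times> X)) (prod_basis B2 B2) (\<lambda>g. map_prod (r2 g) (r2 g)) (X \<times> X) B2 r2 Q Q'"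
      "\<And>a b c d. Q ((a, b), (c, d)) \<in> {(a, d), (b, d), (c, d)}"
  shows "X \<subseteq> closure {a. \<exists>b c d. (a, b) \<in> T1 \<and> P ((a, b), (c, d)) \<in> T2 \<and> Q ((a, b), (c, d)) \<in> T3}"
proof -
  let ?X4 = "(X \<times> X) \<times> (X \<times> X)"
  interpret F: gmod_hom G ?X4 "prod_basis B2 B2" "\<lambda>g. map_prod (r2 g) (r2 g)" "X \<times> X" B2 r2 fst "\<lambda>x. (x, 0)"
    by (rule gmod_hom_fst[OF P2.gmod_axioms P2.gmod_axioms])
  interpret P: gmod_hom G ?X4 "prod_basis B2 B2" "\<lambda>g. map_prod (r2 g) (r2 g)" "X \<times> X" B2 r2 P P'
    by (rule P(1))
  interpret Q: gmod_hom G ?X4 "prod_basis B2 B2" "\<lambda>g. map_prod (r2 g) (r2 g)" "X \<times> X" B2 r2 Q Q'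
    by (rule Q(1))
  interpret H: gmod_hom G ?X4 "prod_basis B2 B2" "\<lambda>g. map_prod (r2 g) (r2 g)" X B r
    "\<lambda>x. fst (fst x)" "\<lambda>x. ((x, 0), 0)"
    by (rule gmod_hom_comp[OF F.gmod_hom_axioms hom_fst])
  have T': "P2.inv_subspace T1" "P2.inv_subspace T2" "P2.inv_subspace T3"
    using T by (simp_all add: inv_operator_def)
  define K1 K2 K3 where "K1 = {x \<in> ?X4. fst x \<in> T1}" and "K2 = {x \<in> K1. P x \<in> T2}"
    and "K3 = {x \<in> K2. Q x \<in> T3}"
  have inv1: "P4.inv_subspace K1"
    unfolding K1_def by (rule F.inv_subspace_vimage[OF P4.inv_subspace_X T'(1)])
  have inv2: "P4.inv_subspace K2"
    unfolding K2_def by (rule P.inv_subspace_vimage[OF inv1 T'(2)])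
  have inv3: "P4.inv_subspace K3"
    unfolding K3_def by (rule Q.inv_subspace_vimage[OF inv2 T'(3)])
  have "4 * vdim X \<le> P4.vdim K1 + vdim X"
    using F.vdim_vimage[OF P4.inv_subspace_X T'(1)] T(1)
    by (simp add: K1_def vdim_P2 vdim_P4 vdim_inv_operator)
  moreover have "P4.vdim K1 \<le> P4.vdim K2 + vdim X"
    using P.vdim_vimage[OF inv1 T'(2)] T(2) by (simp add: K2_def vdim_P2 vdim_inv_operator)
  moreover have "P4.vdim K2 \<le> P4.vdim K3 + vdim X"
    using Q.vdim_vimage[OF inv2 T'(3)] T(3) by (simp add: K3_def vdim_P2 vdim_inv_operator)
  ultimately have le: "vdim X \<le> P4.vdim K3" by simp
  have sv: "v = 0" if "(0, v) \<in> T1 \<or> (0, v) \<in> T2 \<or> (0, v) \<in> T3" for v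
    using that T by (auto simp: inv_operator_def)
  have "x = 0" if x: "x \<in> K3" and 0: "fst (fst x) = 0" for x
  proof -
    obtain a b c d where abcd: "x = ((a, b), (c, d))" by (metis prod.collapse)
    have m: "(a, b) \<in> T1" "P ((a, b), (c, d)) \<in> T2" "Q ((a, b), (c, d)) \<in> T3"
      using x by (auto simp: abcd K1_def K2_def K3_def)
    have a: "a = 0" using 0 abcd by simp
    have b: "b = 0" using m(1) a sv by blast
    have c: "c = 0" using m(2) P(2)[of a b c d] a b sv by auto
    have d: "d = 0" using m(3) Q(2)[of a b c d] a b c sv by auto
    show ?thesis using abcd a b c d by (simp add: zero_prod_def)
  qed
  moreover have "0 \<in> K3" using inv3 by (simp add: P4.inv_subspace_def closed_subspace_def subspace_0)
  ultimately have "{x \<in> K3. fst (fst x) = 0} = {0}" by (auto simp: fst_zero)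
  then have "vdim X \<le> vdim (closure ((\<lambda>x. fst (fst x)) ` K3))"
    using le H.rank_nullity[OF inv3] P4.vdim_zero by simp
  then have "closure ((\<lambda>x. fst (fst x)) ` K3) = X"
    using H.inv_subspace_image[OF inv3] inv_subspace_X
    by (intro inv_subspace_eqI) (auto simp: inv_subspace_def)
  moreover have "(\<lambda>x. fst (fst x)) ` K3
      \<subseteq> {a. \<exists>b c d. (a, b) \<in> T1 \<and> P ((a, b), (c, d)) \<in> T2 \<and> Q ((a, b), (c, d)) \<in> T3}"
    by (auto simp: K1_def K2_def K3_def) blast
  ultimately show ?thesis using closure_mono by blast
qed

text \<open>Three shapes serve the ring axioms: the fan for associativity of sums,
  \<open>dense_chain\<close> for associativity of products, \<open>dense_branch\<close> for
  distributivity. They differ only in the choice of \<open>P\<close> and \<open>Q\<close>.\<close>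

lemma dense_fan:
  assumes "inv_operator T1" "inv_operator T2" "inv_operator T3"
  shows "X \<subseteq> closure {a. \<exists>b c d. (a, b) \<in> T1 \<and> (a, c) \<in> T2 \<and> (a, d) \<in> T3}"
  using dense_solutions[OF assms gmod_hom_map_prod[OF hom_fst hom_fst] _ gmod_hom_map_prod[OF hom_fst hom_snd]]
  by simp

lemma dense_chain:
  assumes "inv_operator T1" "inv_operator T2" "inv_operator T3"
  shows "X \<subseteq> closure {a. \<exists>b c d. (a, b) \<in> T1 \<and> (b, c) \<in> T2 \<and> (c, d) \<in> T3}"
  using dense_solutions[OF assms gmod_hom_map_prod[OF hom_snd hom_fst] _
      gmod_hom_snd[OF P2.gmod_axioms P2.gmod_axioms]]
  by simp

lemma dense_branch:
  assumes "inv_operator T1" "inv_operator T2" "inv_operator T3"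
  shows "X \<subseteq> closure {a. \<exists>b c d. (a, b) \<in> T1 \<and> (b, c) \<in> T2 \<and> (b, d) \<in> T3}"
  using dense_solutions[OF assms gmod_hom_map_prod[OF hom_snd hom_fst] _ gmod_hom_map_prod[OF hom_snd hom_snd]]
  by simp

end

section \<open>Right translations on square-summable functions\<close>

lemma coord_zero [simp]: "coord 0 x = 0"
  and coord_add [simp]: "coord (f + g) x = coord f x + coord g x"
  and coord_uminus [simp]: "coord (- f) x = - coord f x"
  and coord_scaleC [simp]: "coord (c *\<^sub>C f) x = c * coord f x"
  by (simp_all add: zero_ell2.rep_eq plus_ell2.rep_eq uminus_ell2.rep_eq scaleC.rep_eq)

lemma coord_diff [simp]: "coord (f - g) x = coord f x - coord g x"
  unfolding minus_ell2_def coord_add coord_uminus by simp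

lemma scaleC_add_right: "c *\<^sub>C (f + g) = c *\<^sub>C f + c *\<^sub>C g"
  and scaleC_zero_right [simp]: "c *\<^sub>C (0 :: 'a ell2) = 0"
  and scaleC_minus_one: "(- 1) *\<^sub>C f = - f"
  for f g :: "'a ell2"
  by (rule ell2_eqI; simp add: algebra_simps)+

lemma scaleR_scaleC: "a *\<^sub>R f = of_real a *\<^sub>C f" for f :: "'a ell2"
  by (rule scaleR_ell2_def)

lemma inner_cinner: "f \<bullet> g = Re (cinner f g)"
  by (rule inner_ell2_def)

lemma cinner_add_left: "cinner (f + g) h = cinner f h + cinner g h"
  by (simp add: cinner_def ring_distribs infsum_add[OF ell2_product_summable ell2_product_summable])

lemma cinner_scaleC_left: "cinner (c *\<^sub>C f) g = c * cinner f g"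
  by (simp add: cinner_def mult.assoc infsum_cmult_right')

lemma cinner_commute: "cinner g f = cnj (cinner f g)"
proof -
  have "cinner g f = (\<Sum>\<^sub>\<infinity>x. cnj (coord f x * cnj (coord g x)))"
    by (simp add: cinner_def mult.commute)
  then show ?thesis by (simp only: infsum_cnj cinner_def)
qed

lemma cinner_add_right: "cinner f (g + h) = cinner f g + cinner f h"
  by (metis cinner_add_left cinner_commute complex_cnj_add)

lemma scaleC_zero_left: "0 *\<^sub>C f = 0"
  by (rule ell2_eqI) simp

lemma cinner_scaleC_right: "cinner f (c *\<^sub>C g) = cnj c * cinner f g"
  by (metis cinner_commute cinner_scaleC_left complex_cnj_mult)

lemma cinner_diff_left: "cinner (f - g) h = cinner f h - cinner g h"
  using cinner_add_left[of "f - g" g h] by simp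

lemma cinner_self: "cinner f f = of_real ((norm f)\<^sup>2)"
  using arg_cong[OF cinner_commute[of f f], of Im]
  by (simp add: complex_eq_iff power2_norm_eq_inner inner_cinner)

lemma norm_scaleC: "norm (c *\<^sub>C f) = cmod c * norm f"
proof -
  have "complex_of_real ((norm (c *\<^sub>C f))\<^sup>2) = of_real ((cmod c * norm f)\<^sup>2)"
    unfolding cinner_self[symmetric] cinner_scaleC_left cinner_scaleC_right power_mult_distrib
      of_real_mult complex_norm_square by (simp only: ac_simps)
  then have "(norm (c *\<^sub>C f))\<^sup>2 = (cmod c * norm f)\<^sup>2" by (simp only: of_real_eq_iff)
  then show ?thesis by (rule power2_eq_imp_eq) auto
qed

section \<open>Basis vectors and the subspace of functions on the carrier\<close>

definition ket :: "'a \<Rightarrow> 'a ell2"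
  where "ket a = Abs_ell2 (\<lambda>x. if x = a then 1 else 0)"

lemma coord_ket [simp]: "coord (ket a) x = (if x = a then 1 else 0)"
proof -
  have "(\<lambda>x. (cmod (if x = a then 1 else 0))\<^sup>2) summable_on {a}" by simp
  then have "(\<lambda>x. (cmod (if x = a then 1 else 0))\<^sup>2) summable_on UNIV"
    by (rule summable_on_cong_neutral[THEN iffD1, rotated -1]) auto
  then show ?thesis by (simp add: ket_def Abs_ell2_inverse)
qed

lemma cinner_ket: "cinner f (ket a) = coord f a"
proof -
  have "cinner f (ket a) = (\<Sum>\<^sub>\<infinity>x\<in>{a}. coord f x * cnj (coord (ket a) x))"
    unfolding cinner_def by (rule infsum_cong_neutral) auto
  then show ?thesis by simp
qed

lemma l2_scaleC: "f \<in> l2 G \<Longrightarrow> c *\<^sub>C f \<in> l2 G"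
  by (simp add: l2_def)

lemma l2_add: "f \<in> l2 G \<Longrightarrow> g \<in> l2 G \<Longrightarrow> f + g \<in> l2 G"
  by (simp add: l2_def)

lemma ket_in_l2: "a \<in> carrier G \<Longrightarrow> ket a \<in> l2 G"
  by (auto simp: l2_def)

text \<open>An orthogonal complement is automatically a closed subspace. The real inner product with
  \<open>ket a\<close> sees only the real part of a coordinate; \<open>\<i> *\<^sub>C ket a\<close>
  accounts for the imaginary part.\<close>

lemma closed_subspace_l2: "closed_subspace (l2 G)"
proof -
  have "l2 G = orthogonal_comp (\<Union>a\<in>- carrier G. {ket a, \<i> *\<^sub>C ket a})"
    by (auto simp: l2_def orthogonal_comp_def orthogonal_def inner_commute[of _ "_ :: 'a ell2"]
        inner_cinner cinner_scaleC_right cinner_ket complex_eq_iff)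
  then show ?thesis using closed_subspace_orthogonal_comp by metis
qed

text \<open>As \<open>f\<close> is evaluated at \<open>x \<otimes> g\<close>, the basis vector
  \<open>h\<close> goes to \<open>h \<otimes> inv g\<close>; the inverse makes this a left action,
  and it commutes with left translations.\<close>

definition right_translation :: "('a, 'b) monoid_scheme \<Rightarrow> 'a \<Rightarrow> 'a ell2 \<Rightarrow> 'a ell2"
  where "right_translation G g f = Abs_ell2 (\<lambda>x. if x \<in> carrier G then coord f (x \<otimes>\<^bsub>G\<^esub> g) else 0)"

context group
begin

lemma coord_right_translation:
  assumes "g \<in> carrier G"
  shows "coord (right_translation G g f) x = (if x \<in> carrier G then coord f (x \<otimes> g) else 0)"
proof -
  let ?s = "\<lambda>x. x \<otimes> g"
  have inj: "inj_on ?s (carrier G)"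
    using assms by (auto intro!: inj_onI)
  have "(\<lambda>x. (cmod (coord f x))\<^sup>2) summable_on ?s ` carrier G"
    by (rule summable_on_subset_banach[OF coord_summable]) simp
  then have "(\<lambda>x. (cmod (coord f (?s x)))\<^sup>2) summable_on carrier G"
    using summable_on_reindex[OF inj, of "\<lambda>x. (cmod (coord f x))\<^sup>2"] by (simp add: o_def)
  then have "(\<lambda>x. (cmod (if x \<in> carrier G then coord f (?s x) else 0))\<^sup>2) summable_on UNIV"
    by (rule summable_on_cong_neutral[THEN iffD1, rotated -1]) auto
  then show ?thesis
    by (simp add: right_translation_def Abs_ell2_inverse)
qed

lemma right_translation_in_l2: "g \<in> carrier G \<Longrightarrow> right_translation G g f \<in> l2 G"
  by (simp add: l2_def coord_right_translation)

lemma right_translation_add: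
    "g \<in> carrier G \<Longrightarrow> right_translation G g (f + h) = right_translation G g f + right_translation G g h"
  and right_translation_scaleC:
    "g \<in> carrier G \<Longrightarrow> right_translation G g (c *\<^sub>C f) = c *\<^sub>C right_translation G g f"
  and right_translation_zero: "g \<in> carrier G \<Longrightarrow> right_translation G g 0 = 0"
  by (rule ell2_eqI; simp add: coord_right_translation)+

lemma right_translation_mult:
  assumes "g \<in> carrier G" "h \<in> carrier G"
  shows "right_translation G g (right_translation G h f) = right_translation G (g \<otimes> h) f"
  by (rule ell2_eqI) (simp add: coord_right_translation assms m_assoc)

lemma right_translation_one: "f \<in> l2 G \<Longrightarrow> right_translation G \<one> f = f"
  by (rule ell2_eqI) (auto simp: coord_right_translation l2_def)

lemma right_translation_inv:
  assumes "g \<in> carrier G" "f \<in> l2 G"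
  shows "right_translation G g (right_translation G (inv g) f) = f"
    "right_translation G (inv g) (right_translation G g f) = f"
  using assms by (simp_all add: right_translation_mult right_translation_one)

lemma right_translation_ket: "g \<in> carrier G \<Longrightarrow> right_translation G g (ket \<one>) = ket (inv g)"
  by (rule ell2_eqI) (auto simp: coord_right_translation inv_equality)

lemma cinner_carrier: "f \<in> l2 G \<Longrightarrow> cinner f h = (\<Sum>\<^sub>\<infinity>x\<in>carrier G. coord f x * cnj (coord h x))"
  unfolding cinner_def by (rule infsum_cong_neutral) (auto simp: l2_def)

lemma cinner_right_translation:
  assumes g: "g \<in> carrier G" and "f \<in> l2 G"
  shows "cinner (right_translation G g f) h = cinner f (right_translation G (inv g) h)"
proof -
  have bij: "bij_betw (\<lambda>x. x \<otimes> g) (carrier G) (carrier G)"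
    by (rule bij_betw_byWitness[where f' = "\<lambda>x. x \<otimes> inv g"]) (use g in \<open>auto simp: m_assoc\<close>)
  have "cinner (right_translation G g f) h = (\<Sum>\<^sub>\<infinity>x\<in>carrier G. coord f (x \<otimes> g) * cnj (coord h x))"
    by (simp add: cinner_carrier right_translation_in_l2 g coord_right_translation cong: infsum_cong)
  also have "\<dots> = (\<Sum>\<^sub>\<infinity>x\<in>carrier G.
      coord f (x \<otimes> g) * cnj (coord (right_translation G (inv g) h) (x \<otimes> g)))"
    by (rule infsum_cong) (use g in \<open>simp add: coord_right_translation m_assoc\<close>)
  also have "\<dots> = cinner f (right_translation G (inv g) h)"
    unfolding cinner_carrier[OF assms(2)]
    by (rule infsum_reindex_bij_betw[OF bij, of "\<lambda>x. coord f x * cnj (coord (right_translation G (inv g) h) x)"])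
  finally show ?thesis .
qed

lemma norm_right_translation:
  assumes "g \<in> carrier G" "f \<in> l2 G"
  shows "norm (right_translation G g f) = norm f"
proof -
  have "right_translation G g f \<bullet> right_translation G g f = f \<bullet> f"
    using assms by (simp add: inner_cinner cinner_right_translation right_translation_inv)
  then show ?thesis by (simp add: norm_eq_sqrt_inner)
qed

text \<open>The real inner products of \<open>f\<close> with the translates of
  \<open>ket \<one>\<close> and \<open>\<i> *\<^sub>C ket \<one>\<close> are the real and imaginary
  parts of the coordinate at \<open>inv g\<close>, so Parseval is the formula for the norm reindexed
  by inversion.\<close>

lemma gmod_l2: "gmod G (l2 G) {ket \<one>, \<i> *\<^sub>C ket \<one>} (right_translation G)"
proof (rule gmod.intro)
  show "group G" by (rule group_axioms)
  show "closed_subspace (l2 G)" by (rule closed_subspace_l2)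
  show "{ket \<one>, \<i> *\<^sub>C ket \<one>} \<subseteq> l2 G" by (simp add: ket_in_l2 l2_scaleC)
  have "coord (ket \<one>) \<one> \<noteq> coord (0 :: 'a ell2) \<one>" "coord (\<i> *\<^sub>C ket \<one>) \<one> \<noteq> coord (0 :: 'a ell2) \<one>"
    by simp_all
  then show "(0 :: 'a ell2) \<notin> {ket \<one>, \<i> *\<^sub>C ket \<one>}" by (metis insertE singletonD)
  show "right_translation G g f \<bullet> h = f \<bullet> right_translation G (inv g) h"
    if "g \<in> carrier G" "f \<in> l2 G" for g f h
    using that by (simp add: inner_cinner cinner_right_translation)
next
  fix f assume f: "f \<in> l2 G"
  have "coord (ket \<one>) \<one> \<noteq> coord (\<i> *\<^sub>C ket \<one>) \<one>" by simp
  then have ne: "ket \<one> \<noteq> \<i> *\<^sub>C ket \<one>" by metis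
  have sum_eq: "(\<Sum>b\<in>{ket \<one>, \<i> *\<^sub>C ket \<one>}. (f \<bullet> right_translation G g b)\<^sup>2) = (cmod (coord f (inv g)))\<^sup>2"
    if "g \<in> carrier G" for g
    using that ne
    by (simp add: inner_cinner right_translation_scaleC right_translation_ket cinner_scaleC_right cinner_ket cmod_power2)
  have "((\<lambda>x. (cmod (coord f x))\<^sup>2) has_sum (norm f)\<^sup>2) UNIV"
    using has_sum_infsum[OF coord_summable[of f]] by (simp add: norm_ell2_def infsum_nonneg)
  then have "((\<lambda>x. (cmod (coord f x))\<^sup>2) has_sum (norm f)\<^sup>2) (carrier G)"
    by (rule has_sum_cong_neutral[THEN iffD1, rotated -1]) (use f in \<open>auto simp: l2_def\<close>)
  moreover have "bij_betw (\<lambda>g. inv g) (carrier G) (carrier G)"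
    by (rule bij_betw_byWitness[where f' = "\<lambda>g. inv g"]) auto
  ultimately have "((\<lambda>g. (cmod (coord f (inv g)))\<^sup>2) has_sum f \<bullet> f) (carrier G)"
    using has_sum_reindex_bij_betw[of "\<lambda>g. inv g" "carrier G" "carrier G" "\<lambda>x. (cmod (coord f x))\<^sup>2"]
    by (simp add: power2_norm_eq_inner)
  then show "((\<lambda>g. \<Sum>b\<in>{ket \<one>, \<i> *\<^sub>C ket \<one>}. (f \<bullet> right_translation G g b)\<^sup>2) has_sum f \<bullet> f) (carrier G)"
    by (simp add: sum_eq cong: has_sum_cong)
qed (auto simp: right_translation_in_l2 norm_right_translation)

lemma right_translation_bounded: "g \<in> carrier G \<Longrightarrow> right_translation G g \<in> bounded_operators G"
  unfolding bounded_operators_def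
  by (auto simp: right_translation_in_l2 right_translation_add right_translation_scaleC norm_right_translation
      intro!: exI[of _ 1])

lemma right_translation_unitary:
  assumes g: "g \<in> carrier G"
  shows "unitary_operator G (right_translation G g)"
  unfolding unitary_operator_def
proof (intro conjI ballI right_translation_bounded g)
  show "bij_betw (right_translation G g) (l2 G) (l2 G)"
    by (rule bij_betw_byWitness[where f' = "right_translation G (inv g)"])
      (use g in \<open>auto simp: right_translation_inv right_translation_in_l2\<close>)
  show "cinner (right_translation G g u) (right_translation G g v) = cinner u v"
    if "u \<in> l2 G" "v \<in> l2 G" for u v
    using g that by (simp add: cinner_right_translation right_translation_inv)
qed

lemma right_translation_left_translation:
  assumes "g \<in> carrier G" "h \<in> carrier G"
  shows "right_translation G g (left_translation G h u) = left_translation G h (right_translation G g u)"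
  by (rule ell2_eqI)
    (use assms in \<open>simp add: coord_right_translation coord_left_translation[OF group_axioms] m_assoc\<close>)

lemma right_translation_group_algebra:
  assumes g: "g \<in> carrier G" and A: "A \<in> group_algebra_operators G"
  shows "right_translation G g (A u) = A (right_translation G g u)"
proof -
  obtain S c where S: "finite S" "S \<subseteq> carrier G"
    and A: "A = (\<lambda>u. \<Sum>g\<in>S. c g *\<^sub>C left_translation G g u)"
    using A by (auto simp: group_algebra_operators_def)
  have "right_translation G g (\<Sum>h\<in>S. f h) = (\<Sum>h\<in>S. right_translation G g (f h))" for f
    using S(1) by induction (simp_all add: g right_translation_add right_translation_zero)
  then show ?thesis
    using S(2) unfolding A
    by (auto simp: right_translation_scaleC right_translation_left_translation g intro!: sum.cong)
qed

text \<open>Right translations commute with left ones, hence with the group algebra. This passes to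
  the weak closure because the defect \<open>v\<close> only has to be tested against itself, which
  involves two matrix coefficients.\<close>

lemma right_translation_commutant:
  assumes g: "g \<in> carrier G"
  shows "right_translation G g \<in> commutant G (group_von_neumann_algebra G)"
  unfolding commutant_def
proof (intro CollectI conjI ballI right_translation_bounded g)
  fix T u assume T: "T \<in> group_von_neumann_algebra G" and u: "u \<in> l2 G"
  let ?r = "right_translation G g"
  have T_in: "\<And>u. u \<in> l2 G \<Longrightarrow> T u \<in> l2 G"
    using T by (simp add: group_von_neumann_algebra_def bounded_operators_def)
  define v where "v = ?r (T u) - T (?r u)"
  have ru: "?r u \<in> l2 G" by (rule right_translation_in_l2[OF g])
  have v: "v \<in> l2 G"
    unfolding v_def
    by (intro subspace_diff closed_subspace.subspace[OF closed_subspace_l2] right_translation_in_l2 g T_in ru)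
  have small: "cmod (cinner v v) < 2 * e" if e: "e > 0" for e
  proof -
    \<comment> \<open>The first pair tests \<open>T u\<close> against the translate of
      \<open>v\<close> by \<open>inv g\<close>, which is \<open>?r (T u)\<close> tested against
      \<open>v\<close>; the second tests \<open>T (?r u)\<close>. Together they control both terms
      of the defect.\<close>
    define F where "F = {(u, right_translation G (inv g) v), (?r u, v)}"
    have "finite F" "F \<subseteq> l2 G \<times> l2 G"
      using u v ru g by (auto simp: F_def right_translation_in_l2)
    then obtain A where A: "A \<in> group_algebra_operators G"
      and "\<forall>(u, v)\<in>F. cmod (cinner (T u - A u) v) < e"
      using T e unfolding group_von_neumann_algebra_def by blast
    then have near: "cmod (cinner (T u - A u) (right_translation G (inv g) v)) < e"
      "cmod (cinner (T (?r u) - A (?r u)) v) < e"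
      by (auto simp: F_def)
    have rA: "?r (A u) = A (?r u)" by (rule right_translation_group_algebra[OF g A])
    have "A (?r u) \<in> l2 G" unfolding rA[symmetric] by (rule right_translation_in_l2[OF g])
    have "A u \<in> l2 G"
    proof -
      have "left_translation G h u \<in> l2 G" if "h \<in> carrier G" for h
        using that by (simp add: l2_def coord_left_translation[OF group_axioms])
      then show ?thesis
        using A by (auto simp: group_algebra_operators_def
            intro!: subspace_sum[OF closed_subspace.subspace[OF closed_subspace_l2]] l2_scaleC)
    qed
    then have "T u - A u \<in> l2 G"
      by (intro subspace_diff closed_subspace.subspace[OF closed_subspace_l2] T_in u)
    then have "cinner (T u - A u) (right_translation G (inv g) v) = cinner (?r (T u - A u)) v"
      using g by (simp add: cinner_right_translation)
    moreover have "?r (T u - A u) = ?r (T u) - A (?r u)"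
      unfolding rA[symmetric] by (rule ell2_eqI) (simp add: coord_right_translation g)
    ultimately have "cinner v v = cinner (T u - A u) (right_translation G (inv g) v)
        - cinner (T (?r u) - A (?r u)) v"
      by (simp add: cinner_diff_left[symmetric]) (simp add: v_def)
    then show ?thesis using near norm_triangle_ineq4 by (smt (verit))
  qed
  have "cmod (cinner v v) \<le> 0"
  proof (rule field_le_epsilon)
    show "cmod (cinner v v) \<le> 0 + e" if "e > 0" for e using small[of "e / 2"] that by simp
  qed
  then show "?r (T u) = T (?r u)" by (simp add: cinner_self v_def)
qed

end

section \<open>Operators affiliated to the group von Neumann algebra\<close>

locale affiliated_operators = group G for G :: "('a, 'b) monoid_scheme" (structure)
begin

sublocale H: gmod_powers G "l2 G" "{ket \<one>, \<i> *\<^sub>C ket \<one>}" "right_translation G"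
  by (simp add: gmod_powers_def gmod_l2)

abbreviation "U \<equiv> affiliated_algebra G"

definition commuting_unitaries :: "('a ell2 \<Rightarrow> 'a ell2) set"
  where "commuting_unitaries = {V \<in> commutant G (group_von_neumann_algebra G). unitary_operator G V}"

lemma right_translation_commuting: "g \<in> carrier G \<Longrightarrow> right_translation G g \<in> commuting_unitaries"
  by (simp add: commuting_unitaries_def right_translation_commutant right_translation_unitary)

context
  fixes V
  assumes V: "V \<in> commuting_unitaries"
begin

lemma unitary_in: "u \<in> l2 G \<Longrightarrow> V u \<in> l2 G"
  and unitary_add: "u \<in> l2 G \<Longrightarrow> v \<in> l2 G \<Longrightarrow> V (u + v) = V u + V v"
  and unitary_scaleC: "u \<in> l2 G \<Longrightarrow> V (c *\<^sub>C u) = c *\<^sub>C V u"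
  and unitary_cinner: "u \<in> l2 G \<Longrightarrow> v \<in> l2 G \<Longrightarrow> cinner (V u) (V v) = cinner u v"
  and unitary_bij: "bij_betw V (l2 G) (l2 G)"
proof -
  have "unitary_operator G V" using V by (simp add: commuting_unitaries_def)
  then show "u \<in> l2 G \<Longrightarrow> V u \<in> l2 G"
    "u \<in> l2 G \<Longrightarrow> v \<in> l2 G \<Longrightarrow> V (u + v) = V u + V v"
    "u \<in> l2 G \<Longrightarrow> V (c *\<^sub>C u) = c *\<^sub>C V u"
    "u \<in> l2 G \<Longrightarrow> v \<in> l2 G \<Longrightarrow> cinner (V u) (V v) = cinner u v"
    "bij_betw V (l2 G) (l2 G)"
    unfolding unitary_operator_def bounded_operators_def by blast+
qed

lemma unitary_inner: "u \<in> l2 G \<Longrightarrow> v \<in> l2 G \<Longrightarrow> V u \<bullet> V v = u \<bullet> v"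
  by (simp add: inner_cinner unitary_cinner)

lemma unitary_zero: "V 0 = 0"
  using unitary_scaleC[of 0 0] by (simp add: l2_def scaleC_zero_left)

lemma unitary_uminus: "u \<in> l2 G \<Longrightarrow> V (- u) = - V u"
  using unitary_scaleC[of u "-1"] by (simp add: scaleC_minus_one)

lemma unitary_diff: "u \<in> l2 G \<Longrightarrow> v \<in> l2 G \<Longrightarrow> V (u - v) = V u - V v"
  using unitary_add[of u "- v"] unitary_uminus[of v] by (simp add: l2_def)

lemma unitary_norm: "u \<in> l2 G \<Longrightarrow> norm (V u) = norm u"
  by (simp add: norm_eq_sqrt_inner unitary_inner)

text \<open>Stability under inverses turns the one-sided invariance of a relation under each
  \<open>V\<close> into the equality demanded by \<open>affiliated\<close>. The inverse is taken on
  \<open>l2 G\<close>, where the values of \<open>V\<close> are meaningful.\<close>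

lemma unitary_inv_into:
  "inv_into (l2 G) V \<in> commuting_unitaries"
  "u \<in> l2 G \<Longrightarrow> inv_into (l2 G) V u \<in> l2 G"
  "u \<in> l2 G \<Longrightarrow> V (inv_into (l2 G) V u) = u"
proof -
  let ?W = "inv_into (l2 G) V"
  have W: "bij_betw ?W (l2 G) (l2 G)" by (rule bij_betw_inv_into[OF unitary_bij])
  show W_in: "?W u \<in> l2 G" if "u \<in> l2 G" for u by (rule bij_betw_apply[OF W that])
  show VW: "V (?W u) = u" if "u \<in> l2 G" for u
    by (rule bij_betw_inv_into_right[OF unitary_bij that])
  have inj: "u = v" if "V u = V v" "u \<in> l2 G" "v \<in> l2 G" for u v
    using bij_betw_imp_inj_on[OF unitary_bij] that by (rule inj_onD)
  have add: "?W (u + v) = ?W u + ?W v" if "u \<in> l2 G" "v \<in> l2 G" for u v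
    using that by - (rule inj, simp_all add: VW W_in l2_add unitary_add)
  have scale: "?W (c *\<^sub>C u) = c *\<^sub>C ?W u" if "u \<in> l2 G" for u c
    using that by - (rule inj, simp_all add: VW W_in l2_scaleC unitary_scaleC)
  have cin: "cinner (?W u) (?W v) = cinner u v" if "u \<in> l2 G" "v \<in> l2 G" for u v
    using unitary_cinner[OF W_in W_in, OF that] unfolding VW[OF that(1)] VW[OF that(2)] by (rule sym)
  have "norm (?W u) = norm u" if "u \<in> l2 G" for u
    using unitary_norm[OF W_in, OF that] unfolding VW[OF that] by (rule sym)
  then have bounded: "?W \<in> bounded_operators G"
    unfolding bounded_operators_def by (auto simp: W_in add scale intro!: exI[of _ 1])
  have "?W (T u) = T (?W u)" if T: "T \<in> group_von_neumann_algebra G" and u: "u \<in> l2 G" for T u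
  proof -
    have T_in: "\<And>u. u \<in> l2 G \<Longrightarrow> T u \<in> l2 G"
      using T by (simp add: group_von_neumann_algebra_def bounded_operators_def)
    have "V (T (?W u)) = T (V (?W u))"
      using V T W_in[OF u] unfolding commuting_unitaries_def commutant_def by blast
    then have "V (?W (T u)) = V (T (?W u))" using u by (simp only: VW T_in)
    then show ?thesis by (rule inj) (use u in \<open>simp_all add: W_in T_in\<close>)
  qed
  then show "?W \<in> commuting_unitaries"
    unfolding commuting_unitaries_def commutant_def unitary_operator_def
    by (intro CollectI conjI ballI bounded W cin)
qed

end

text \<open>The part of membership in the algebra that naive sums, composites, intersections and
  closures inherit. Single-valuedness, closedness and dense domain are left out and established
  separately.\<close>

definition aff_relation :: "('a ell2 \<times> 'a ell2) set \<Rightarrow> bool"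
  where "aff_relation N \<longleftrightarrow> N \<subseteq> l2 G \<times> l2 G \<and> (0, 0) \<in> N \<and>
    (\<forall>u v u' v'. (u, v) \<in> N \<longrightarrow> (u', v') \<in> N \<longrightarrow> (u + u', v + v') \<in> N) \<and>
    (\<forall>c u v. (u, v) \<in> N \<longrightarrow> (c *\<^sub>C u, c *\<^sub>C v) \<in> N) \<and>
    (\<forall>V\<in>commuting_unitaries. \<forall>u v. (u, v) \<in> N \<longrightarrow> (V u, V v) \<in> N)"

lemma aff_relationI:
  assumes "\<And>u v. (u, v) \<in> N \<Longrightarrow> u \<in> l2 G \<and> v \<in> l2 G" "(0, 0) \<in> N"
    "\<And>u v u' v'. (u, v) \<in> N \<Longrightarrow> (u', v') \<in> N \<Longrightarrow> (u + u', v + v') \<in> N"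
    "\<And>c u v. (u, v) \<in> N \<Longrightarrow> (c *\<^sub>C u, c *\<^sub>C v) \<in> N"
    "\<And>V u v. V \<in> commuting_unitaries \<Longrightarrow> (u, v) \<in> N \<Longrightarrow> (V u, V v) \<in> N"
  shows "aff_relation N"
  unfolding aff_relation_def
  by (intro conjI allI impI ballI subrelI) (simp_all add: assms)

lemma aff_relationD:
  assumes "aff_relation N"
  shows "(u, v) \<in> N \<Longrightarrow> u \<in> l2 G" "(u, v) \<in> N \<Longrightarrow> v \<in> l2 G" "(0, 0) \<in> N"
    "(u, v) \<in> N \<Longrightarrow> (u', v') \<in> N \<Longrightarrow> (u + u', v + v') \<in> N"
    "(u, v) \<in> N \<Longrightarrow> (c *\<^sub>C u, c *\<^sub>C v) \<in> N"
    "V \<in> commuting_unitaries \<Longrightarrow> (u, v) \<in> N \<Longrightarrow> (V u, V v) \<in> N"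
proof -
  have sub: "N \<subseteq> l2 G \<times> l2 G" using assms by (simp add: aff_relation_def)
  then show "(u, v) \<in> N \<Longrightarrow> u \<in> l2 G" "(u, v) \<in> N \<Longrightarrow> v \<in> l2 G" by auto
qed (use assms in \<open>simp_all add: aff_relation_def\<close>)

lemma aff_relation_uminus: "aff_relation N \<Longrightarrow> (u, v) \<in> N \<Longrightarrow> (- u, - v) \<in> N"
  using aff_relationD(5)[of N u v "-1"] by (simp add: scaleC_minus_one)

lemma aff_relation_diff: "aff_relation N \<Longrightarrow> (u, v) \<in> N \<Longrightarrow> (u', v') \<in> N \<Longrightarrow> (u - u', v - v') \<in> N"
  using aff_relationD(4)[of N u v "- u'" "- v'"] aff_relation_uminus[of N u' v'] by simp

lemma aff_relation_subspace: "aff_relation N \<Longrightarrow> subspace N"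
  by (rule subspaceI) (auto simp: scaleR_scaleC zero_prod_def intro: aff_relationD(3,4,5))

lemma aff_relation_unitary_image:
  assumes N: "aff_relation N" and V: "V \<in> commuting_unitaries" and uv: "(u, v) \<in> N"
  obtains u' v' where "(u', v') \<in> N" "u = V u'" "v = V v'"
proof
  show "(inv_into (l2 G) V u, inv_into (l2 G) V v) \<in> N"
    using aff_relationD(6)[OF N unitary_inv_into(1)[OF V] uv] .
  show "u = V (inv_into (l2 G) V u)" "v = V (inv_into (l2 G) V v)"
    using unitary_inv_into(3)[OF V] aff_relationD(1,2)[OF N uv] by simp_all
qed

lemma carrier_iff: "T \<in> carrier U \<longleftrightarrow>
  aff_relation T \<and> single_valued T \<and> closed T \<and> l2 G \<subseteq> closure (Domain T)"
proof
  assume "T \<in> carrier U"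
  then have T: "linear_operator G T" "closed T" "l2 G \<subseteq> closure (Domain T)"
    "affiliated G (group_von_neumann_algebra G) T"
    by (simp_all add: affiliated_algebra_def densely_defined_def)
  have "(V u, V v) \<in> T" if "V \<in> commuting_unitaries" "(u, v) \<in> T" for V u v
  proof -
    have "map_prod V V ` T = T"
      using T(4) that(1) unfolding affiliated_def commuting_unitaries_def by blast
    then show ?thesis using imageI[OF that(2), of "map_prod V V"] by (simp only: map_prod_simp)
  qed
  moreover have "T \<subseteq> l2 G \<times> l2 G" "(0, 0) \<in> T"
    "\<And>u v u' v'. (u, v) \<in> T \<Longrightarrow> (u', v') \<in> T \<Longrightarrow> (u + u', v + v') \<in> T"
    "\<And>c u v. (u, v) \<in> T \<Longrightarrow> (c *\<^sub>C u, c *\<^sub>C v) \<in> T"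
  proof -
    note L = T(1)[unfolded linear_operator_def]
    show "T \<subseteq> l2 G \<times> l2 G" by (rule L[THEN conjunct1])
    show "(0, 0) \<in> T" by (rule L[THEN conjunct2, THEN conjunct2, THEN conjunct1])
    note sum = L[THEN conjunct2, THEN conjunct2, THEN conjunct2, THEN conjunct1]
      and scale = L[THEN conjunct2, THEN conjunct2, THEN conjunct2, THEN conjunct2]
    show "(u + u', v + v') \<in> T" if "(u, v) \<in> T" "(u', v') \<in> T" for u v u' v'
      using bspec[OF bspec[OF sum that(1), unfolded prod.case] that(2)] by simp
    show "(c *\<^sub>C u, c *\<^sub>C v) \<in> T" if "(u, v) \<in> T" for c u v
      using bspec[OF spec[OF scale, of c] that] by simp
  qed
  ultimately have "aff_relation T" by (intro aff_relationI) blast+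
  then show "aff_relation T \<and> single_valued T \<and> closed T \<and> l2 G \<subseteq> closure (Domain T)"
    using T by (simp add: linear_operator_def)
next
  assume T: "aff_relation T \<and> single_valued T \<and> closed T \<and> l2 G \<subseteq> closure (Domain T)"
  have "map_prod V V ` T = T" if V: "V \<in> commuting_unitaries" for V
  proof
    have N: "aff_relation T" using T by simp
    show "map_prod V V ` T \<subseteq> T"
    proof (rule image_subsetI)
      show "map_prod V V z \<in> T" if "z \<in> T" for z
        using aff_relationD(6)[OF N V, of "fst z" "snd z"] that by (cases z) simp
    qed
    show "T \<subseteq> map_prod V V ` T"
    proof clarify
      fix u v assume "(u, v) \<in> T"
      from aff_relation_unitary_image[OF N V this]
      obtain u' v' where "(u', v') \<in> T" and eq: "u = V u'" "v = V v'" .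
      then show "(u, v) \<in> map_prod V V ` T"
        unfolding eq using imageI[of "(u', v')" T "map_prod V V"] by (simp only: map_prod_simp)
    qed
  qed
  then have "affiliated G (group_von_neumann_algebra G) T"
    by (simp add: affiliated_def commuting_unitaries_def)
  moreover have "linear_operator G T"
    unfolding linear_operator_def
  proof (intro conjI)
    have N: "aff_relation T" using T by simp
    show "T \<subseteq> l2 G \<times> l2 G" using aff_relationD(1,2)[OF N] by auto
    show "(0, 0) \<in> T" by (rule aff_relationD(3)[OF N])
    show "\<forall>(u, v)\<in>T. \<forall>(u', v')\<in>T. (u + u', v + v') \<in> T"
      by (clarify, rule aff_relationD(4)[OF N])
    show "\<forall>c. \<forall>(u, v)\<in>T. (c *\<^sub>C u, c *\<^sub>C v) \<in> T"
      by (clarify, rule aff_relationD(5)[OF N])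
  qed (use T in simp)
  ultimately show "T \<in> carrier U"
    using T by (simp add: affiliated_algebra_def densely_defined_def)
qed

lemma carrierD:
  assumes "T \<in> carrier U"
  shows "aff_relation T" "single_valued T" "closed T" "l2 G \<subseteq> closure (Domain T)"
  using assms by (simp_all add: carrier_iff)

lemma aff_relation_closure:
  assumes N: "aff_relation N"
  shows "aff_relation (closure N)"
proof -
  have seq: "\<exists>p q. (\<forall>n. (p n, q n) \<in> N) \<and> p \<longlonglongrightarrow> u \<and> q \<longlonglongrightarrow> v" if uv: "(u, v) \<in> closure N" for u v
  proof -
    obtain z where "\<And>n. z n \<in> N" "z \<longlonglongrightarrow> (u, v)" using uv by (auto simp: closure_sequential)
    then show ?thesis
      using tendsto_fst[of z "(u, v)"] tendsto_snd[of z "(u, v)"]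
      by (intro exI[of _ "\<lambda>n. fst (z n)"] exI[of _ "\<lambda>n. snd (z n)"]) auto
  qed
  have lim: "(u, v) \<in> closure N" if "\<And>n. (p n, q n) \<in> N" "p \<longlonglongrightarrow> u" "q \<longlonglongrightarrow> v" for p q u v
    unfolding closure_sequential
    by (intro exI[of _ "\<lambda>n. (p n, q n)"] conjI allI tendsto_Pair that)
  \<comment> \<open>A unitary is controlled only on \<open>l2 G\<close>, not on the whole type, so
    the estimate is asked along the given sequence instead of as continuity of
    \<open>f\<close>.\<close>
  have lipschitz: "(\<lambda>n. f (p n)) \<longlonglongrightarrow> f u"
    if "p \<longlonglongrightarrow> u" and le: "\<And>n. norm (f (p n) - f u) \<le> c * norm (p n - u)"
    for f :: "'a ell2 \<Rightarrow> 'a ell2" and p u c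
  proof -
    have "(\<lambda>n. c * norm (p n - u)) \<longlonglongrightarrow> 0"
      using tendsto_mult[OF tendsto_const[of c] tendsto_norm_zero[OF LIM_zero[OF that(1)]]] by simp
    then have "(\<lambda>n. f (p n) - f u) \<longlonglongrightarrow> 0"
      by (rule Lim_null_comparison[rotated]) (simp add: le)
    then show ?thesis by (rule LIM_zero_cancel)
  qed
  have "closed (l2 G \<times> l2 G)" by (intro closed_Times H.X.closed)
  then have sub: "closure N \<subseteq> l2 G \<times> l2 G"
    using aff_relationD(1,2)[OF N] by (intro closure_minimal) auto
  show ?thesis
  proof (rule aff_relationI)
    show "(0, 0) \<in> closure N" using aff_relationD(3)[OF N] closure_subset by blast
    fix u v assume uv: "(u, v) \<in> closure N"
    then show "u \<in> l2 G \<and> v \<in> l2 G" using sub by auto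
    obtain p q where pq: "\<And>n. (p n, q n) \<in> N" "p \<longlonglongrightarrow> u" "q \<longlonglongrightarrow> v" using seq[OF uv] by blast
    show "(u + u', v + v') \<in> closure N" if uv': "(u', v') \<in> closure N" for u' v'
    proof -
      obtain p' q' where "\<And>n. (p' n, q' n) \<in> N" "p' \<longlonglongrightarrow> u'" "q' \<longlonglongrightarrow> v'"
        using seq[OF uv'] by blast
      then show ?thesis using pq by (intro lim[of "\<lambda>n. p n + p' n" "\<lambda>n. q n + q' n"] tendsto_add)
          (auto intro: aff_relationD(4)[OF N])
    qed
    show "(c *\<^sub>C u, c *\<^sub>C v) \<in> closure N" for c
    proof (rule lim)
      show "(c *\<^sub>C p n, c *\<^sub>C q n) \<in> N" for n using aff_relationD(5)[OF N pq(1)] .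
      have *: "norm (c *\<^sub>C f - c *\<^sub>C g) \<le> cmod c * norm (f - g)" for f g :: "'a ell2"
      proof -
        have "c *\<^sub>C f - c *\<^sub>C g = c *\<^sub>C (f - g)" by (rule ell2_eqI) (simp add: algebra_simps)
        then show ?thesis by (simp add: norm_scaleC)
      qed
      show "(\<lambda>n. c *\<^sub>C p n) \<longlonglongrightarrow> c *\<^sub>C u" "(\<lambda>n. c *\<^sub>C q n) \<longlonglongrightarrow> c *\<^sub>C v"
        using lipschitz[OF pq(2) *] lipschitz[OF pq(3) *] by simp_all
    qed
    show "(V u, V v) \<in> closure N" if V: "V \<in> commuting_unitaries" for V
    proof (rule lim)
      show "(V (p n), V (q n)) \<in> N" for n using aff_relationD(6)[OF N V pq(1)] .
      have *: "norm (V f - V g) \<le> 1 * norm (f - g)" if "f \<in> l2 G" "g \<in> l2 G" for f g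
        using that H.X.subspace
        by (simp add: unitary_diff[OF V, symmetric] unitary_norm[OF V] subspace_diff)
      have "u \<in> l2 G" "v \<in> l2 G" "\<And>n. p n \<in> l2 G" "\<And>n. q n \<in> l2 G"
        using uv sub aff_relationD(1)[OF N pq(1)] aff_relationD(2)[OF N pq(1)] by auto
      then show "(\<lambda>n. V (p n)) \<longlonglongrightarrow> V u" "(\<lambda>n. V (q n)) \<longlonglongrightarrow> V v"
        using lipschitz[OF pq(2) *] lipschitz[OF pq(3) *] by simp_all
    qed
  qed
qed

lemma aff_relation_translation: "aff_relation N \<Longrightarrow> g \<in> carrier G \<Longrightarrow> x \<in> N \<Longrightarrow> H.r2 g x \<in> N"
  using aff_relationD(6)[OF _ right_translation_commuting] by (cases x) simp

lemma inv_operator_carrier: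
  assumes T: "T \<in> carrier U"
  shows "H.inv_operator T"
proof -
  note D = carrierD[OF T]
  have "H.P2.inv_subspace T"
    unfolding H.P2.inv_subspace_def closed_subspace_def
    using D(3) aff_relation_subspace[OF D(1)] aff_relation_translation[OF D(1)] aff_relationD(1,2)[OF D(1)]
    by auto
  moreover have "v = 0" if "(0, v) \<in> T" for v
    using single_valuedD[OF D(2) that aff_relationD(3)[OF D(1)]] .
  ultimately show ?thesis using D(4) by (simp add: H.inv_operator_def)
qed

theorem closure_eq_carrier:
  assumes A: "A \<in> carrier U" and "N \<subseteq> A" and N: "aff_relation N" and dense: "l2 G \<subseteq> closure (Domain N)"
  shows "closure N = A"
  using assms by (intro H.closure_eq_inv_operator inv_operator_carrier aff_relation_subspace aff_relation_translation)

lemma dense_orthogonal: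
  assumes "l2 G \<subseteq> closure D" "w \<in> l2 G" "\<And>u. u \<in> D \<Longrightarrow> w \<bullet> u = 0"
  shows "w = 0"
proof -
  have "D \<subseteq> {u. w \<bullet> u = 0}" using assms(3) by auto
  then have "closure D \<subseteq> {u. w \<bullet> u = 0}" by (rule closure_minimal) (rule closed_hyperplane)
  then have "w \<bullet> w = 0" using assms by blast
  then show ?thesis by simp
qed

lemma single_valuedI_aff:
  assumes N: "aff_relation N" and "\<And>v. (0, v) \<in> N \<Longrightarrow> v = 0"
  shows "single_valued N"
proof (rule single_valuedI)
  fix x y z assume "(x, y) \<in> N" "(x, z) \<in> N"
  then have "(0, y - z) \<in> N" using aff_relation_diff[OF N, of x y x z] by simp
  then show "y = z" using assms(2) by fastforce
qed

text \<open>\<open>N'\<close> acts as a formal adjoint. If \<open>(0, w)\<close> is a limit of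
  points of \<open>N\<close>, pairing with \<open>N'\<close> makes \<open>w\<close> orthogonal to a
  dense domain; hence the closure is still single-valued.\<close>

lemma closure_in_carrier:
  assumes N: "aff_relation N" and dense: "l2 G \<subseteq> closure (Domain N)" "l2 G \<subseteq> closure (Domain N')"
    and dual: "\<And>x y u v. (x, y) \<in> N \<Longrightarrow> (u, v) \<in> N' \<Longrightarrow> cinner y u = cinner x v"
  shows "closure N \<in> carrier U"
  unfolding carrier_iff
proof (intro conjI single_valuedI_aff aff_relation_closure N)
  have "Domain N \<subseteq> Domain (closure N)" using closure_subset by fastforce
  then show "l2 G \<subseteq> closure (Domain (closure N))" using dense(1) closure_mono by blast
  fix w assume w: "(0, w) \<in> closure N"
  show "w = 0"
  proof (rule dense_orthogonal[OF dense(2)])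
    show "w \<in> l2 G" using aff_relationD(2)[OF aff_relation_closure[OF N] w] .
    fix u assume "u \<in> Domain N'"
    then obtain v where uv: "(u, v) \<in> N'" by blast
    have "N \<subseteq> {z. snd z \<bullet> u = fst z \<bullet> v}" using dual uv by (auto simp: inner_cinner)
    moreover have "closed {z. snd z \<bullet> u = fst z \<bullet> v}"
      by (intro closed_Collect_eq continuous_intros)
    ultimately have "closure N \<subseteq> {z. snd z \<bullet> u = fst z \<bullet> v}" by (rule closure_minimal)
    then show "w \<bullet> u = 0" using w by auto
  qed
qed simp

end

section \<open>Naive sums, composites and adjoints\<close>

context affiliated_operators
begin

definition relsum :: "('a ell2 \<times> 'a ell2) set \<Rightarrow> ('a ell2 \<times> 'a ell2) set \<Rightarrow> ('a ell2 \<times> 'a ell2) set"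
  where "relsum S T = {(u, v + w) | u v w. (u, v) \<in> S \<and> (u, w) \<in> T}"

lemma U_simps:
  "S \<otimes>\<^bsub>U\<^esub> T = closure (T O S)" "S \<oplus>\<^bsub>U\<^esub> T = closure (relsum S T)" "\<one>\<^bsub>U\<^esub> = Id_on (l2 G)"
  "\<zero>\<^bsub>U\<^esub> = l2 G \<times> {0}" "star U T = adjoint_operator G T"
  by (simp_all add: affiliated_algebra_def relsum_def)

lemma relsumI: "(u, v) \<in> S \<Longrightarrow> (u, w) \<in> T \<Longrightarrow> (u, v + w) \<in> relsum S T"
  unfolding relsum_def by blast

lemma relsumE:
  assumes "(u, z) \<in> relsum S T"
  obtains v w where "z = v + w" "(u, v) \<in> S" "(u, w) \<in> T"
  using assms unfolding relsum_def by blast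

lemma aff_relation_relcomp:
  assumes S: "aff_relation S" and T: "aff_relation T"
  shows "aff_relation (T O S)"
proof (rule aff_relationI)
  show "(0, 0) \<in> T O S" using aff_relationD(3)[OF T] aff_relationD(3)[OF S] by (rule relcompI)
  fix u w assume "(u, w) \<in> T O S"
  then obtain v where v: "(u, v) \<in> T" "(v, w) \<in> S" by (rule relcompEpair)
  show "u \<in> l2 G \<and> w \<in> l2 G" using aff_relationD(1)[OF T v(1)] aff_relationD(2)[OF S v(2)] ..
  show "(c *\<^sub>C u, c *\<^sub>C w) \<in> T O S" for c
    using aff_relationD(5)[OF T v(1)] aff_relationD(5)[OF S v(2)] by (rule relcompI)
  show "(V u, V w) \<in> T O S" if "V \<in> commuting_unitaries" for V
    using aff_relationD(6)[OF T that v(1)] aff_relationD(6)[OF S that v(2)] by (rule relcompI)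
  fix u' w' assume "(u', w') \<in> T O S"
  then obtain v' where v': "(u', v') \<in> T" "(v', w') \<in> S" by (rule relcompEpair)
  show "(u + u', w + w') \<in> T O S"
    using aff_relationD(4)[OF T v(1) v'(1)] aff_relationD(4)[OF S v(2) v'(2)] by (rule relcompI)
qed

lemma aff_relation_relsum:
  assumes S: "aff_relation S" and T: "aff_relation T"
  shows "aff_relation (relsum S T)"
proof (rule aff_relationI)
  show "(0, 0) \<in> relsum S T"
    using relsumI[OF aff_relationD(3)[OF S] aff_relationD(3)[OF T]] by simp
  fix u z assume "(u, z) \<in> relsum S T"
  then obtain v w where z: "z = v + w" and v: "(u, v) \<in> S" "(u, w) \<in> T" by (rule relsumE)
  have in_l2: "u \<in> l2 G" "v \<in> l2 G" "w \<in> l2 G"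
    using aff_relationD(1,2)[OF S v(1)] aff_relationD(2)[OF T v(2)] .
  then show "u \<in> l2 G \<and> z \<in> l2 G" unfolding z by (intro conjI l2_add)
  show "(c *\<^sub>C u, c *\<^sub>C z) \<in> relsum S T" for c
    unfolding z scaleC_add_right
    using aff_relationD(5)[OF S v(1)] aff_relationD(5)[OF T v(2)] by (rule relsumI)
  show "(V u, V z) \<in> relsum S T" if "V \<in> commuting_unitaries" for V
    unfolding z unitary_add[OF that in_l2(2,3)]
    using aff_relationD(6)[OF S that v(1)] aff_relationD(6)[OF T that v(2)] by (rule relsumI)
  fix u' z' assume "(u', z') \<in> relsum S T"
  then obtain v' w' where z': "z' = v' + w'" and v': "(u', v') \<in> S" "(u', w') \<in> T" by (rule relsumE)
  have "z + z' = (v + v') + (w + w')" unfolding z z' by (simp add: algebra_simps)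
  then show "(u + u', z + z') \<in> relsum S T"
    using relsumI[OF aff_relationD(4)[OF S v(1) v'(1)] aff_relationD(4)[OF T v(2) v'(2)]] by (simp only:)
qed

lemma aff_relation_zero: "aff_relation (l2 G \<times> {0})"
  by (rule aff_relationI) (auto simp: l2_add l2_scaleC unitary_in unitary_zero subspace_0[OF H.X.subspace])

lemma zero_in_carrier: "l2 G \<times> {0} \<in> carrier U"
  unfolding carrier_iff
proof (intro conjI aff_relation_zero)
  show "single_valued (l2 G \<times> {0 :: 'a ell2})" by (auto intro: single_valuedI)
  show "closed (l2 G \<times> {0 :: 'a ell2})" by (intro closed_Times H.X.closed closed_singleton)
  have "Domain (l2 G \<times> {0 :: 'a ell2}) = l2 G" by auto
  then show "l2 G \<subseteq> closure (Domain (l2 G \<times> {0 :: 'a ell2}))" by (simp add: closure_subset)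
qed

lemma one_in_carrier: "Id_on (l2 G) \<in> carrier U"
  unfolding carrier_iff
proof (intro conjI)
  show "aff_relation (Id_on (l2 G))"
    by (rule aff_relationI) (auto simp: l2_add l2_scaleC unitary_in subspace_0[OF H.X.subspace])
  show "single_valued (Id_on (l2 G))" by (auto intro: single_valuedI)
  have "Id_on (l2 G) = (l2 G \<times> l2 G) \<inter> {z. fst z = snd z}" by auto
  moreover have "closed \<dots>"
    by (intro closed_Int closed_Times H.X.closed closed_Collect_eq continuous_intros)
  ultimately show "closed (Id_on (l2 G))" by simp
  show "l2 G \<subseteq> closure (Domain (Id_on (l2 G)))" by (simp add: closure_subset)
qed

lemma uminus_in_carrier:
  assumes T: "T \<in> carrier U"
  shows "{(u, v). (u, - v) \<in> T} \<in> carrier U"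
  unfolding carrier_iff
proof (intro conjI)
  note D = carrierD[OF T]
  let ?N = "{(u, v). (u, - v) \<in> T}"
  have mem: "(u, v) \<in> ?N \<longleftrightarrow> (u, - v) \<in> T" for u v by simp
  have l2_uminus: "v \<in> l2 G" if "- v \<in> l2 G" for v using that by (simp add: l2_def)
  show "aff_relation ?N"
    unfolding aff_relation_def
  proof (intro conjI allI impI ballI subrelI)
    show "(0, 0) \<in> ?N" using aff_relationD(3)[OF D(1)] by simp
    fix u v assume uv: "(u, v) \<in> ?N"
    then have uv': "(u, - v) \<in> T" by simp
    have v: "v \<in> l2 G" using aff_relationD(2)[OF D(1) uv'] by (rule l2_uminus)
    then show "(u, v) \<in> l2 G \<times> l2 G" using aff_relationD(1)[OF D(1) uv'] by simp
    have "c *\<^sub>C - v = - (c *\<^sub>C v)" for c by (rule ell2_eqI) simp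
    then show "(c *\<^sub>C u, c *\<^sub>C v) \<in> ?N" for c
      using aff_relationD(5)[OF D(1) uv', of c] by (simp only: mem)
    show "(V u, V v) \<in> ?N" if V: "V \<in> commuting_unitaries" for V
      using aff_relationD(6)[OF D(1) V uv'] by (simp only: mem unitary_uminus[OF V v])
    show "(u + u', v + v') \<in> ?N" if "(u', v') \<in> ?N" for u' v'
      using aff_relationD(4)[OF D(1) uv', of u' "- v'"] that by (simp add: minus_add_distrib)
  qed
  show "single_valued ?N"
    by (rule single_valuedI) (use D(2) in \<open>auto dest: single_valuedD\<close>)
  have "?N = (\<lambda>z. (fst z, - snd z)) -` T" by auto
  moreover have "closed \<dots>"
    by (rule closed_vimage[OF D(3)]) (intro continuous_intros)
  ultimately show "closed ?N" by simp
  have "Domain ?N = Domain T" by (auto simp: Domain_iff) (metis minus_minus)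
  then show "l2 G \<subseteq> closure (Domain ?N)" using D(4) by simp
qed

lemma mem_adjoint: "(u, v) \<in> adjoint_operator G N \<longleftrightarrow>
    u \<in> l2 G \<and> v \<in> l2 G \<and> (\<forall>x y. (x, y) \<in> N \<longrightarrow> cinner y u = cinner x v)"
  unfolding adjoint_operator_def by auto

text \<open>Testing at \<open>(x, y)\<close> and at its multiple by \<open>\<i>\<close> recovers
  real and imaginary parts. The real form is the one that fits closures and orthogonal complements
  in the real inner product.\<close>

lemma mem_adjoint_real:
  assumes N: "aff_relation N"
  shows "(u, v) \<in> adjoint_operator G N \<longleftrightarrow>
    u \<in> l2 G \<and> v \<in> l2 G \<and> (\<forall>x y. (x, y) \<in> N \<longrightarrow> y \<bullet> u = x \<bullet> v)"
proof -
  have "cinner y u = cinner x v" if *: "\<And>x y. (x, y) \<in> N \<Longrightarrow> y \<bullet> u = x \<bullet> v" and xy: "(x, y) \<in> N" for x y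
  proof -
    have "Re (cinner y u) = Re (cinner x v)" using *[OF xy] by (simp add: inner_cinner)
    moreover have "Re (\<i> * cinner y u) = Re (\<i> * cinner x v)"
      using *[OF aff_relationD(5)[OF N xy, of \<i>]] by (simp only: inner_cinner cinner_scaleC_left)
    ultimately show ?thesis by (simp add: complex_eq_iff)
  qed
  then show ?thesis unfolding mem_adjoint by (auto simp: inner_cinner)
qed

lemma adjoint_closure:
  assumes N: "aff_relation N"
  shows "adjoint_operator G (closure N) = adjoint_operator G N"
proof -
  have "(\<forall>x y. (x, y) \<in> closure N \<longrightarrow> y \<bullet> u = x \<bullet> v) \<longleftrightarrow> (\<forall>x y. (x, y) \<in> N \<longrightarrow> y \<bullet> u = x \<bullet> v)" for u v
  proof
    assume "\<forall>x y. (x, y) \<in> N \<longrightarrow> y \<bullet> u = x \<bullet> v"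
    then have "N \<subseteq> {z. snd z \<bullet> u = fst z \<bullet> v}" by auto
    moreover have "closed {z. snd z \<bullet> u = fst z \<bullet> v}"
      by (intro closed_Collect_eq continuous_intros)
    ultimately have "closure N \<subseteq> {z. snd z \<bullet> u = fst z \<bullet> v}" by (rule closure_minimal)
    then show "\<forall>x y. (x, y) \<in> closure N \<longrightarrow> y \<bullet> u = x \<bullet> v" by auto
  qed (use closure_subset in blast)
  then have "z \<in> adjoint_operator G (closure N) \<longleftrightarrow> z \<in> adjoint_operator G N" for z
    by (cases z) (simp only: mem_adjoint_real[OF N] mem_adjoint_real[OF aff_relation_closure[OF N]])
  then show ?thesis by blast
qed

lemma star_in_carrier:
  assumes T: "T \<in> carrier U"
  shows "adjoint_operator G T \<in> carrier U"
  unfolding carrier_iff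
proof (intro conjI)
  note D = carrierD[OF T]
  let ?A = "adjoint_operator G T"
  show aff: "aff_relation ?A"
  proof (rule aff_relationI)
    show "(0, 0) \<in> ?A" unfolding mem_adjoint_real[OF D(1)] by (simp add: subspace_0[OF H.X.subspace])
    fix u v assume "(u, v) \<in> ?A"
    then have uv: "u \<in> l2 G" "v \<in> l2 G" "\<And>x y. (x, y) \<in> T \<Longrightarrow> cinner y u = cinner x v"
      unfolding mem_adjoint by blast+
    show "u \<in> l2 G \<and> v \<in> l2 G" using uv(1,2) ..
    show "(c *\<^sub>C u, c *\<^sub>C v) \<in> ?A" for c
      unfolding mem_adjoint cinner_scaleC_right by (simp add: uv(1,2) l2_scaleC) (simp add: uv(3))
    show "(V u, V v) \<in> ?A" if V: "V \<in> commuting_unitaries" for V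
      unfolding mem_adjoint
    proof (intro conjI allI impI unitary_in[OF V] uv(1,2))
      fix x y assume "(x, y) \<in> T"
      \<comment> \<open>\<open>V\<close> maps \<open>T\<close> onto itself, so a pair of
        \<open>T\<close> may be written as an image, and unitarity cancels \<open>V\<close>.\<close>
      then obtain x' y' where xy: "(x', y') \<in> T" and eq: "x = V x'" "y = V y'"
        by (rule aff_relation_unitary_image[OF D(1) V])
      show "cinner y (V u) = cinner x (V v)"
        unfolding eq using uv(3)[OF xy] aff_relationD(1,2)[OF D(1) xy] uv(1,2)
        by (simp only: unitary_cinner[OF V])
    qed
    fix u' v' assume "(u', v') \<in> ?A"
    then have uv': "u' \<in> l2 G" "v' \<in> l2 G" "\<And>x y. (x, y) \<in> T \<Longrightarrow> cinner y u' = cinner x v'"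
      unfolding mem_adjoint by blast+
    show "(u + u', v + v') \<in> ?A"
      unfolding mem_adjoint cinner_add_right using uv uv' by (simp add: l2_add)
  qed
  show "single_valued ?A"
  proof (rule single_valuedI_aff[OF aff])
    fix v assume "(0, v) \<in> ?A"
    then have v: "v \<in> l2 G" "\<And>x y. (x, y) \<in> T \<Longrightarrow> y \<bullet> 0 = x \<bullet> v"
      unfolding mem_adjoint_real[OF D(1)] by blast+
    show "v = 0"
      by (rule dense_orthogonal[OF D(4) v(1)]) (use v(2) in \<open>auto simp: inner_commute\<close>)
  qed
  have "?A = (l2 G \<times> l2 G) \<inter> (\<Inter>z\<in>T. {w. snd z \<bullet> fst w = fst z \<bullet> snd w})"
    by (auto simp: mem_adjoint_real[OF D(1)]) (use fst_conv snd_conv in metis)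
  moreover have "closed \<dots>"
    by (intro closed_Int closed_Times closed_INT ballI H.X.closed closed_Collect_eq continuous_intros)
  ultimately show "closed ?A" by simp
  \<comment> \<open>Sending \<open>(a, b)\<close> to \<open>(b, - a)\<close> carries the orthogonal
    complement of the graph into the adjoint, so the dense second coordinates lie in its
    domain.\<close>
  have "snd ` ((l2 G \<times> l2 G) \<inter> orthogonal_comp T) \<subseteq> Domain ?A"
  proof clarify
    fix a b assume ab: "(a, b) \<in> orthogonal_comp T" "a \<in> l2 G" "b \<in> l2 G"
    have "x \<bullet> a + y \<bullet> b = 0" if "(x, y) \<in> T" for x y
      using ab(1) that by (auto simp: orthogonal_comp_def orthogonal_def inner_prod_def)
    then have "(b, - a) \<in> ?A"
      unfolding mem_adjoint_real[OF D(1)] using ab(2,3)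
      by (simp add: subspace_neg[OF H.X.subspace] eq_neg_iff_add_eq_0 add.commute)
    then show "snd (a, b) \<in> Domain ?A" by auto
  qed
  then show "l2 G \<subseteq> closure (Domain ?A)"
    using H.dense_range_orthogonal[OF inv_operator_carrier[OF T]] closure_mono by blast
qed

text \<open>Inclusion in the double adjoint is formal; equality follows because both sides belong to
  the algebra, where no operator properly extends another.\<close>

lemma star_star:
  assumes T: "T \<in> carrier U"
  shows "adjoint_operator G (adjoint_operator G T) = T"
proof -
  note D = carrierD[OF T]
  have "T \<subseteq> adjoint_operator G (adjoint_operator G T)"
  proof (rule subrelI)
    fix u v assume uv: "(u, v) \<in> T"
    show "(u, v) \<in> adjoint_operator G (adjoint_operator G T)"
    proof (rule mem_adjoint[THEN iffD2], intro conjI allI impI aff_relationD(1,2)[OF D(1) uv])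
      fix x y assume "(x, y) \<in> adjoint_operator G T"
      then have "cinner v x = cinner u y" unfolding mem_adjoint using uv by blast
      then show "cinner y u = cinner x v" by (metis cinner_commute)
    qed
  qed
  then have "closure T = adjoint_operator G (adjoint_operator G T)"
    by (rule closure_eq_carrier[OF star_in_carrier[OF star_in_carrier[OF T]] _ D(1,4)])
  then show ?thesis using closure_closed[OF D(3)] by simp
qed

section \<open>Domains of naive composites and sums\<close>

lemma dense_relcomp3:
  assumes "R \<in> carrier U" "S \<in> carrier U" "T \<in> carrier U"
  shows "l2 G \<subseteq> closure (Domain (R O S O T))"
proof -
  have "{a. \<exists>b c d. (a, b) \<in> R \<and> (b, c) \<in> S \<and> (c, d) \<in> T} \<subseteq> Domain (R O S O T)" by blast
  then show ?thesis
    using H.dense_chain[OF assms[THEN inv_operator_carrier]] closure_mono by blast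
qed

lemma dense_relcomp:
  assumes "S \<in> carrier U" "T \<in> carrier U"
  shows "l2 G \<subseteq> closure (Domain (S O T))"
proof -
  have "Domain (S O T O Id_on (l2 G)) \<subseteq> Domain (S O T)" by blast
  then show ?thesis
    using dense_relcomp3[OF assms one_in_carrier] closure_mono by blast
qed

lemma dense_relsum3:
  assumes "R \<in> carrier U" "S \<in> carrier U" "T \<in> carrier U"
  shows "l2 G \<subseteq> closure (Domain (relsum (relsum R S) T))"
proof -
  have "{a. \<exists>b c d. (a, b) \<in> R \<and> (a, c) \<in> S \<and> (a, d) \<in> T} \<subseteq> Domain (relsum (relsum R S) T)"
    by (clarify, rule DomainI[OF relsumI[OF relsumI]])
  then show ?thesis
    using H.dense_fan[OF assms[THEN inv_operator_carrier]] closure_mono by blast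
qed

lemma dense_relsum:
  assumes "S \<in> carrier U" "T \<in> carrier U"
  shows "l2 G \<subseteq> closure (Domain (relsum S T))"
proof -
  have "Domain (relsum (relsum S T) (l2 G \<times> {0})) \<subseteq> Domain (relsum S T)"
    by (clarify, erule relsumE, rule DomainI)
  then show ?thesis
    using dense_relsum3[OF assms zero_in_carrier] closure_mono by blast
qed

lemma dense_relcomp_relsum:
  assumes "R \<in> carrier U" "S \<in> carrier U" "T \<in> carrier U"
  shows "l2 G \<subseteq> closure (Domain (R O relsum S T))"
proof -
  have "{a. \<exists>b c d. (a, b) \<in> R \<and> (b, c) \<in> S \<and> (b, d) \<in> T} \<subseteq> Domain (R O relsum S T)"
    by (clarify, rule DomainI[OF relcompI[OF _ relsumI]])
  then show ?thesis
    using H.dense_branch[OF assms[THEN inv_operator_carrier]] closure_mono by blast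
qed

text \<open>The product of the adjoints in reverse order is a formal adjoint of the product. As both
  naive composites are densely defined, this makes the composite closable; later it also yields
  \<open>star_mult\<close>.\<close>

lemma adjoint_relcomp_dual:
  assumes "(x, z) \<in> T O S" "(u, w) \<in> adjoint_operator G S O adjoint_operator G T"
  shows "cinner z u = cinner x w"
proof -
  obtain y where y: "(x, y) \<in> T" "(y, z) \<in> S" using assms(1) by (rule relcompEpair)
  obtain v where "(u, v) \<in> adjoint_operator G S" "(v, w) \<in> adjoint_operator G T"
    using assms(2) by (rule relcompEpair)
  then have "cinner z u = cinner y v" "cinner y v = cinner x w"
    using y unfolding mem_adjoint by blast+
  then show ?thesis by simp
qed

lemma adjoint_relsum_dual:
  assumes "(x, y) \<in> relsum S T" "(u, v) \<in> relsum (adjoint_operator G S) (adjoint_operator G T)"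
  shows "cinner y u = cinner x v"
proof -
  obtain y1 y2 where y: "y = y1 + y2" "(x, y1) \<in> S" "(x, y2) \<in> T" using assms(1) by (rule relsumE)
  obtain v1 v2 where v: "v = v1 + v2" "(u, v1) \<in> adjoint_operator G S" "(u, v2) \<in> adjoint_operator G T"
    using assms(2) by (rule relsumE)
  have "cinner y1 u = cinner x v1" "cinner y2 u = cinner x v2"
    using y v unfolding mem_adjoint by blast+
  then show ?thesis by (simp add: y v cinner_add_left cinner_add_right)
qed

lemma mult_in_carrier:
  assumes S: "S \<in> carrier U" and T: "T \<in> carrier U"
  shows "closure (T O S) \<in> carrier U"
  by (rule closure_in_carrier[OF aff_relation_relcomp[OF carrierD(1)[OF S] carrierD(1)[OF T]]
        dense_relcomp[OF T S] dense_relcomp[OF star_in_carrier[OF S] star_in_carrier[OF T]]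
        adjoint_relcomp_dual])

lemma add_in_carrier:
  assumes S: "S \<in> carrier U" and T: "T \<in> carrier U"
  shows "closure (relsum S T) \<in> carrier U"
  by (rule closure_in_carrier[OF aff_relation_relsum[OF carrierD(1)[OF S] carrierD(1)[OF T]]
        dense_relsum[OF S T] dense_relsum[OF star_in_carrier[OF S] star_in_carrier[OF T]]
        adjoint_relsum_dual])

end

section \<open>Moore--Penrose inverses in star-regular rings\<close>

text \<open>\<open>x \<otimes> s\<close> is the idempotent. A multiplicatively closed subset
  \<open>T\<close> is allowed so that the lemma serves both the ring of affiliated operators and the
  intersection of subrings.\<close>

lemma (in monoid) l_coset_inner_inverse:
  assumes T: "T \<subseteq> carrier G" and x: "x \<in> T" and s: "s \<in> T"
    and closed: "\<And>a b. a \<in> T \<Longrightarrow> b \<in> T \<Longrightarrow> a \<otimes> b \<in> T" and xsx: "x \<otimes> s \<otimes> x = x"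
  shows "x \<otimes> s \<in> T \<and> (x \<otimes> s) \<otimes> (x \<otimes> s) = x \<otimes> s \<and> x <# T = (x \<otimes> s) <# T"
proof (intro conjI equalityI subsetI)
  have c: "x \<in> carrier G" "s \<in> carrier G" using T x s by auto
  show "x \<otimes> s \<in> T" by (rule closed[OF x s])
  have "(x \<otimes> s) \<otimes> (x \<otimes> s) = (x \<otimes> s \<otimes> x) \<otimes> s" using c by (simp add: m_assoc)
  then show "(x \<otimes> s) \<otimes> (x \<otimes> s) = x \<otimes> s" by (simp only: xsx)
  fix z
  {
    assume "z \<in> x <# T"
    then obtain h where h: "h \<in> T" and z: "z = x \<otimes> h" unfolding l_coset_def by blast
    have "h \<in> carrier G" using h T by blast
    then have "(x \<otimes> s) \<otimes> (x \<otimes> h) = (x \<otimes> s \<otimes> x) \<otimes> h" using c by (simp add: m_assoc)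
    then have "z = (x \<otimes> s) \<otimes> (x \<otimes> h)" by (simp only: xsx z)
    then show "z \<in> (x \<otimes> s) <# T" unfolding l_coset_def using closed[OF x h] by blast
  next
    assume "z \<in> (x \<otimes> s) <# T"
    then obtain h where h: "h \<in> T" and z: "z = (x \<otimes> s) \<otimes> h" unfolding l_coset_def by blast
    have "h \<in> carrier G" using h T by blast
    then have "z = x \<otimes> (s \<otimes> h)" using c z by (simp add: m_assoc)
    then show "z \<in> x <# T" unfolding l_coset_def using closed[OF s h] by blast
  }
qed

text \<open>Penrose's four equations. The carrier occurs only in the membership of \<open>s\<close>,
  so a solution in a subring solves them in the whole ring.\<close>

definition mp_inverse :: "('a, 'm) star_ring_scheme \<Rightarrow> 'a \<Rightarrow> 'a \<Rightarrow> bool"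
  where "mp_inverse R x s \<longleftrightarrow> s \<in> carrier R \<and>
    x \<otimes>\<^bsub>R\<^esub> s \<otimes>\<^bsub>R\<^esub> x = x \<and> s \<otimes>\<^bsub>R\<^esub> x \<otimes>\<^bsub>R\<^esub> s = s \<and>
    star R (x \<otimes>\<^bsub>R\<^esub> s) = x \<otimes>\<^bsub>R\<^esub> s \<and> star R (s \<otimes>\<^bsub>R\<^esub> x) = s \<otimes>\<^bsub>R\<^esub> x"

lemma involutiveD:
  assumes "involutive R"
  shows "x \<in> carrier R \<Longrightarrow> star R x \<in> carrier R" "x \<in> carrier R \<Longrightarrow> star R (star R x) = x"
    "x \<in> carrier R \<Longrightarrow> y \<in> carrier R \<Longrightarrow> star R (x \<otimes>\<^bsub>R\<^esub> y) = star R y \<otimes>\<^bsub>R\<^esub> star R x"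
  using assms by (simp_all add: involutive_def)

text \<open>\<open>(x \<otimes> s) \<otimes> (x \<otimes> t) = x \<otimes> t\<close> by the inner
  equation, and the involution gives the product in the other order the same value; similarly for
  \<open>s \<otimes> x\<close> and \<open>t \<otimes> x\<close>. Hence
  \<open>s = s \<otimes> x \<otimes> t = t\<close>.\<close>

lemma mp_inverse_unique:
  fixes R (structure)
  assumes "ring R" and inv: "involutive R" and x: "x \<in> carrier R"
    and s: "mp_inverse R x s" and t: "mp_inverse R x t"
  shows "s = t"
proof -
  interpret ring R by fact
  note star = involutiveD[OF inv]
  have c: "s \<in> carrier R" "t \<in> carrier R" using s t by (simp_all add: mp_inverse_def)
  have S: "x \<otimes> s \<otimes> x = x" "s \<otimes> x \<otimes> s = s" "star R (x \<otimes> s) = x \<otimes> s" "star R (s \<otimes> x) = s \<otimes> x"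
    using s by (simp_all add: mp_inverse_def)
  have T: "x \<otimes> t \<otimes> x = x" "t \<otimes> x \<otimes> t = t" "star R (x \<otimes> t) = x \<otimes> t" "star R (t \<otimes> x) = t \<otimes> x"
    using t by (simp_all add: mp_inverse_def)
  have "(x \<otimes> t) \<otimes> (x \<otimes> s) = star R ((x \<otimes> s) \<otimes> (x \<otimes> t))"
    using x c by (simp add: star(3) S T)
  also have "(x \<otimes> s) \<otimes> (x \<otimes> t) = (x \<otimes> s \<otimes> x) \<otimes> t" using x c by (simp add: m_assoc)
  also have "star R \<dots> = x \<otimes> t" by (simp add: S T)
  finally have 1: "(x \<otimes> t) \<otimes> (x \<otimes> s) = x \<otimes> t" .
  have "(t \<otimes> x) \<otimes> (s \<otimes> x) = star R ((s \<otimes> x) \<otimes> (t \<otimes> x))"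
    using x c by (simp add: star(3) S T)
  also have "(s \<otimes> x) \<otimes> (t \<otimes> x) = s \<otimes> (x \<otimes> t \<otimes> x)" using x c by (simp add: m_assoc)
  also have "star R \<dots> = s \<otimes> x" by (simp add: S T)
  finally have 2: "(t \<otimes> x) \<otimes> (s \<otimes> x) = s \<otimes> x" .
  have "s = s \<otimes> (x \<otimes> t \<otimes> x) \<otimes> s" by (simp add: S T)
  also have "\<dots> = s \<otimes> ((x \<otimes> t) \<otimes> (x \<otimes> s))" using x c by (simp add: m_assoc)
  also have "\<dots> = (s \<otimes> x) \<otimes> t" using x c by (simp add: 1 m_assoc)
  also have "\<dots> = (t \<otimes> x) \<otimes> (s \<otimes> x) \<otimes> t" by (simp add: 2)
  also have "\<dots> = t \<otimes> (x \<otimes> s \<otimes> x) \<otimes> t" using x c by (simp add: m_assoc)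
  also have "\<dots> = t" by (simp add: S T)
  finally show ?thesis .
qed

lemma regular_ring_inner_inverse:
  fixes R (structure)
  assumes "regular_ring R" and z: "z \<in> carrier R"
  shows "\<exists>k\<in>carrier R. z \<otimes> k \<otimes> z = z"
proof -
  interpret ring R using assms by (simp add: regular_ring_def)
  obtain e where e: "e \<in> carrier R" "e \<otimes> e = e" "z <# carrier R = e <# carrier R"
    using assms by (auto simp: regular_ring_def)
  have "y \<in> y <# carrier R" if "y \<in> carrier R" for y
    unfolding l_coset_def by (rule UN_I[OF one_closed]) (simp add: r_one that)
  then have "z \<in> e <# carrier R" "e \<in> z <# carrier R" using e z by auto
  then obtain h k where h: "h \<in> carrier R" "z = e \<otimes> h" and k: "k \<in> carrier R" "e = z \<otimes> k"
    unfolding l_coset_def by blast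
  have "z \<otimes> k \<otimes> z = e \<otimes> (e \<otimes> h)" unfolding k(2)[symmetric] by (simp only: h(2)[symmetric])
  also have "\<dots> = z" using e h by (simp add: m_assoc[symmetric])
  finally show ?thesis using k by blast
qed

text \<open>Take an inner inverse \<open>k\<close> of \<open>star R x \<otimes> x\<close>. The
  failure \<open>x \<otimes> w\<close> of the claim is annihilated by \<open>star R x\<close>, hence
  by its own adjoint, so it vanishes by properness of the involution.\<close>

lemma star_regular_ring_left_inverse:
  fixes R (structure)
  assumes R: "star_regular_ring R" and x: "x \<in> carrier R"
  shows "\<exists>k\<in>carrier R. x \<otimes> k \<otimes> star R x \<otimes> x = x"
proof -
  interpret ring R using R by (simp add: star_regular_ring_def regular_ring_def)
  have "involutive R" using R by (simp add: star_regular_ring_def)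
  note star = involutiveD[OF this]
  have sx: "star R x \<in> carrier R" by (rule star(1)[OF x])
  obtain k where k: "k \<in> carrier R" and zkz: "(star R x \<otimes> x) \<otimes> k \<otimes> (star R x \<otimes> x) = star R x \<otimes> x"
    using regular_ring_inner_inverse[of R "star R x \<otimes> x"] R x sx by (auto simp: star_regular_ring_def)
  define w where "w = k \<otimes> star R x \<otimes> x \<ominus> \<one>"
  have w: "w \<in> carrier R" using x sx k by (simp add: w_def)
  have xw: "x \<otimes> w = x \<otimes> k \<otimes> star R x \<otimes> x \<ominus> x"
    using x sx k by (simp add: w_def minus_eq r_distr r_minus m_assoc)
  have "star R x \<otimes> (x \<otimes> w) = (star R x \<otimes> x) \<otimes> k \<otimes> (star R x \<otimes> x) \<ominus> star R x \<otimes> x"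
    unfolding xw using x sx k by (simp add: minus_eq r_distr r_minus m_assoc)
  also have "\<dots> = \<zero>" unfolding zkz using x sx by (simp add: minus_eq r_neg)
  finally have "star R (x \<otimes> w) \<otimes> (x \<otimes> w) = \<zero>"
    using x sx w star(1)[OF w] by (simp add: star(3) m_assoc)
  then have "x \<otimes> w = \<zero>" using R x w by (simp add: star_regular_ring_def)
  then have "x \<otimes> k \<otimes> star R x \<otimes> x = x" using xw x sx k by simp
  then show ?thesis using k by blast
qed

lemma mp_inverse_exists:
  fixes R (structure)
  assumes R: "star_regular_ring R" and x: "x \<in> carrier R"
  shows "\<exists>s. mp_inverse R x s"
proof -
  interpret ring R using R by (simp add: star_regular_ring_def regular_ring_def)
  have "involutive R" using R by (simp add: star_regular_ring_def)
  note star = involutiveD[OF this]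
  have sx: "star R x \<in> carrier R" by (rule star(1)[OF x])
  obtain k where k: "k \<in> carrier R" and xk: "x \<otimes> k \<otimes> star R x \<otimes> x = x"
    using star_regular_ring_left_inverse[OF R x] by blast
  obtain l where l: "l \<in> carrier R" and xl: "star R x \<otimes> l \<otimes> x \<otimes> star R x = star R x"
    using star_regular_ring_left_inverse[OF R sx] by (auto simp: star(2)[OF x])
  \<comment> \<open>\<open>p\<close> and \<open>q\<close> turn out to be the projections generating
    the right ideals of \<open>x\<close> and \<open>star R x\<close>; self-adjointness comes from
    \<open>p \<otimes> star R p = p\<close> and its analogue for \<open>q\<close>.\<close>
  define t p q where "t = k \<otimes> star R x" and "p = x \<otimes> t" and "q = star R x \<otimes> l \<otimes> x"
  have c: "t \<in> carrier R" "p \<in> carrier R" "q \<in> carrier R"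
    using x sx k l by (simp_all add: t_def p_def q_def)
  have sp: "star R p \<in> carrier R" and sq: "star R q \<in> carrier R" using c star(1) by auto
  have px: "p \<otimes> x = x" using xk x sx k by (simp add: p_def t_def m_assoc)
  have "star R x \<otimes> star R p = star R x" using star(3)[OF c(2) x] by (simp add: px)
  then have "p \<otimes> star R p = p" using x sx k sp by (simp add: p_def t_def m_assoc)
  then have p_star: "star R p = p" using star(3)[OF c(2) sp] star(2)[OF c(2)] by simp
  have "q \<otimes> star R x = star R x" using xl by (simp add: q_def)
  then have "x \<otimes> star R q = x" using star(3)[OF c(3) sx] star(2)[OF x] by simp
  then have "q \<otimes> star R q = q" using x sx l sq by (simp add: q_def m_assoc)
  then have q_star: "star R q = q" using star(3)[OF c(3) sq] star(2)[OF c(3)] by simp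
  then have xq: "x \<otimes> q = x" using \<open>x \<otimes> star R q = x\<close> by simp
  have pp: "p \<otimes> p = p" using \<open>p \<otimes> star R p = p\<close> p_star by simp
  have qq: "q \<otimes> q = q" using \<open>q \<otimes> star R q = q\<close> q_star by simp
  \<comment> \<open>Cutting the inner inverse \<open>t\<close> down by \<open>q\<close> and
    \<open>p\<close> makes both products with \<open>x\<close> projections:
    \<open>x \<otimes> s = p\<close> and \<open>s \<otimes> x = q\<close>.\<close>
  define s where "s = q \<otimes> t \<otimes> p"
  have s: "s \<in> carrier R" using c by (simp add: s_def)
  have "x \<otimes> s = (x \<otimes> q) \<otimes> t \<otimes> p" using x c by (simp add: s_def m_assoc)
  then have xs: "x \<otimes> s = p" by (simp add: xq p_def[symmetric] pp)
  have "s \<otimes> x = q \<otimes> t \<otimes> (p \<otimes> x)" using x c by (simp add: s_def m_assoc)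
  also have "\<dots> = star R x \<otimes> l \<otimes> (p \<otimes> x)" unfolding px using x sx l c by (simp add: q_def p_def m_assoc)
      (simp add: m_assoc[symmetric] p_def[symmetric] px)
  also have "\<dots> = q" by (simp add: px q_def)
  finally have sx': "s \<otimes> x = q" .
  have "q \<otimes> s = s" using c by (simp add: s_def m_assoc[symmetric] qq)
  then have "mp_inverse R x s"
    by (simp add: mp_inverse_def s xs sx' px p_star q_star)
  then show ?thesis by blast
qed

text \<open>Regularity does not pass to intersections by itself: inner inverses are not unique, and
  different \<open>S i\<close> may contain different ones. The Moore--Penrose inverse is a choice
  common to all. The factor \<open>carrier R\<close> gives the empty family its meaning.\<close>

lemma star_regular_subring_Inter:
  fixes R (structure)
  assumes R: "star_regular_ring R" and S: "\<And>i. i \<in> I \<Longrightarrow> star_regular_subring (S i) R"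
  shows "star_regular_subring (carrier R \<inter> (\<Inter>i\<in>I. S i)) R"
proof -
  interpret ring R using R by (simp add: star_regular_ring_def regular_ring_def)
  have inv: "involutive R" using R by (simp add: star_regular_ring_def)
  note star = involutiveD[OF inv]
  let ?T = "carrier R \<inter> (\<Inter>i\<in>I. S i)"
  have sub: "subring (S i) R" and S_star: "\<And>x. x \<in> S i \<Longrightarrow> star R x \<in> S i"
    and S_reg: "star_regular_ring (R\<lparr>carrier := S i\<rparr>)" if "i \<in> I" for i
    using S[OF that] by (simp_all add: star_regular_subring_def)
  have T: "subring ?T R"
    by (rule subringI) (auto dest: sub subringE)
  have T_star: "star R x \<in> ?T" if "x \<in> ?T" for x using that star(1) S_star by auto
  have mp: "\<exists>s\<in>?T. mp_inverse R x s" if x: "x \<in> ?T" for x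
  proof -
    obtain s where s: "mp_inverse R x s" using mp_inverse_exists[OF R] x by blast
    have "s \<in> S i" if i: "i \<in> I" for i
    proof -
      obtain t where t: "mp_inverse (R\<lparr>carrier := S i\<rparr>) x t"
        using mp_inverse_exists[OF S_reg[OF i]] x i by auto
      then have "mp_inverse R x t" "t \<in> S i"
        using subringE(1)[OF sub[OF i]] by (auto simp: mp_inverse_def)
      then show ?thesis using mp_inverse_unique[OF ring_axioms inv _ s] x by auto
    qed
    then show ?thesis using s by (auto simp: mp_inverse_def)
  qed
  have regular: "\<exists>e\<in>?T. e \<otimes> e = e \<and> x <# ?T = e <# ?T" if x: "x \<in> ?T" for x
  proof -
    obtain s where s: "s \<in> ?T" and "mp_inverse R x s" using mp[OF x] by blast
    then have xsx: "x \<otimes> s \<otimes> x = x" by (simp add: mp_inverse_def)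
    have "?T \<subseteq> carrier R" by blast
    from l_coset_inner_inverse[OF this x s subringE(6)[OF T] xsx]
    show ?thesis by blast
  qed
  have "ring (R\<lparr>carrier := ?T\<rparr>)" by (rule subring_is_ring[OF T])
  moreover have "involutive (R\<lparr>carrier := ?T\<rparr>)"
    using inv T_star by (simp add: involutive_def)
  moreover have "x = \<zero>" if "x \<in> ?T" "star R x \<otimes> x = \<zero>" for x
    using R that by (simp add: star_regular_ring_def)
  ultimately have "star_regular_ring (R\<lparr>carrier := ?T\<rparr>)"
    using regular by (simp add: star_regular_ring_def regular_ring_def l_coset_def)
  then show ?thesis using T T_star by (simp add: star_regular_subring_def)
qed

section \<open>The star-regular ring of affiliated operators\<close>

context affiliated_operators
begin

lemma closure_eqI:
  assumes "A \<in> carrier U" "B \<in> carrier U" "N \<subseteq> A" "N \<subseteq> B" "aff_relation N" "l2 G \<subseteq> closure (Domain N)"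
  shows "A = B"
  using closure_eq_carrier[of A N] closure_eq_carrier[of B N] assms by simp

lemma relsum_mono: "S \<subseteq> S' \<Longrightarrow> T \<subseteq> T' \<Longrightarrow> relsum S T \<subseteq> relsum S' T'"
  unfolding relsum_def by blast

lemma relsum_assoc: "relsum (relsum R S) T = relsum R (relsum S T)"
proof -
  have "(u, z) \<in> relsum (relsum R S) T \<longleftrightarrow> (\<exists>a b c. z = a + b + c \<and> (u, a) \<in> R \<and> (u, b) \<in> S \<and> (u, c) \<in> T)"
    for u z
    unfolding relsum_def by blast
  moreover have "(u, z) \<in> relsum R (relsum S T) \<longleftrightarrow> (\<exists>a b c. z = a + (b + c) \<and> (u, a) \<in> R \<and> (u, b) \<in> S \<and> (u, c) \<in> T)"
    for u z
    unfolding relsum_def by blast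
  ultimately show ?thesis by (simp add: set_eq_iff split_paired_All add.assoc)
qed

lemma relsum_commute: "relsum S T = relsum T S"
proof -
  have "relsum S T \<subseteq> relsum T S" for S T
  proof (rule subrelI, erule relsumE)
    fix u z v w assume "z = v + w" "(u, v) \<in> S" "(u, w) \<in> T"
    then show "(u, z) \<in> relsum T S" using relsumI[of u w T v S] by (simp add: add.commute)
  qed
  then show ?thesis by blast
qed

lemma mult_assoc:
  assumes "A \<in> carrier U" "B \<in> carrier U" "C \<in> carrier U"
  shows "closure (C O closure (B O A)) = closure (closure (C O B) O A)"
proof (rule closure_eqI)
  show "closure (C O closure (B O A)) \<in> carrier U" "closure (closure (C O B) O A) \<in> carrier U"
    by (intro mult_in_carrier assms)+
  show "C O B O A \<subseteq> closure (C O closure (B O A))"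
    by (rule order_trans[OF relcomp_mono[OF subset_refl closure_subset] closure_subset])
  show "C O B O A \<subseteq> closure (closure (C O B) O A)"
    unfolding O_assoc[symmetric]
    by (rule order_trans[OF relcomp_mono[OF closure_subset subset_refl] closure_subset])
  show "aff_relation (C O B O A)" by (intro aff_relation_relcomp carrierD(1) assms)
  show "l2 G \<subseteq> closure (Domain (C O B O A))" by (intro dense_relcomp3 assms)
qed

lemma add_assoc:
  assumes "A \<in> carrier U" "B \<in> carrier U" "C \<in> carrier U"
  shows "closure (relsum (closure (relsum A B)) C) = closure (relsum A (closure (relsum B C)))"
proof (rule closure_eqI)
  show "closure (relsum (closure (relsum A B)) C) \<in> carrier U"
    "closure (relsum A (closure (relsum B C))) \<in> carrier U"
    by (intro add_in_carrier assms)+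
  show "relsum (relsum A B) C \<subseteq> closure (relsum (closure (relsum A B)) C)"
    by (rule order_trans[OF relsum_mono[OF closure_subset subset_refl] closure_subset])
  show "relsum (relsum A B) C \<subseteq> closure (relsum A (closure (relsum B C)))"
    unfolding relsum_assoc
    by (rule order_trans[OF relsum_mono[OF subset_refl closure_subset] closure_subset])
  show "aff_relation (relsum (relsum A B) C)" by (intro aff_relation_relsum carrierD(1) assms)
  show "l2 G \<subseteq> closure (Domain (relsum (relsum A B) C))" by (intro dense_relsum3 assms)
qed

text \<open>Here the sum is applied after \<open>C\<close>: on the domain of the naive composite,
  \<open>A\<close> and \<open>B\<close> act on the same vector, so this composite is contained in
  the sum of the two composites.\<close>

lemma mult_add_distrib:
  assumes "A \<in> carrier U" "B \<in> carrier U" "C \<in> carrier U"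
  shows "closure (C O closure (relsum A B)) = closure (relsum (closure (C O A)) (closure (C O B)))"
proof (rule closure_eqI)
  show "closure (C O closure (relsum A B)) \<in> carrier U"
    "closure (relsum (closure (C O A)) (closure (C O B))) \<in> carrier U"
    by (intro mult_in_carrier add_in_carrier assms)+
  show "C O relsum A B \<subseteq> closure (C O closure (relsum A B))"
    by (rule order_trans[OF relcomp_mono[OF subset_refl closure_subset] closure_subset])
  have "C O relsum A B \<subseteq> relsum (C O A) (C O B)" unfolding relsum_def by blast
  also have "\<dots> \<subseteq> closure (relsum (closure (C O A)) (closure (C O B)))"
    by (rule order_trans[OF relsum_mono[OF closure_subset closure_subset] closure_subset])
  finally show "C O relsum A B \<subseteq> closure (relsum (closure (C O A)) (closure (C O B)))" .
  show "aff_relation (C O relsum A B)" by (intro aff_relation_relcomp aff_relation_relsum carrierD(1) assms)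
  show "l2 G \<subseteq> closure (Domain (C O relsum A B))" by (intro dense_relcomp_relsum assms)
qed

lemma star_add:
  assumes S: "S \<in> carrier U" and T: "T \<in> carrier U"
  shows "adjoint_operator G (closure (relsum S T))
    = closure (relsum (adjoint_operator G S) (adjoint_operator G T))"
proof (rule closure_eq_carrier[symmetric])
  have aff: "aff_relation (relsum S T)" by (intro aff_relation_relsum carrierD(1) S T)
  show "adjoint_operator G (closure (relsum S T)) \<in> carrier U"
    by (intro star_in_carrier add_in_carrier S T)
  show aff': "aff_relation (relsum (adjoint_operator G S) (adjoint_operator G T))"
    by (intro aff_relation_relsum carrierD(1) star_in_carrier S T)
  show "relsum (adjoint_operator G S) (adjoint_operator G T) \<subseteq> adjoint_operator G (closure (relsum S T))"
    unfolding adjoint_closure[OF aff]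
  proof (rule subrelI)
    fix u v assume uv: "(u, v) \<in> relsum (adjoint_operator G S) (adjoint_operator G T)"
    show "(u, v) \<in> adjoint_operator G (relsum S T)"
      using aff_relationD(1,2)[OF aff' uv] adjoint_relsum_dual[OF _ uv]
      by (intro mem_adjoint[THEN iffD2] conjI allI impI)
  qed
  show "l2 G \<subseteq> closure (Domain (relsum (adjoint_operator G S) (adjoint_operator G T)))"
    by (intro dense_relsum star_in_carrier S T)
qed

lemma star_mult:
  assumes S: "S \<in> carrier U" and T: "T \<in> carrier U"
  shows "adjoint_operator G (closure (T O S)) = closure (adjoint_operator G S O adjoint_operator G T)"
proof (rule closure_eq_carrier[symmetric])
  have aff: "aff_relation (T O S)" by (intro aff_relation_relcomp carrierD(1) S T)
  show "adjoint_operator G (closure (T O S)) \<in> carrier U"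
    by (intro star_in_carrier mult_in_carrier S T)
  show aff': "aff_relation (adjoint_operator G S O adjoint_operator G T)"
    by (intro aff_relation_relcomp carrierD(1) star_in_carrier S T)
  show "adjoint_operator G S O adjoint_operator G T \<subseteq> adjoint_operator G (closure (T O S))"
    unfolding adjoint_closure[OF aff]
  proof (rule subrelI)
    fix u v assume uv: "(u, v) \<in> adjoint_operator G S O adjoint_operator G T"
    show "(u, v) \<in> adjoint_operator G (T O S)"
      using aff_relationD(1,2)[OF aff' uv] adjoint_relcomp_dual[OF _ uv]
      by (intro mem_adjoint[THEN iffD2] conjI allI impI)
  qed
  show "l2 G \<subseteq> closure (Domain (adjoint_operator G S O adjoint_operator G T))"
    by (intro dense_relcomp star_in_carrier S T)
qed

lemma involutive_U: "involutive U"
  unfolding involutive_def U_simps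
  by (intro conjI ballI star_in_carrier star_star star_add star_mult)

lemma ring_U: "ring U"
proof (rule ringI)
  show "abelian_group U"
  proof (rule abelian_groupI)
    fix x y z assume x: "x \<in> carrier U" and y: "y \<in> carrier U"
    show "x \<oplus>\<^bsub>U\<^esub> y \<in> carrier U" unfolding U_simps by (intro add_in_carrier x y)
    show "x \<oplus>\<^bsub>U\<^esub> y = y \<oplus>\<^bsub>U\<^esub> x" unfolding U_simps by (subst relsum_commute) (rule refl)
    show "x \<oplus>\<^bsub>U\<^esub> y \<oplus>\<^bsub>U\<^esub> z = x \<oplus>\<^bsub>U\<^esub> (y \<oplus>\<^bsub>U\<^esub> z)" if "z \<in> carrier U"
      unfolding U_simps by (intro add_assoc x y that)
  next
    show "\<zero>\<^bsub>U\<^esub> \<in> carrier U" unfolding U_simps by (rule zero_in_carrier)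
  next
    fix x assume x: "x \<in> carrier U"
    note D = carrierD[OF x]
    have "relsum (l2 G \<times> {0}) x = x"
      using aff_relationD(1)[OF D(1)] by (force simp: relsum_def)
    then show "\<zero>\<^bsub>U\<^esub> \<oplus>\<^bsub>U\<^esub> x = x"
      unfolding U_simps using closure_closed[OF D(3)] by simp
    let ?y = "{(u, v). (u, - v) \<in> x}"
    have y: "?y \<in> carrier U" by (rule uminus_in_carrier[OF x])
    have "relsum ?y x \<subseteq> l2 G \<times> {0}"
    proof (rule subrelI, erule relsumE)
      fix u z v w assume z: "z = v + w" and v: "(u, v) \<in> ?y" and w: "(u, w) \<in> x"
      have "- v = w" using single_valuedD[OF D(2)] v w by blast
      then show "(u, z) \<in> l2 G \<times> {0}" using aff_relationD(1)[OF D(1) w] z by auto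
    qed
    then have "closure (relsum ?y x) = l2 G \<times> {0}"
      by (intro closure_eq_carrier zero_in_carrier aff_relation_relsum carrierD(1) dense_relsum x y)
    then show "\<exists>y\<in>carrier U. y \<oplus>\<^bsub>U\<^esub> x = \<zero>\<^bsub>U\<^esub>"
      unfolding U_simps using y by (intro bexI[of _ ?y])
  qed
  show "monoid U"
  proof (rule monoidI)
    fix x y z assume x: "x \<in> carrier U"
    note D = carrierD[OF x]
    show "x \<otimes>\<^bsub>U\<^esub> y \<in> carrier U" if "y \<in> carrier U" unfolding U_simps by (intro mult_in_carrier x that)
    show "x \<otimes>\<^bsub>U\<^esub> y \<otimes>\<^bsub>U\<^esub> z = x \<otimes>\<^bsub>U\<^esub> (y \<otimes>\<^bsub>U\<^esub> z)" if "y \<in> carrier U" "z \<in> carrier U"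
      unfolding U_simps by (intro mult_assoc x that)
    have "x O Id_on (l2 G) = x" "Id_on (l2 G) O x = x"
      using aff_relationD(1,2)[OF D(1)] by auto
    then show "\<one>\<^bsub>U\<^esub> \<otimes>\<^bsub>U\<^esub> x = x" "x \<otimes>\<^bsub>U\<^esub> \<one>\<^bsub>U\<^esub> = x"
      unfolding U_simps using closure_closed[OF D(3)] by simp_all
  next
    show "\<one>\<^bsub>U\<^esub> \<in> carrier U" unfolding U_simps by (rule one_in_carrier)
  qed
  fix x y z assume x: "x \<in> carrier U" and y: "y \<in> carrier U" and z: "z \<in> carrier U"
  show "(x \<oplus>\<^bsub>U\<^esub> y) \<otimes>\<^bsub>U\<^esub> z = x \<otimes>\<^bsub>U\<^esub> z \<oplus>\<^bsub>U\<^esub> y \<otimes>\<^bsub>U\<^esub> z"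
    unfolding U_simps by (intro mult_add_distrib x y z)
  \<comment> \<open>The other distributive law is transported by the involution, which reverses
    products; directly, the naive sum of the two products would give four equations in five
    unknowns.\<close>
  let ?s = "adjoint_operator G"
  have s: "?s x \<in> carrier U" "?s y \<in> carrier U" "?s z \<in> carrier U"
    by (intro star_in_carrier x y z)+
  have "?s (closure (closure (relsum x y) O z)) = closure (?s z O closure (relsum (?s x) (?s y)))"
    unfolding star_mult[OF z add_in_carrier[OF x y]] star_add[OF x y] ..
  also have "\<dots> = closure (relsum (closure (?s z O ?s x)) (closure (?s z O ?s y)))"
    by (rule mult_add_distrib[OF s])
  also have "\<dots> = ?s (closure (relsum (closure (x O z)) (closure (y O z))))"
    unfolding star_add[OF mult_in_carrier[OF z x] mult_in_carrier[OF z y]]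
      star_mult[OF z x] star_mult[OF z y] ..
  finally have "?s (?s (closure (closure (relsum x y) O z)))
      = ?s (?s (closure (relsum (closure (x O z)) (closure (y O z)))))"
    by (rule arg_cong)
  then show "z \<otimes>\<^bsub>U\<^esub> (x \<oplus>\<^bsub>U\<^esub> y) = z \<otimes>\<^bsub>U\<^esub> x \<oplus>\<^bsub>U\<^esub> z \<otimes>\<^bsub>U\<^esub> y"
    unfolding U_simps
      star_star[OF mult_in_carrier[OF z add_in_carrier[OF x y]]]
      star_star[OF add_in_carrier[OF mult_in_carrier[OF z x] mult_in_carrier[OF z y]]] .
qed

section \<open>Properness of the involution and von Neumann regularity\<close>

lemma aff_relation_Int:
  assumes M: "aff_relation M" and N: "aff_relation N"
  shows "aff_relation (M \<inter> N)"
proof (rule aff_relationI)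
  show "(0, 0) \<in> M \<inter> N" using aff_relationD(3)[OF M] aff_relationD(3)[OF N] ..
  fix u v assume "(u, v) \<in> M \<inter> N"
  then have uv: "(u, v) \<in> M" "(u, v) \<in> N" by auto
  show "u \<in> l2 G \<and> v \<in> l2 G" using aff_relationD(1,2)[OF M uv(1)] ..
  show "(c *\<^sub>C u, c *\<^sub>C v) \<in> M \<inter> N" for c
    using aff_relationD(5)[OF M uv(1)] aff_relationD(5)[OF N uv(2)] ..
  show "(V u, V v) \<in> M \<inter> N" if "V \<in> commuting_unitaries" for V
    using aff_relationD(6)[OF M that uv(1)] aff_relationD(6)[OF N that uv(2)] ..
  fix u' v' assume "(u', v') \<in> M \<inter> N"
  then have uv': "(u', v') \<in> M" "(u', v') \<in> N" by auto
  show "(u + u', v + v') \<in> M \<inter> N"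
    using aff_relationD(4)[OF M uv(1) uv'(1)] aff_relationD(4)[OF N uv(2) uv'(2)] ..
qed

text \<open>Where the naive composite is defined at \<open>u\<close>, the squared norm of the value
  of \<open>x\<close> is the inner product of \<open>u\<close> with 0. So \<open>x\<close> agrees
  with the zero operator on a dense domain.\<close>

lemma star_mult_self_eq_zero:
  assumes x: "x \<in> carrier U" and zero: "closure (x O adjoint_operator G x) = l2 G \<times> {0}"
  shows "x = l2 G \<times> {0}"
proof (rule closure_eqI[OF x zero_in_carrier])
  note D = carrierD[OF x] and Z = carrierD[OF zero_in_carrier]
  let ?N = "x \<inter> (l2 G \<times> {0})"
  show "?N \<subseteq> x" "?N \<subseteq> l2 G \<times> {0}" by auto
  show "aff_relation ?N"
    by (intro aff_relation_Int D(1) Z(1))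
  have "Domain (x O adjoint_operator G x) \<subseteq> Domain ?N"
  proof
    fix u assume "u \<in> Domain (x O adjoint_operator G x)"
    then obtain w where "(u, w) \<in> x O adjoint_operator G x" by (rule DomainE)
    then obtain v where v: "(u, v) \<in> x" and w: "(v, w) \<in> adjoint_operator G x" by (rule relcompEpair)
    have "(u, w) \<in> closure (x O adjoint_operator G x)"
      by (rule subsetD[OF closure_subset relcompI[OF v w]])
    then have "w = 0" unfolding zero by simp
    then have "cinner v v = cinner u 0" using v w unfolding mem_adjoint by blast
    then have "cinner v v = 0" by (simp add: cinner_def)
    then have "v = 0" by (simp add: cinner_self)
    then show "u \<in> Domain ?N" using v aff_relationD(1)[OF D(1) v] by blast
  qed
  then show "l2 G \<subseteq> closure (Domain ?N)"
    using dense_relcomp[OF x star_in_carrier[OF x]] closure_mono by blast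
qed

text \<open>Encoding \<open>A\<close> as the relation \<open>{0} \<times> A\<close> makes complex
  linearity and invariance under the commuting unitaries instances of what is known for
  relations.\<close>

definition aff_subspace :: "'a ell2 set \<Rightarrow> bool"
  where "aff_subspace A \<longleftrightarrow> closed A \<and> aff_relation ({0} \<times> A)"

lemma aff_subspaceD:
  assumes "aff_subspace A"
  shows "closed_subspace A" "v \<in> A \<Longrightarrow> v \<in> l2 G" "v \<in> A \<Longrightarrow> c *\<^sub>C v \<in> A"
    "V \<in> commuting_unitaries \<Longrightarrow> v \<in> A \<Longrightarrow> V v \<in> A"
    "V \<in> commuting_unitaries \<Longrightarrow> v \<in> A \<Longrightarrow> \<exists>w\<in>A. v = V w"
proof -
  have N: "aff_relation ({0} \<times> A)" and closed: "closed A" using assms by (simp_all add: aff_subspace_def)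
  have "A = snd ` ({0 :: 'a ell2} \<times> A)" by force
  then have "subspace A"
    using linear_subspace_image[OF linear_snd aff_relation_subspace[OF N]] by simp
  then show "closed_subspace A" using closed by (simp add: closed_subspace_def)
  have mem: "(0, v) \<in> {0 :: 'a ell2} \<times> A" if "v \<in> A" for v using that by simp
  show "v \<in> A \<Longrightarrow> v \<in> l2 G" using aff_relationD(2)[OF N mem] .
  show "v \<in> A \<Longrightarrow> c *\<^sub>C v \<in> A" using aff_relationD(5)[OF N mem] by blast
  show "V \<in> commuting_unitaries \<Longrightarrow> v \<in> A \<Longrightarrow> V v \<in> A" using aff_relationD(6)[OF N _ mem] by blast
  show "V \<in> commuting_unitaries \<Longrightarrow> v \<in> A \<Longrightarrow> \<exists>w\<in>A. v = V w"
    using aff_relation_unitary_image[OF N _ mem] by (metis SigmaD2)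
qed

lemma aff_subspace_orthogonal:
  assumes A: "aff_subspace A" and v: "v \<in> l2 G" "v \<in> orthogonal_comp A"
  shows "c *\<^sub>C v \<in> orthogonal_comp A"
    "V \<in> commuting_unitaries \<Longrightarrow> V v \<in> orthogonal_comp A"
proof -
  have orth: "w \<in> orthogonal_comp A \<longleftrightarrow> (\<forall>k\<in>A. w \<bullet> k = 0)" for w
    by (simp add: orthogonal_comp_def orthogonal_def inner_commute)
  show "c *\<^sub>C v \<in> orthogonal_comp A"
    unfolding orth
  proof
    fix k assume "k \<in> A"
    then have "v \<bullet> (cnj c *\<^sub>C k) = 0" using v(2) aff_subspaceD(3)[OF A] unfolding orth by blast
    then show "(c *\<^sub>C v) \<bullet> k = 0"
      by (simp only: inner_cinner cinner_scaleC_left cinner_scaleC_right complex_cnj_cnj)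
  qed
  show "V v \<in> orthogonal_comp A" if V: "V \<in> commuting_unitaries"
    unfolding orth
  proof
    fix k assume "k \<in> A"
    then obtain k' where k': "k' \<in> A" and k: "k = V k'" using aff_subspaceD(5)[OF A V] by blast
    show "V v \<bullet> k = 0"
      unfolding k unitary_inner[OF V v(1) aff_subspaceD(2)[OF A k']] using v(2) k' unfolding orth by blast
  qed
qed

text \<open>The projection is defined through the real inner product. It respects complex scalars
  and unitaries because these preserve both \<open>A\<close> and its orthogonal complement in
  \<open>l2 G\<close>.\<close>

lemma proj_aff_subspace:
  assumes A: "aff_subspace A" and u: "u \<in> l2 G"
  shows "proj A (c *\<^sub>C u) = c *\<^sub>C proj A u"
    "V \<in> commuting_unitaries \<Longrightarrow> proj A (V u) = V (proj A u)"
proof -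
  interpret A: closed_subspace A by (rule aff_subspaceD(1)[OF A])
  have p: "proj A u \<in> l2 G" by (rule aff_subspaceD(2)[OF A A.proj_in])
  have d: "u - proj A u \<in> l2 G" by (rule subspace_diff[OF H.X.subspace u p])
  have orth: "w \<in> orthogonal_comp A \<longleftrightarrow> (\<forall>k\<in>A. w \<bullet> k = 0)" for w
    by (simp add: orthogonal_comp_def orthogonal_def inner_commute)
  have d_orth: "u - proj A u \<in> orthogonal_comp A" unfolding orth using A.proj_orth by blast
  show "proj A (c *\<^sub>C u) = c *\<^sub>C proj A u"
  proof (rule A.proj_eqI)
    show "c *\<^sub>C proj A u \<in> A" by (rule aff_subspaceD(3)[OF A A.proj_in])
    have eq: "c *\<^sub>C u - c *\<^sub>C proj A u = c *\<^sub>C (u - proj A u)"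
      by (rule ell2_eqI) (simp add: algebra_simps)
    show "(c *\<^sub>C u - c *\<^sub>C proj A u) \<bullet> k = 0" if "k \<in> A" for k
      unfolding eq using aff_subspace_orthogonal(1)[OF A d d_orth] that unfolding orth by blast
  qed
  show "proj A (V u) = V (proj A u)" if V: "V \<in> commuting_unitaries"
  proof (rule A.proj_eqI)
    show "V (proj A u) \<in> A" by (rule aff_subspaceD(4)[OF A V A.proj_in])
    show "(V u - V (proj A u)) \<bullet> k = 0" if "k \<in> A" for k
      unfolding unitary_diff[OF V u p, symmetric]
      using aff_subspace_orthogonal(2)[OF A d d_orth V] that unfolding orth by blast
  qed
qed

text \<open>
  The inner inverse sends \<open>u\<close> to the solution \<open>v\<close> of \<open>x v = P u\<close> orthogonal to the kernel of
  \<open>x\<close>, where \<open>P\<close> is the projection onto the closure of the range of \<open>x\<close>.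
\<close>

lemma inner_inverse_exists:
  assumes x: "x \<in> carrier U"
  shows "\<exists>y\<in>carrier U. closure (x O closure (y O x)) = x"
proof -
  note D = carrierD[OF x]
  define K M where "K = closure (Range x)" and "M = {v. (v, 0) \<in> x}"
  have "aff_relation ({0} \<times> Range x)"
  proof (rule aff_relationI)
    show "(0, 0) \<in> {0} \<times> Range x" using aff_relationD(3)[OF D(1)] by blast
    fix u v assume "(u, v) \<in> {0 :: 'a ell2} \<times> Range x"
    then obtain w where u: "u = 0" and w: "(w, v) \<in> x" by blast
    show "u \<in> l2 G \<and> v \<in> l2 G" using u aff_relationD(2)[OF D(1) w] subspace_0[OF H.X.subspace] by simp
    show "(c *\<^sub>C u, c *\<^sub>C v) \<in> {0} \<times> Range x" for c
      using u aff_relationD(5)[OF D(1) w, of c] by auto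
    show "(V u, V v) \<in> {0} \<times> Range x" if "V \<in> commuting_unitaries" for V
      using u aff_relationD(6)[OF D(1) that w] unitary_zero[OF that] by auto
    fix u' v' assume "(u', v') \<in> {0 :: 'a ell2} \<times> Range x"
    then obtain w' where u': "u' = 0" and w': "(w', v') \<in> x" by blast
    show "(u + u', v + v') \<in> {0} \<times> Range x"
      using u u' aff_relationD(4)[OF D(1) w w'] by auto
  qed
  then have K: "aff_subspace K"
    using aff_relation_closure[of "{0} \<times> Range x"] by (simp add: aff_subspace_def K_def closure_Times)
  have M: "aff_subspace M"
    unfolding aff_subspace_def
  proof
    have "M = (\<lambda>v. (v, 0)) -` x" by (auto simp: M_def)
    moreover have "closed \<dots>" by (rule closed_vimage[OF D(3)]) (intro continuous_intros)
    ultimately show "closed M" by simp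
    show "aff_relation ({0} \<times> M)"
    proof (rule aff_relationI)
      show "(0, 0) \<in> {0} \<times> M" using aff_relationD(3)[OF D(1)] by (simp add: M_def)
      fix u v assume "(u, v) \<in> {0 :: 'a ell2} \<times> M"
      then have u: "u = 0" and v: "(v, 0) \<in> x" by (auto simp: M_def)
      show "u \<in> l2 G \<and> v \<in> l2 G" using u aff_relationD(1)[OF D(1) v] subspace_0[OF H.X.subspace] by simp
      show "(c *\<^sub>C u, c *\<^sub>C v) \<in> {0} \<times> M" for c
        using u aff_relationD(5)[OF D(1) v, of c] by (simp add: M_def)
      show "(V u, V v) \<in> {0} \<times> M" if "V \<in> commuting_unitaries" for V
        using u aff_relationD(6)[OF D(1) that v] unitary_zero[OF that] by (simp add: M_def)
      fix u' v' assume "(u', v') \<in> {0 :: 'a ell2} \<times> M"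
      then have u': "u' = 0" and v': "(v', 0) \<in> x" by (auto simp: M_def)
      show "(u + u', v + v') \<in> {0} \<times> M"
        using u u' aff_relationD(4)[OF D(1) v v'] by (simp add: M_def)
    qed
  qed
  interpret K: closed_subspace K by (rule aff_subspaceD(1)[OF K])
  interpret M: closed_subspace M by (rule aff_subspaceD(1)[OF M])
  interpret MO: closed_subspace "orthogonal_comp M" by (rule closed_subspace_orthogonal_comp)
  \<comment> \<open>Phrasing the inverse as a membership in \<open>x\<close> makes \<open>y\<close>
    closed, as part of the preimage of a closed graph under a continuous map, even where the inverse
    is unbounded.\<close>
  define y where "y = {(u, v). u \<in> l2 G \<and> v \<in> l2 G \<and> v \<in> orthogonal_comp M \<and> (v, proj K u) \<in> x}"
  have mem_y: "(u, v) \<in> y \<longleftrightarrow> u \<in> l2 G \<and> v \<in> l2 G \<and> v \<in> orthogonal_comp M \<and> (v, proj K u) \<in> x" for u v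
    by (simp add: y_def)
  have aff_y: "aff_relation y"
  proof (rule aff_relationI)
    show "(0, 0) \<in> y"
      unfolding mem_y linear_0[OF K.linear_proj]
      using aff_relationD(3)[OF D(1)] subspace_0[OF H.X.subspace] subspace_0[OF MO.subspace] by blast
    fix u v assume "(u, v) \<in> y"
    then have uv: "u \<in> l2 G" "v \<in> l2 G" "v \<in> orthogonal_comp M" "(v, proj K u) \<in> x"
      unfolding mem_y by blast+
    show "u \<in> l2 G \<and> v \<in> l2 G" using uv(1,2) ..
    show "(c *\<^sub>C u, c *\<^sub>C v) \<in> y" for c
      unfolding mem_y proj_aff_subspace(1)[OF K uv(1)]
      by (intro conjI l2_scaleC uv(1,2) aff_subspace_orthogonal(1)[OF M uv(2,3)] aff_relationD(5)[OF D(1) uv(4)])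
    show "(V u, V v) \<in> y" if V: "V \<in> commuting_unitaries" for V
      unfolding mem_y proj_aff_subspace(2)[OF K uv(1) V]
      by (intro conjI unitary_in[OF V] uv(1,2) aff_subspace_orthogonal(2)[OF M uv(2,3) V]
          aff_relationD(6)[OF D(1) V uv(4)])
    fix u' v' assume "(u', v') \<in> y"
    then have uv': "u' \<in> l2 G" "v' \<in> l2 G" "v' \<in> orthogonal_comp M" "(v', proj K u') \<in> x"
      unfolding mem_y by blast+
    show "(u + u', v + v') \<in> y"
      unfolding mem_y linear_add[OF K.linear_proj]
      by (intro conjI l2_add uv(1,2) uv'(1,2) subspace_add[OF MO.subspace uv(3) uv'(3)]
          aff_relationD(4)[OF D(1) uv(4) uv'(4)])
  qed
  have "y \<in> carrier U"
    unfolding carrier_iff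
  proof (intro conjI aff_y)
    show "single_valued y"
    proof (rule single_valuedI_aff[OF aff_y])
      fix v assume "(0, v) \<in> y"
      then have "v \<in> orthogonal_comp M" "v \<in> M"
        unfolding mem_y linear_0[OF K.linear_proj] by (auto simp: M_def)
      then show "v = 0" by (auto simp: orthogonal_comp_def orthogonal_def)
    qed
    have "y = (l2 G \<times> (l2 G \<inter> orthogonal_comp M)) \<inter> (\<lambda>z. (snd z, proj K (fst z))) -` x"
      by (auto simp: y_def)
    moreover have "closed ((\<lambda>z. (snd z, proj K (fst z))) -` x)"
      by (rule closed_vimage[OF D(3)])
        (intro continuous_on_Pair continuous_on_compose2[OF K.continuous_proj[of UNIV]] continuous_intros subset_UNIV)
    ultimately show "closed y"
      by (simp add: closed_Int closed_Times H.X.closed MO.closed)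
    show "l2 G \<subseteq> closure (Domain y)"
    proof
      fix u assume u: "u \<in> l2 G"
      show "u \<in> closure (Domain y)"
        unfolding closure_approachable
      proof (intro allI impI)
        fix e :: real assume "e > 0"
        then obtain a where "a \<in> Range x" and a: "dist a (proj K u) < e"
          using K.proj_in[of u] unfolding K_def closure_approachable by blast
        then obtain w where w: "(w, a) \<in> x" by blast
        \<comment> \<open>Removing the kernel part of \<open>w\<close> keeps the value
          \<open>a\<close>, and replacing the \<open>K\<close>-part of \<open>u\<close> by the
          nearby \<open>a\<close> gives a point of the domain of \<open>y\<close> close to
          \<open>u\<close>.\<close>
        let ?v = "w - proj M w" and ?u = "a + (u - proj K u)"
        have "(proj M w, 0) \<in> x" using M.proj_in[of w] by (simp add: M_def)
        then have va: "(?v, a) \<in> x" using aff_relation_diff[OF D(1) w] by fastforce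
        have "?v \<in> orthogonal_comp M"
          using M.proj_orth[of _ w] by (simp add: orthogonal_comp_def orthogonal_def inner_commute[of _ "w - proj M w"])
        moreover have aK: "a \<in> K" unfolding K_def by (rule subsetD[OF closure_subset RangeI[OF w]])
        have "proj K ?u = a"
          by (simp add: linear_add[OF K.linear_proj] linear_diff[OF K.linear_proj] K.proj_id[OF aK]
              K.proj_id[OF K.proj_in])
        moreover have "?u \<in> l2 G"
          by (rule l2_add[OF aff_subspaceD(2)[OF K aK]
              subspace_diff[OF H.X.subspace u aff_subspaceD(2)[OF K K.proj_in]]])
        moreover have "?v \<in> l2 G" by (rule aff_relationD(1)[OF D(1) va])
        ultimately have "(?u, ?v) \<in> y" unfolding mem_y using va by simp
        moreover have "dist ?u u < e" using a by (simp add: dist_norm algebra_simps)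
        ultimately show "\<exists>z\<in>Domain y. dist z u < e" by blast
      qed
    qed
  qed
  \<comment> \<open>A value \<open>v\<close> of \<open>x\<close> lies in \<open>K\<close>, so the
    condition defining \<open>y\<close> reads \<open>(w, v) \<in> x\<close>: applying
    \<open>y\<close> and then \<open>x\<close> returns \<open>v\<close>.\<close>
  moreover have "x O y O x \<subseteq> x"
  proof (rule subrelI)
    fix u z assume "(u, z) \<in> x O y O x"
    then obtain v where uv: "(u, v) \<in> x" and "(v, z) \<in> y O x" by (rule relcompEpair)
    then obtain w where vw: "(v, w) \<in> y" and wz: "(w, z) \<in> x" by (metis relcompEpair)
    have "v \<in> K" unfolding K_def by (rule subsetD[OF closure_subset RangeI[OF uv]])
    then have "(w, v) \<in> x" using vw K.proj_id unfolding mem_y by simp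
    then have "z = v" using single_valuedD[OF D(2) wz] by blast
    then show "(u, z) \<in> x" using uv by simp
  qed
  moreover have "x O y O x \<subseteq> closure (x O closure (y O x))"
    by (rule order_trans[OF relcomp_mono[OF subset_refl closure_subset] closure_subset])
  ultimately have "closure (x O closure (y O x)) = x"
    by (intro closure_eqI[of _ _ "x O y O x"] mult_in_carrier x aff_relation_relcomp aff_y D(1) dense_relcomp3)
  then show ?thesis using \<open>y \<in> carrier U\<close> by blast
qed

theorem star_regular_ring_U: "star_regular_ring U"
proof -
  interpret U: ring U by (rule ring_U)
  have "\<exists>e\<in>carrier U. e \<otimes>\<^bsub>U\<^esub> e = e \<and> x <#\<^bsub>U\<^esub> carrier U = e <#\<^bsub>U\<^esub> carrier U"
    if x: "x \<in> carrier U" for x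
  proof -
    obtain y where y: "y \<in> carrier U" and xyx: "x \<otimes>\<^bsub>U\<^esub> y \<otimes>\<^bsub>U\<^esub> x = x"
      using inner_inverse_exists[OF x] unfolding U_simps by blast
    show ?thesis
      using U.l_coset_inner_inverse[OF subset_refl x y U.m_closed xyx] by blast
  qed
  then show ?thesis
    using ring_U involutive_U star_mult_self_eq_zero
    by (simp add: star_regular_ring_def regular_ring_def U_simps)
qed

end

theorem proposition3p1:
  fixes G :: "('a, 'b) monoid_scheme"
    and I :: "'i set"
    and R :: "'i \<Rightarrow> ('a ell2 \<times> 'a ell2) set set"
  assumes "group G"
    and "\<And>i. i \<in> I \<Longrightarrow> star_regular_subring (R i) (affiliated_algebra G)"
  shows "star_regular_subring (carrier (affiliated_algebra G) \<inter> (\<Inter>i\<in>I. R i)) (affiliated_algebra G)"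
proof -
  interpret affiliated_operators G by (simp add: affiliated_operators_def assms(1))
  show ?thesis by (rule star_regular_subring_Inter[OF star_regular_ring_U assms(2)])
qed

end
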